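(* Let $\varphi:\mathbb{R}^n\to\overline{\mathbb{R}}$ be finite at $\bar x\in\mathbb{R}^n$ and have the composite representation $\varphi=g\circ\Phi$ around $\bar x$. Let $\bar v\in\partial\varphi(\bar x)$ and $\bar\lambda\in\Lambda(\bar x,\bar v)$. If the second-order qualification condition (SOQC) holds at $(\bar x,\bar\lambda)$, then for all $w\in\mathbb{R}^n$ $$ \mathrm{d}_s^2\varphi(\bar x,\bar v)(w)=\langle\bar\lambda,\nabla^2\Phi(\bar x)(w,w)\rangle+\mathrm{d}_s^2 g(\Phi(\bar x),\bar\lambda)(\nabla\Phi(\bar x)w), $$ with $\mathrm{d}_s^2 g(\Phi(\bar x),\bar\lambda)(u)=\delta_{\mathrm{span}\{K_g(\Phi(\bar x),\bar\lambda)\}}(u)$ for all $u\in\mathbb{R}^m$.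
   Context: $\overline{\mathbb{R}}=[-\infty,\infty]$. "$\varphi$ has the composite representation around $\bar x$" means: there are a neighborhood $O$ of $\bar x$, a mapping $\Phi:\mathbb{R}^n\to\mathbb{R}^m$ twice continuously differentiable around $\bar x$, and a polyhedral function $g:\mathbb{R}^m\to\overline{\mathbb{R}}$ (proper, with $\mathrm{epi}\,g$ a polyhedral convex set) such that $\varphi(x)=g(\Phi(x))$ for all $x\in O$. $\nabla\Phi(x)$ is the Jacobian, $\nabla\Phi(x)^*$ its transpose, and $\nabla^2\Phi(x)(w,w)\in\mathbb{R}^m$ has components $\langle\nabla^2\Phi_i(x)w,w\rangle$. Tangent cone: $T_\Omega(\bar x)=\limsup_{t\searrow0}(\Omega-\bar x)/t$. Regular normal cone: $\widehat N_\Omega(\bar x)=T_\Omega(\bar x)^*$ (polar cone). Limiting normal cone $N_\Omega(\bar x)$: all limits of $v^k\in\widehat N_\Omega(x^k)$ with $x^k\to\bar x$, $x^k\in\Omega$. Subdifferential: $\partial f(\bar x)=\{v : (v,-1)\in N_{\mathrm{epi} f}(\bar x,f(\bar x))\}$. Coderivative of $F$: $w\in D^*F(\bar x,\bar y)(u)\iff(w,-u)\in N_{\mathrm{gph}F}(\bar x,\bar y)$. Multipliers: $\Lambda(x,v)=\{\lambda\in\mathbb{R}^m : \nabla\Phi(x)^*\lambda=v,\ \lambda\in\partial g(\Phi(x))\}$. SOQC at $(\bar x,\bar\lambda)$: $D^*(\partial g)(\Phi(\bar x),\bar\lambda)(0)\cap\ker\nabla\Phi(\bar x)^*=\{0\}$.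 Subderivative: $\mathrm{d}f(\bar x)(w)=\liminf_{t\searrow0,\,w'\to w}\frac{f(\bar x+tw')-f(\bar x)}{t}$. Critical cone: $K_f(\bar x,\bar v)=\{w : \langle\bar v,w\rangle=\mathrm{d}f(\bar x)(w)\}$. $\delta_C$ is the indicator function of $C$ and $\mathrm{span}\,C$ the linear span. Second-order difference quotients: $\Delta_t^2f(x,v)(w)=\dfrac{f(x+tw)-f(x)-t\langle v,w\rangle}{\frac12t^2}$. Strict second subderivative of $f$ at $\bar x$ for $\bar v\in\partial f(\bar x)$: $\mathrm{d}_s^2f(\bar x,\bar v)(w)=\liminf\Delta_t^2f(x,v)(w')$ as $t\searrow0$, $w'\to w$, $(x,v)\to(\bar x,\bar v)$ with $(x,v)\in\mathrm{gph}\,\partial f$ and $f(x)\to f(\bar x)$. *)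

theory Defs
  imports "HOL-Analysis.Analysis"
begin

text \<open>Painleve--Kuratowski outer limit of \<open>(\<Omega> - x) / t\<close> as \<open>t\<close> decreases to \<open>0\<close>.\<close>

definition tangent_cone :: "'a::euclidean_space set \<Rightarrow> 'a \<Rightarrow> 'a set" where
  "tangent_cone \<Omega> x = {w. \<exists>t u. (\<forall>k::nat. 0 < t k \<and> u k \<in> (\<lambda>z. (z - x) /\<^sub>R t k) ` \<Omega>)
     \<and> t \<longlonglongrightarrow> (0::real) \<and> u \<longlonglongrightarrow> w}"

definition polar_cone :: "'a::euclidean_space set \<Rightarrow> 'a set" where
  "polar_cone C = {v. \<forall>w\<in>C. v \<bullet> w \<le> 0}"

text \<open>The normal cones are only meaningful at points \<open>x \<in> \<Omega>\<close>.\<close>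

definition regular_normal_cone :: "'a::euclidean_space set \<Rightarrow> 'a \<Rightarrow> 'a set" where
  "regular_normal_cone \<Omega> x = polar_cone (tangent_cone \<Omega> x)"

definition normal_cone :: "'a::euclidean_space set \<Rightarrow> 'a \<Rightarrow> 'a set" where
  "normal_cone \<Omega> x = {v. \<exists>xs vs. (\<forall>k::nat. xs k \<in> \<Omega> \<and> vs k \<in> regular_normal_cone \<Omega> (xs k))
     \<and> xs \<longlonglongrightarrow> x \<and> vs \<longlonglongrightarrow> v}"

definition epi :: "('a \<Rightarrow> ereal) \<Rightarrow> ('a \<times> real) set" where
  "epi f = {(x, \<alpha>). f x \<le> ereal \<alpha>}"

definition gph :: "('a \<Rightarrow> 'b set) \<Rightarrow> ('a \<times> 'b) set" where
  "gph F = {(x, y). y \<in> F x}"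

text \<open>The subdifferential is empty wherever the function is not finite.\<close>

definition subdifferential :: "('a::euclidean_space \<Rightarrow> ereal) \<Rightarrow> 'a \<Rightarrow> 'a set" where
  "subdifferential f x =
     {v. \<bar>f x\<bar> \<noteq> \<infinity> \<and> (v, -1) \<in> normal_cone (epi f) (x, real_of_ereal (f x))}"

definition coderivative ::
  "('a::euclidean_space \<Rightarrow> 'b::euclidean_space set) \<Rightarrow> 'a \<Rightarrow> 'b \<Rightarrow> 'b \<Rightarrow> 'a set" where
  "coderivative F x y u = {w. (w, -u) \<in> normal_cone (gph F) (x, y)}"

definition subderivative :: "('a::euclidean_space \<Rightarrow> ereal) \<Rightarrow> 'a \<Rightarrow> 'a \<Rightarrow> ereal" where
  "subderivative f x w =
     Liminf (at_right 0 \<times>\<^sub>F nhds w) (\<lambda>(t, w'). (f (x + t *\<^sub>R w') - f x) / ereal t)"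

definition critical_cone :: "('a::euclidean_space \<Rightarrow> ereal) \<Rightarrow> 'a \<Rightarrow> 'a \<Rightarrow> 'a set" where
  "critical_cone f x v = {w. ereal (v \<bullet> w) = subderivative f x w}"

definition indicator_fun :: "'a set \<Rightarrow> 'a \<Rightarrow> ereal" where
  "indicator_fun C u = (if u \<in> C then 0 else \<infinity>)"

definition second_order_quotient ::
  "('a::euclidean_space \<Rightarrow> ereal) \<Rightarrow> real \<Rightarrow> 'a \<Rightarrow> 'a \<Rightarrow> 'a \<Rightarrow> ereal" where
  "second_order_quotient f t x v w =
     (f (x + t *\<^sub>R w) - f x - ereal (t * (v \<bullet> w))) / ereal (1/2 * t\<^sup>2)"

text \<open>The filter below encodes \<open>(x, v) \<rightarrow> (x0, v0)\<close> within the graph of the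
  subdifferential of \<open>f\<close> together with \<open>f x \<rightarrow> f x0\<close>; the point \<open>(x0, v0)\<close>
  itself is not excluded.\<close>

definition gph_subdifferential_at ::
  "('a::euclidean_space \<Rightarrow> ereal) \<Rightarrow> 'a \<Rightarrow> 'a \<Rightarrow> ('a \<times> 'a) filter" where
  "gph_subdifferential_at f x0 v0 =
     inf (inf (nhds (x0, v0)) (principal (gph (subdifferential f))))
         (filtercomap (\<lambda>(x, v). f x) (nhds (f x0)))"

definition strict_second_subderivative ::
  "('a::euclidean_space \<Rightarrow> ereal) \<Rightarrow> 'a \<Rightarrow> 'a \<Rightarrow> 'a \<Rightarrow> ereal" where
  "strict_second_subderivative f x0 v0 w =
     Liminf (at_right 0 \<times>\<^sub>F nhds w \<times>\<^sub>F gph_subdifferential_at f x0 v0)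
       (\<lambda>(t, w', x, v). second_order_quotient f t x v w')"

definition polyhedral_function :: "('a::euclidean_space \<Rightarrow> ereal) \<Rightarrow> bool" where
  "polyhedral_function g \<longleftrightarrow>
     (\<forall>z. g z \<noteq> -\<infinity>) \<and> (\<exists>z. g z \<noteq> \<infinity>) \<and> polyhedron (epi g)"

definition gradient :: "(real^'n \<Rightarrow> real) \<Rightarrow> real^'n \<Rightarrow> real^'n" where
  "gradient f x = (\<chi> j. frechet_derivative f (at x) (axis j 1))"

definition hessian :: "(real^'n \<Rightarrow> real) \<Rightarrow> real^'n \<Rightarrow> real^'n^'n" where
  "hessian f x = jacobian (gradient f) (at x)"

definition second_derivative ::
  "(real^'n \<Rightarrow> real^'m) \<Rightarrow> real^'n \<Rightarrow> real^'n \<Rightarrow> real^'m" where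
  "second_derivative \<Phi> x w = (\<chi> i. (hessian (\<lambda>y. \<Phi> y $ i) x *v w) \<bullet> w)"

definition C2_around :: "(real^'n \<Rightarrow> real^'m) \<Rightarrow> real^'n \<Rightarrow> bool" where
  "C2_around \<Phi> x \<longleftrightarrow> (\<exists>U. open U \<and> x \<in> U
     \<and> (\<forall>y\<in>U. \<Phi> differentiable (at y))
     \<and> (\<forall>i. \<forall>y\<in>U. gradient (\<lambda>z. \<Phi> z $ i) differentiable (at y))
     \<and> (\<forall>i. continuous_on U (hessian (\<lambda>z. \<Phi> z $ i))))"

definition composite_representation ::
  "(real^'n \<Rightarrow> ereal) \<Rightarrow> (real^'m \<Rightarrow> ereal) \<Rightarrow> (real^'n \<Rightarrow> real^'m) \<Rightarrow> real^'n \<Rightarrow> bool" where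
  "composite_representation \<phi> g \<Phi> x \<longleftrightarrow>
     C2_around \<Phi> x \<and> polyhedral_function g
     \<and> (\<exists>O'. open O' \<and> x \<in> O' \<and> (\<forall>y\<in>O'. \<phi> y = g (\<Phi> y)))"

definition multipliers ::
  "(real^'m \<Rightarrow> ereal) \<Rightarrow> (real^'n \<Rightarrow> real^'m) \<Rightarrow> real^'n \<Rightarrow> real^'n \<Rightarrow> (real^'m) set" where
  "multipliers g \<Phi> x v =
     {l. transpose (jacobian \<Phi> (at x)) *v l = v \<and> l \<in> subdifferential g (\<Phi> x)}"

definition SOQC ::
  "(real^'m \<Rightarrow> ereal) \<Rightarrow> (real^'n \<Rightarrow> real^'m) \<Rightarrow> real^'n \<Rightarrow> real^'m \<Rightarrow> bool" where
  "SOQC g \<Phi> x l \<longleftrightarrow>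
     coderivative (subdifferential g) (\<Phi> x) l 0
       \<inter> {u. transpose (jacobian \<Phi> (at x)) *v u = 0} = {0}"

end

theory Submission
  imports Defs
begin

text \<open>
  Near \<open>(z, g z)\<close>, \<open>z = \<Phi> x\<close>, the epigraph of \<open>g\<close> is a polyhedral cone whose lineality space
  contains all \<open>(h, \<langle>\<lambda>, h\<rangle>)\<close> with \<open>h\<close> orthogonal to the space \<open>L\<close> parallel to \<open>\<partial>g(z)\<close>. Since
  \<open>L\<close> is contained in \<open>D\<^sup>*(\<partial>g)(z, \<lambda>)(0)\<close>, SOQC makes \<open>\<nabla>\<Phi>(x)\<^sup>T\<close> injective on \<open>L\<close>, so that
  \<open>\<Phi>\<close> can be steered freely modulo \<open>L\<^sup>\<bottom>\<close>. This yields the exact chain rule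
  \<open>\<partial>\<phi> = \<nabla>\<Phi>\<^sup>T \<partial>g\<close> nearby with unique multipliers converging to \<open>\<lambda>\<close>, and the quotients of \<open>\<phi>\<close>
  split into quotients of \<open>g\<close> plus a Taylor term. The former are nonnegative, blow up like \<open>1/t\<close>
  off the span of the critical cone \<open>K\<close>, and vanish along suitable curves when
  \<open>\<nabla>\<Phi>(x) w = a - b\<close> with \<open>a, b \<in> K\<close>. The formula for \<open>g\<close> itself is the case \<open>\<Phi> = id\<close>.
\<close>

text \<open>The span of \<open>K\<close>, rather than \<open>K\<close> itself, appears because the
  base point of the quotient is free: it may start at a point with image near
  \<open>\<Phi> x0 + t b\<close> and move by about \<open>t w\<close> to a point with image near
  \<open>\<Phi> x0 + t a\<close>. Both ends then lie on the face where \<open>g\<close> equals its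
  supporting affine function of slope \<open>l\<close>, although \<open>a - b\<close> need not be
  critical. The obstacle is that \<open>g\<close> may be infinite arbitrarily close to
  \<open>\<Phi> x0\<close>. A first-order approximation of a feasible point has an error
  \<open>o(t)\<close>, which can leave the domain of \<open>g\<close>. The equation is therefore
  solved exactly in the components along \<open>L\<close>; the error left is orthogonal to
  \<open>L\<close>, and in those directions \<open>g\<close> is locally affine. \<open>L\<close>
  contains the recession directions of the subdifferential as well, since adding one to
  \<open>l\<close> gives another subgradient. Injectivity on \<open>L\<close> thus also controls the
  horizontal normals of \<open>epi g\<close>. The blow-up off the span comes from a linear cost:
  leaving it raises \<open>g\<close> above its supporting plane by at least a multiple of
  \<open>t\<close>, while the quotient divides by \<open>t^2 / 2\<close>.\<close>

section \<open>Tangent and normal cones, and polyhedra near a point\<close>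

lemma tangent_cone_iff:
  "w \<in> tangent_cone S x \<longleftrightarrow> (\<exists>t u. (\<forall>k::nat. 0 < t k \<and> x + t k *\<^sub>R u k \<in> S)
     \<and> t \<longlonglongrightarrow> (0::real) \<and> u \<longlonglongrightarrow> w)"
proof -
  have "u \<in> (\<lambda>z. (z - x) /\<^sub>R t) ` S \<longleftrightarrow> x + t *\<^sub>R u \<in> S" if "0 < t" for t :: real and u
  proof
    show "x + t *\<^sub>R u \<in> S \<Longrightarrow> u \<in> (\<lambda>z. (z - x) /\<^sub>R t) ` S"
      using that by (intro image_eqI[of _ _ "x + t *\<^sub>R u"]) auto
  qed (use that in auto)
  then show ?thesis
    unfolding tangent_cone_def by (auto cong: conj_cong)
qed

text \<open>Segments from \<open>x\<close> make every \<open>y - x\<close> tangent, and every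
  tangent vector is a limit of positive multiples of such differences, so polarity can be tested on
  \<open>S - x\<close>.\<close>

lemma regular_normal_cone_convex:
  assumes "convex S" "x \<in> S"
  shows "regular_normal_cone S x = {v. \<forall>y\<in>S. v \<bullet> (y - x) \<le> 0}"
proof (intro set_eqI iffI)
  fix v assume v: "v \<in> regular_normal_cone S x"
  have "v \<bullet> (y - x) \<le> 0" if "y \<in> S" for y
  proof -
    have "y - x \<in> tangent_cone S x"
      unfolding tangent_cone_iff
    proof (intro exI conjI allI)
      show "0 < inverse (real (Suc k))" for k by simp
      show "x + inverse (real (Suc k)) *\<^sub>R (y - x) \<in> S" for k
        using convexD_alt[OF assms(1,2) that, of "inverse (real (Suc k))"]
        by (simp add: algebra_simps inverse_le_1_iff)
    qed (use LIMSEQ_inverse_real_of_nat in auto)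
    then show ?thesis using v by (simp add: regular_normal_cone_def polar_cone_def)
  qed
  then show "v \<in> {v. \<forall>y\<in>S. v \<bullet> (y - x) \<le> 0}" by blast
next
  fix v assume v: "v \<in> {v. \<forall>y\<in>S. v \<bullet> (y - x) \<le> 0}"
  have "v \<bullet> w \<le> 0" if w: "w \<in> tangent_cone S x" for w
  proof -
    obtain t u where t: "\<And>k::nat. 0 < t k \<and> x + t k *\<^sub>R u k \<in> S" and u: "u \<longlonglongrightarrow> w"
      using w unfolding tangent_cone_iff by auto
    have "v \<bullet> u k \<le> 0" for k
    proof -
      have "v \<bullet> (x + t k *\<^sub>R u k - x) \<le> 0" using t[of k] v by blast
      then show ?thesis using t[of k] by (simp add: mult_le_0_iff)
    qed
    then show ?thesis
      using tendsto_inner[OF tendsto_const u, of v] by (intro LIMSEQ_le_const2) auto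
  qed
  then show "v \<in> regular_normal_cone S x" by (simp add: regular_normal_cone_def polar_cone_def)
qed

lemma regular_normal_cone_subset_normal_cone:
  assumes "x \<in> S"
  shows "regular_normal_cone S x \<subseteq> normal_cone S x"
proof
  fix v assume "v \<in> regular_normal_cone S x"
  then show "v \<in> normal_cone S x"
    unfolding normal_cone_def
    by (intro CollectI exI[of _ "\<lambda>_. x"] exI[of _ "\<lambda>_. v"]) (use assms in auto)
qed

text \<open>The global inequality survives limits of both base point and normal, so for convex sets
  the limiting construction adds nothing to the regular cone.\<close>

lemma normal_cone_convex:
  assumes "convex S" "x \<in> S"
  shows "normal_cone S x = {v. \<forall>y\<in>S. v \<bullet> (y - x) \<le> 0}"
proof
  show "{v. \<forall>y\<in>S. v \<bullet> (y - x) \<le> 0} \<subseteq> normal_cone S x"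
    using regular_normal_cone_subset_normal_cone[OF assms(2)] regular_normal_cone_convex[OF assms]
    by simp
  show "normal_cone S x \<subseteq> {v. \<forall>y\<in>S. v \<bullet> (y - x) \<le> 0}"
  proof
    fix v assume "v \<in> normal_cone S x"
    then obtain xs vs where k: "\<And>k::nat. xs k \<in> S \<and> vs k \<in> regular_normal_cone S (xs k)"
      and lim: "xs \<longlonglongrightarrow> x" "vs \<longlonglongrightarrow> v"
      unfolding normal_cone_def by blast
    have "v \<bullet> (y - x) \<le> 0" if "y \<in> S" for y
    proof (rule LIMSEQ_le_const2)
      show "(\<lambda>k. vs k \<bullet> (y - xs k)) \<longlonglongrightarrow> v \<bullet> (y - x)"
        using lim by (intro tendsto_intros)
      show "\<exists>N. \<forall>n\<ge>N. vs n \<bullet> (y - xs n) \<le> 0"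
        using k that regular_normal_cone_convex[OF assms(1)] by fastforce
    qed
    then show "v \<in> {v. \<forall>y\<in>S. v \<bullet> (y - x) \<le> 0}" by blast
  qed
qed

text \<open>\<open>A\<close> collects the normals of the half-spaces active at \<open>p\<close>. The
  finitely many inactive ones are strict at \<open>p\<close> and stay satisfied within a common
  radius \<open>\<delta>\<close>.\<close>

lemma polyhedron_locally_cone:
  fixes S :: "'a::euclidean_space set"
  assumes "polyhedron S" "p \<in> S"
  obtains A \<delta> where "0 < \<delta>"
    "\<And>a y. a \<in> A \<Longrightarrow> y \<in> S \<Longrightarrow> a \<bullet> (y - p) \<le> 0"
    "\<And>y. norm (y - p) < \<delta> \<Longrightarrow> (\<And>a. a \<in> A \<Longrightarrow> a \<bullet> (y - p) \<le> 0) \<Longrightarrow> y \<in> S"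
proof -
  obtain F where F: "finite F" "S = \<Inter>F" "\<forall>h\<in>F. \<exists>a b. a \<noteq> 0 \<and> h = {x. a \<bullet> x \<le> b}"
    using assms(1) unfolding polyhedron_def by blast
  have "\<exists>c. \<forall>x. x \<in> h \<longleftrightarrow> fst c \<bullet> x \<le> snd c" if h: "h \<in> F" for h
  proof -
    obtain a b where "h = {x. a \<bullet> x \<le> b}"
      using bspec[OF F(3) h] by (elim exE conjE)
    then show ?thesis by (intro exI[of _ "(a, b)"]) simp
  qed
  then obtain c where c: "\<And>h x. h \<in> F \<Longrightarrow> x \<in> h \<longleftrightarrow> fst (c h) \<bullet> x \<le> snd (c h)"
    by metis
  define a where "a h = fst (c h)" for h
  define b where "b h = snd (c h)" for h
  have ab: "x \<in> h \<longleftrightarrow> a h \<bullet> x \<le> b h" if "h \<in> F" for h x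
    using c[OF that] by (simp add: a_def b_def)
  have "\<forall>\<^sub>F y in nhds p. \<forall>h\<in>{h \<in> F. a h \<bullet> p \<noteq> b h}. a h \<bullet> y < b h"
  proof (rule eventually_ball_finite)
    show "\<forall>h\<in>{h \<in> F. a h \<bullet> p \<noteq> b h}. \<forall>\<^sub>F y in nhds p. a h \<bullet> y < b h"
    proof
      fix h assume h: "h \<in> {h \<in> F. a h \<bullet> p \<noteq> b h}"
      then have "a h \<bullet> p < b h" using assms(2) F(2) ab by fastforce
      moreover have "((\<lambda>y. a h \<bullet> y) \<longlongrightarrow> a h \<bullet> p) (nhds p)"
        by (intro tendsto_intros filterlim_ident)
      ultimately show "\<forall>\<^sub>F y in nhds p. a h \<bullet> y < b h" by (simp add: order_tendstoD(2))
    qed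
  qed (use F in auto)
  then obtain \<delta> where \<delta>: "\<delta> > 0" "\<And>y h. dist y p < \<delta> \<Longrightarrow> h \<in> F \<Longrightarrow> a h \<bullet> p \<noteq> b h \<Longrightarrow> a h \<bullet> y < b h"
    unfolding eventually_nhds_metric by blast
  show thesis
  proof
    show "0 < \<delta>" by fact
    fix c y assume "c \<in> a ` {h \<in> F. a h \<bullet> p = b h}" "y \<in> S"
    then obtain h where "c = a h" "h \<in> F" "a h \<bullet> p = b h" "a h \<bullet> y \<le> b h"
      using F(2) ab by blast
    then show "c \<bullet> (y - p) \<le> 0" by (simp add: inner_diff_right)
  next
    fix y assume y: "norm (y - p) < \<delta>" "\<And>c. c \<in> a ` {h \<in> F. a h \<bullet> p = b h} \<Longrightarrow> c \<bullet> (y - p) \<le> 0"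
    have "y \<in> h" if "h \<in> F" for h
    proof (cases "a h \<bullet> p = b h")
      case True
      then have "a h \<bullet> (y - p) \<le> 0" using y(2) that by blast
      then have "a h \<bullet> y \<le> b h" using True by (simp add: inner_diff_right)
      then show ?thesis using ab[OF that] by blast
    next
      case False
      then have "a h \<bullet> y < b h" using \<delta>(2)[of y h] that y(1) by (simp add: dist_norm)
      then show ?thesis using ab[OF that] by simp
    qed
    then show "y \<in> S" using F(2) by blast
  qed
qed

text \<open>The dual description by generators: a box around \<open>p\<close> cuts \<open>S\<close>
  down to a polytope, the hull of a finite \<open>V\<close>, and convex weights, which sum to 1, let
  \<open>p\<close> be subtracted inside the sum. \<open>growth_off_span\<close> needs it because
  estimates on finitely many generators are automatically uniform.\<close>

lemma polyhedron_local_generators: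
  fixes S :: "'a::euclidean_space set"
  assumes "polyhedron S" "p \<in> S"
  obtains V \<delta> where "finite V" "V \<subseteq> S" "0 < \<delta>"
    "\<And>y. y \<in> S \<Longrightarrow> norm (y - p) < \<delta> \<Longrightarrow>
       \<exists>s. (\<forall>v\<in>V. 0 \<le> s v) \<and> y - p = (\<Sum>v\<in>V. s v *\<^sub>R (v - p))"
proof -
  obtain a b where ab: "p \<in> box a b"
    using rational_boxes[of 1 p] by auto
  have "polytope (S \<inter> cbox a b)"
    using assms(1) by (simp add: polytope_eq_bounded_polyhedron bounded_Int)
  then obtain V where V: "finite V" "S \<inter> cbox a b = convex hull V"
    unfolding polytope_def by blast
  obtain \<delta> where \<delta>: "\<delta> > 0" "ball p \<delta> \<subseteq> box a b"
    using ab open_box open_contains_ball by metis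
  show thesis
  proof
    show "finite V" "0 < \<delta>" by fact+
    show "V \<subseteq> S" using V(2) hull_subset[of V convex] by blast
    fix y assume y: "y \<in> S" "norm (y - p) < \<delta>"
    then have "y \<in> cbox a b"
      using \<delta>(2) box_subset_cbox[of a b] by (auto simp: dist_norm norm_minus_commute subset_iff)
    then have "y \<in> convex hull V" using V y by blast
    then obtain s where s: "\<forall>v\<in>V. 0 \<le> s v" "sum s V = 1" "(\<Sum>v\<in>V. s v *\<^sub>R v) = y"
      using convex_hull_finite[OF V(1)] by auto
    have "(\<Sum>v\<in>V. s v *\<^sub>R (v - p)) = y - p"
      using s by (simp add: scaleR_diff_right sum_subtractf flip: scaleR_left.sum)
    then show "\<exists>s. (\<forall>v\<in>V. 0 \<le> s v) \<and> y - p = (\<Sum>v\<in>V. s v *\<^sub>R (v - p))"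
      using s by metis
  qed
qed

section \<open>Polyhedral functions\<close>

lemma epi_iff: "(y, \<alpha>) \<in> epi f \<longleftrightarrow> f y \<le> ereal \<alpha>"
  by (simp add: epi_def)

text \<open>The epigraph is convex, so a limiting normal \<open>(\<mu>, -1)\<close> is a global one,
  which is the subgradient inequality of convex analysis. Quantifying over points of
  \<open>epi g\<close> keeps the inequality in the reals.\<close>

lemma subdifferential_polyhedral:
  assumes "polyhedral_function g"
  shows "\<mu> \<in> subdifferential g y \<longleftrightarrow> \<bar>g y\<bar> \<noteq> \<infinity> \<and>
    (\<forall>y' \<alpha>. (y', \<alpha>) \<in> epi g \<longrightarrow> real_of_ereal (g y) + \<mu> \<bullet> (y' - y) \<le> \<alpha>)"
proof (cases "\<bar>g y\<bar> = \<infinity>")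
  case False
  then have "(y, real_of_ereal (g y)) \<in> epi g" by (simp add: epi_iff ereal_real)
  moreover have "convex (epi g)"
    using assms polyhedral_function_def polyhedron_imp_convex by blast
  ultimately show ?thesis
    using False
    by (auto simp: subdifferential_def normal_cone_convex inner_diff_right algebra_simps)
qed (simp add: subdifferential_def)

lemma ereal_quotient_le_iff:
  assumes "0 < t"
  shows "(x - ereal c) / ereal t \<le> ereal b \<longleftrightarrow> x \<le> ereal (c + t * b)"
  using assms by (cases x) (auto simp: field_simps)

locale polyhedral_subgradient =
  fixes g :: "'a::euclidean_space \<Rightarrow> ereal" and z l :: 'a
  assumes polyhedral: "polyhedral_function g"
    and subgradient: "l \<in> subdifferential g z"
begin

definition val :: real where
  "val = real_of_ereal (g z)"

text \<open>Differences with the one fixed subgradient \<open>l\<close> already span the direction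
  space of the affine hull of the subdifferential.\<close>

definition parallel_space :: "'a set" where
  "parallel_space = span ((\<lambda>\<mu>. \<mu> - l) ` subdifferential g z)"

lemma g_z: "g z = ereal val"
  using subgradient by (simp add: val_def subdifferential_def ereal_real)

lemma polyhedron_epi: "polyhedron (epi g)"
  using polyhedral by (simp add: polyhedral_function_def)

lemma convex_epi: "convex (epi g)"
  using polyhedron_epi polyhedron_imp_convex by blast

lemma base_in_epi: "(z, val) \<in> epi g"
  by (simp add: epi_iff g_z)

lemma subgradient_ineq:
  assumes "\<mu> \<in> subdifferential g y" "(y', \<alpha>) \<in> epi g"
  shows "real_of_ereal (g y) + \<mu> \<bullet> (y' - y) \<le> \<alpha>"
  using assms by (simp add: subdifferential_polyhedral[OF polyhedral])

lemma subgradient_global: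
  assumes "\<mu> \<in> subdifferential g y"
  shows "ereal (real_of_ereal (g y) + \<mu> \<bullet> (y' - y)) \<le> g y'"
proof (cases "g y'")
  case (real r)
  then show ?thesis using subgradient_ineq[OF assms, of y' r] by (simp add: epi_iff)
next
  case MInf
  then show ?thesis using polyhedral by (auto simp: polyhedral_function_def)
qed simp

lemma subgradient_value:
  assumes "\<mu> \<in> subdifferential g y"
  shows "g y = ereal (real_of_ereal (g y))"
  using assms by (simp add: subdifferential_def ereal_real)

lemma subgradient_in_epi:
  assumes "\<mu> \<in> subdifferential g y"
  shows "(y, real_of_ereal (g y)) \<in> epi g"
  using subgradient_value[OF assms] by (simp add: epi_iff)

lemma subgradient_at_base_iff:
  "\<mu> \<in> subdifferential g z \<longleftrightarrow> (\<forall>y \<alpha>. (y, \<alpha>) \<in> epi g \<longrightarrow> val + \<mu> \<bullet> (y - z) \<le> \<alpha>)"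
  by (simp add: subdifferential_polyhedral[OF polyhedral] g_z)

lemma subgradient_at_baseD:
  "\<mu> \<in> subdifferential g z \<Longrightarrow> (y, \<alpha>) \<in> epi g \<Longrightarrow> val + \<mu> \<bullet> (y - z) \<le> \<alpha>"
  by (simp add: subgradient_at_base_iff)

lemma epi_lower: "(y, \<alpha>) \<in> epi g \<Longrightarrow> val + l \<bullet> (y - z) \<le> \<alpha>"
  using subgradient subgradient_at_base_iff by blast

lemma g_lower: "ereal (val + l \<bullet> (y - z)) \<le> g y"
  using subgradient_global[OF subgradient] by (simp add: g_z)

lemma parallel_spaceI: "\<mu> \<in> subdifferential g z \<Longrightarrow> \<mu> - l \<in> parallel_space"
  unfolding parallel_space_def by (intro span_base) blast

lemma subspace_parallel_space: "subspace parallel_space"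
  by (simp add: parallel_space_def)

lemma epi_normal_snd_le:
  assumes "\<And>q. q \<in> epi g \<Longrightarrow> a \<bullet> (q - (z, val)) \<le> 0"
  shows "snd a \<le> 0"
proof -
  have "(z, val + 1) \<in> epi g" by (simp add: epi_iff g_z)
  from assms[OF this] show ?thesis by (simp add: inner_prod_def)
qed

text \<open>Up to scaling, a normal to the epigraph is either \<open>(\<mu>, -1)\<close> for a subgradient \<open>\<mu>\<close> or
  \<open>(\<nu>, 0)\<close> for a recession direction \<open>\<nu>\<close> of the subdifferential.\<close>

lemma epi_normal_orthogonal:
  assumes a: "\<And>q. q \<in> epi g \<Longrightarrow> a \<bullet> (q - (z, val)) \<le> 0"
    and h: "\<And>\<eta>. \<eta> \<in> parallel_space \<Longrightarrow> \<eta> \<bullet> h = 0"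
  shows "a \<bullet> (h, l \<bullet> h) = 0"
proof -
  have ineq: "fst a \<bullet> (y - z) + snd a * (\<alpha> - val) \<le> 0" if "(y, \<alpha>) \<in> epi g" for y \<alpha>
    using a[OF that] by (simp add: inner_prod_def)
  show ?thesis
  proof (cases "snd a = 0")
    case True
    have "val + (l + fst a) \<bullet> (y - z) \<le> \<alpha>" if "(y, \<alpha>) \<in> epi g" for y \<alpha>
      using ineq[OF that] epi_lower[OF that] True by (simp add: inner_add_left)
    then have "l + fst a \<in> subdifferential g z" by (simp add: subgradient_at_base_iff)
    then have "fst a \<bullet> h = 0" using parallel_spaceI h by fastforce
    then show ?thesis using True by (simp add: inner_prod_def)
  next
    case False
    then have neg: "snd a < 0" using epi_normal_snd_le[OF a] by simp
    have "val + (fst a /\<^sub>R (- snd a)) \<bullet> (y - z) \<le> \<alpha>" if "(y, \<alpha>) \<in> epi g" for y \<alpha>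
      using ineq[OF that] neg by (simp add: field_simps)
    then have "fst a /\<^sub>R (- snd a) \<in> subdifferential g z" by (simp add: subgradient_at_base_iff)
    then have "(fst a /\<^sub>R (- snd a) - l) \<bullet> h = 0" using parallel_spaceI h by blast
    then show ?thesis using neg by (simp add: inner_prod_def inner_diff_left field_simps)
  qed
qed

text \<open>Active normals vanish on \<open>(h, l \<bullet> h)\<close> by
  \<open>epi_normal_orthogonal\<close>, so the shift changes none of the active inequalities.
  \<open>\<delta>\<close> only keeps the shifted point where these inequalities describe
  \<open>epi g\<close>.\<close>

lemma epi_translate:
  "\<exists>\<delta>>0. \<forall>y \<alpha> h. (y, \<alpha>) \<in> epi g \<longrightarrow> norm (y - z) < \<delta> \<longrightarrow> \<bar>\<alpha> - val\<bar> < \<delta> \<longrightarrow> norm h < \<delta> \<longrightarrow>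
     (\<forall>\<eta>\<in>parallel_space. \<eta> \<bullet> h = 0) \<longrightarrow> (y + h, \<alpha> + l \<bullet> h) \<in> epi g"
proof -
  obtain A \<epsilon> where \<epsilon>: "0 < \<epsilon>"
    and A: "\<And>a q. a \<in> A \<Longrightarrow> q \<in> epi g \<Longrightarrow> a \<bullet> (q - (z, val)) \<le> 0"
    and S: "\<And>q. norm (q - (z, val)) < \<epsilon> \<Longrightarrow> (\<And>a. a \<in> A \<Longrightarrow> a \<bullet> (q - (z, val)) \<le> 0) \<Longrightarrow> q \<in> epi g"
    using polyhedron_locally_cone[OF polyhedron_epi base_in_epi] by metis
  \<comment> \<open>The shifted point is within \<open>norm (y - z) + norm h + \<bar>\<alpha> -
    val\<bar> + norm l * norm h\<close> of the base point: three terms below \<open>\<delta>\<close>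
    and one at most \<open>norm l * \<delta>\<close>.\<close>
  define \<delta> where "\<delta> = \<epsilon> / (3 + norm l)"
  have pos: "0 < 3 + norm l" by (smt (verit) norm_ge_zero)
  then have \<delta>: "0 < \<delta>" "\<delta> * (3 + norm l) = \<epsilon>" using \<epsilon> by (auto simp: \<delta>_def)
  show ?thesis
  proof (intro exI[of _ \<delta>] conjI allI impI \<delta>(1))
    fix y \<alpha> h
    assume q: "(y, \<alpha>) \<in> epi g" and near: "norm (y - z) < \<delta>" "\<bar>\<alpha> - val\<bar> < \<delta>" "norm h < \<delta>"
      and h: "\<forall>\<eta>\<in>parallel_space. \<eta> \<bullet> h = 0"
    have eq: "(y + h, \<alpha> + l \<bullet> h) - (z, val) = ((y, \<alpha>) - (z, val)) + (h, l \<bullet> h)" by simp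
    show "(y + h, \<alpha> + l \<bullet> h) \<in> epi g"
    proof (rule S)
      have "norm ((y + h, \<alpha> + l \<bullet> h) - (z, val)) \<le> norm (y + h - z) + \<bar>\<alpha> + l \<bullet> h - val\<bar>"
        using norm_Pair_le[of "y + h - z" "\<alpha> + l \<bullet> h - val"] by simp
      also have "\<dots> \<le> (norm (y - z) + norm h) + (\<bar>\<alpha> - val\<bar> + norm l * norm h)"
      proof (rule add_mono)
        show "norm (y + h - z) \<le> norm (y - z) + norm h"
          using norm_triangle_ineq[of "y - z" h] by (simp add: algebra_simps)
        show "\<bar>\<alpha> + l \<bullet> h - val\<bar> \<le> \<bar>\<alpha> - val\<bar> + norm l * norm h"
          using Cauchy_Schwarz_ineq2[of l h] by linarith
      qed
      also have "\<dots> < \<delta> * (3 + norm l)"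
      proof -
        have "norm l * norm h \<le> norm l * \<delta>" using near(3) by (intro mult_left_mono) auto
        then show ?thesis using near by (simp add: algebra_simps)
      qed
      finally show "norm ((y + h, \<alpha> + l \<bullet> h) - (z, val)) < \<epsilon>" by (simp add: \<delta>(2))
    next
      fix a assume a: "a \<in> A"
      show "a \<bullet> ((y + h, \<alpha> + l \<bullet> h) - (z, val)) \<le> 0"
        unfolding eq inner_add_right
        using A[OF a q] epi_normal_orthogonal[of a h] A[OF a] h by simp
    qed
  qed
qed

text \<open>Near its apex \<open>(z, val)\<close> the epigraph is a convex cone, so a nearby point
  \<open>q\<close> may be moved a little in the direction \<open>d\<close> from the apex to any
  point of \<open>epi g\<close>. The subgradient inequality at \<open>y\<close> along this move,
  divided by \<open>s\<close>, is the one at \<open>z\<close>.\<close>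

lemma subdifferential_nearby:
  "\<exists>\<delta>>0. \<forall>y \<mu>. norm (y - z) < \<delta> \<longrightarrow> \<bar>real_of_ereal (g y) - val\<bar> < \<delta> \<longrightarrow>
     \<mu> \<in> subdifferential g y \<longrightarrow> \<mu> \<in> subdifferential g z"
proof -
  obtain A \<epsilon> where \<epsilon>: "0 < \<epsilon>"
    and A: "\<And>a q. a \<in> A \<Longrightarrow> q \<in> epi g \<Longrightarrow> a \<bullet> (q - (z, val)) \<le> 0"
    and S: "\<And>q. norm (q - (z, val)) < \<epsilon> \<Longrightarrow> (\<And>a. a \<in> A \<Longrightarrow> a \<bullet> (q - (z, val)) \<le> 0) \<Longrightarrow> q \<in> epi g"
    using polyhedron_locally_cone[OF polyhedron_epi base_in_epi] by metis
  show ?thesis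
  proof (intro exI[of _ "\<epsilon> / 2"] conjI allI impI)
    fix y \<mu> assume near: "norm (y - z) < \<epsilon> / 2" "\<bar>real_of_ereal (g y) - val\<bar> < \<epsilon> / 2"
      and \<mu>: "\<mu> \<in> subdifferential g y"
    define p q where "p = (z, val)" and "q = (y, real_of_ereal (g y))"
    have q: "q \<in> epi g" using subgradient_in_epi[OF \<mu>] by (simp add: q_def)
    have "norm (q - p) < \<epsilon>"
      using norm_Pair_le[of "y - z" "real_of_ereal (g y) - val"] near by (simp add: q_def p_def)
    show "\<mu> \<in> subdifferential g z"
      unfolding subgradient_at_base_iff
    proof (intro allI impI)
      fix y' \<alpha>' assume q': "(y', \<alpha>') \<in> epi g"
      define d where "d = (y', \<alpha>') - p"
      have "((\<lambda>s. norm (q + s *\<^sub>R d - p)) \<longlongrightarrow> norm (q + 0 *\<^sub>R d - p)) (at_right 0)"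
        by (intro tendsto_intros)
      then have "\<forall>\<^sub>F s in at_right 0. norm (q + s *\<^sub>R d - p) < \<epsilon>"
        using \<open>norm (q - p) < \<epsilon>\<close> by (intro order_tendstoD(2)) auto
      moreover have "\<forall>\<^sub>F s::real in at_right 0. 0 < s" by (simp add: eventually_at_right_less)
      ultimately obtain s where s: "0 < s" "norm (q + s *\<^sub>R d - p) < \<epsilon>"
        using eventually_happens[OF eventually_conj] trivial_limit_at_right_real by blast
      have "q + s *\<^sub>R d \<in> epi g"
      proof (rule S)
        show "norm (q + s *\<^sub>R d - (z, val)) < \<epsilon>" using s by (simp add: p_def)
        fix a assume a: "a \<in> A"
        have "a \<bullet> (q + s *\<^sub>R d - (z, val)) = a \<bullet> (q - (z, val)) + s * (a \<bullet> ((y', \<alpha>') - (z, val)))"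
          by (simp add: d_def p_def inner_prod_def algebra_simps)
        also have "\<dots> \<le> 0"
          using A[OF a q] A[OF a q'] s(1) by (simp add: add_nonpos_nonpos mult_nonneg_nonpos)
        finally show "a \<bullet> (q + s *\<^sub>R d - (z, val)) \<le> 0" .
      qed
      then have "(y + s *\<^sub>R (y' - z), real_of_ereal (g y) + s * (\<alpha>' - val)) \<in> epi g"
        by (simp add: q_def d_def p_def)
      from subgradient_ineq[OF \<mu> this] have "s * (\<mu> \<bullet> (y' - z)) \<le> s * (\<alpha>' - val)" by simp
      then show "val + \<mu> \<bullet> (y' - z) \<le> \<alpha>'" using s(1) by simp
    qed
  qed (use \<epsilon> in auto)
qed

section \<open>The critical cone and its span\<close>

text \<open>The subderivative only supplies nearby directions with slope nearly
  \<open>l \<bullet> u\<close>. In the limit every active normal is nonpositive on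
  \<open>(u, l \<bullet> u)\<close>, and the local cone description turns this into an actual point
  of the epigraph on the supporting plane.\<close>

lemma critical_coneD:
  assumes u: "u \<in> critical_cone g z l"
  shows "\<exists>s>0. (z + s *\<^sub>R u, val + s * (l \<bullet> u)) \<in> epi g"
proof -
  obtain A \<epsilon> where \<epsilon>: "0 < \<epsilon>"
    and A: "\<And>a q. a \<in> A \<Longrightarrow> q \<in> epi g \<Longrightarrow> a \<bullet> (q - (z, val)) \<le> 0"
    and S: "\<And>q. norm (q - (z, val)) < \<epsilon> \<Longrightarrow> (\<And>a. a \<in> A \<Longrightarrow> a \<bullet> (q - (z, val)) \<le> 0) \<Longrightarrow> q \<in> epi g"
    using polyhedron_locally_cone[OF polyhedron_epi base_in_epi] by metis
  have approx: "fst a \<bullet> u + snd a * (l \<bullet> u + e) \<le> 0" if a: "a \<in> A" and e: "0 < e" for a e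
  proof (rule ccontr)
    assume "\<not> fst a \<bullet> u + snd a * (l \<bullet> u + e) \<le> 0"
    then have "0 < fst a \<bullet> u + snd a * (l \<bullet> u + e)" by simp
    moreover have "((\<lambda>u'. fst a \<bullet> u' + snd a * (l \<bullet> u + e)) \<longlongrightarrow>
        fst a \<bullet> u + snd a * (l \<bullet> u + e)) (nhds u)"
      by (intro tendsto_intros filterlim_ident)
    ultimately have ev_pos: "\<forall>\<^sub>F u' in nhds u. 0 < fst a \<bullet> u' + snd a * (l \<bullet> u + e)"
      by (simp add: order_tendstoD(1))
    have ev: "\<forall>\<^sub>F (t, u') in at_right (0::real) \<times>\<^sub>F nhds u.
        0 < t \<and> 0 < fst a \<bullet> u' + snd a * (l \<bullet> u + e)"
      using eventually_prodI[OF eventually_at_right_less[of "0::real"] ev_pos]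
      by (simp add: case_prod_unfold)
    have "\<not> ereal (l \<bullet> u + e) \<le> subderivative g z u"
    proof -
      have "subderivative g z u = ereal (l \<bullet> u)" using u by (simp add: critical_cone_def)
      then show ?thesis using e by simp
    qed
    \<comment> \<open>The liminf is below \<open>l \<bullet> u + e\<close>, so quotients below this
      value occur frequently, in particular at some \<open>(t, u')\<close> where the strict
      inequality of \<open>ev\<close> holds too.\<close>
    then have "\<exists>\<^sub>F x in at_right 0 \<times>\<^sub>F nhds u. \<not> ereal (l \<bullet> u + e) \<le>
        (\<lambda>(t, u'). (g (z + t *\<^sub>R u') - g z) / ereal t) x"
      using Liminf_bounded[of "ereal (l \<bullet> u + e)"] unfolding subderivative_def frequently_def not_not by blast
    from frequently_ex[OF frequently_eventually_frequently[OF this ev]]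
    obtain t u' where t: "0 < t" and pos: "0 < fst a \<bullet> u' + snd a * (l \<bullet> u + e)"
      and "\<not> ereal (l \<bullet> u + e) \<le> (g (z + t *\<^sub>R u') - g z) / ereal t"
      by auto
    then have "(g (z + t *\<^sub>R u') - g z) / ereal t \<le> ereal (l \<bullet> u + e)" by simp
    with t have "(z + t *\<^sub>R u', val + t * (l \<bullet> u + e)) \<in> epi g"
      by (simp add: g_z ereal_quotient_le_iff epi_iff)
    from A[OF a this] have "t * (fst a \<bullet> u' + snd a * (l \<bullet> u + e)) \<le> 0"
      by (simp add: inner_prod_def algebra_simps)
    then show False using t pos by (simp add: mult_le_0_iff)
  qed
  have le: "a \<bullet> (u, l \<bullet> u) \<le> 0" if a: "a \<in> A" for a
  proof -
    have "((\<lambda>e. fst a \<bullet> u + snd a * (l \<bullet> u + e)) \<longlongrightarrow> fst a \<bullet> u + snd a * (l \<bullet> u + 0)) (at_right 0)"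
      by (intro tendsto_intros)
    moreover have "\<forall>\<^sub>F e in at_right 0. fst a \<bullet> u + snd a * (l \<bullet> u + e) \<le> 0"
      using approx[OF a] eventually_at_right_less[of 0] by (rule eventually_mono[rotated])
    ultimately show ?thesis
      by (simp add: inner_prod_def tendsto_upperbound)
  qed
  \<comment> \<open>The summand 1 keeps the divisor positive for \<open>u = 0\<close>.\<close>
  define N where "N = norm (u, l \<bullet> u) + 1"
  define s where "s = \<epsilon> / (2 * N)"
  have N: "0 < N" by (simp add: N_def add_nonneg_pos)
  then have "0 < s" "s * N = \<epsilon> / 2" using \<epsilon> by (simp_all add: s_def)
  then have s: "0 < s" "s * norm (u, l \<bullet> u) < \<epsilon>" using \<epsilon> by (simp_all add: N_def algebra_simps)
  have eq: "(z + s *\<^sub>R u, val + s * (l \<bullet> u)) - (z, val) = s *\<^sub>R (u, l \<bullet> u)" by simp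
  have "(z + s *\<^sub>R u, val + s * (l \<bullet> u)) \<in> epi g"
  proof (rule S)
    show "norm ((z + s *\<^sub>R u, val + s * (l \<bullet> u)) - (z, val)) < \<epsilon>"
      unfolding eq norm_scaleR using s by simp
    show "a \<bullet> ((z + s *\<^sub>R u, val + s * (l \<bullet> u)) - (z, val)) \<le> 0" if "a \<in> A" for a
      unfolding eq inner_scaleR_right using s le[OF that] by (simp add: mult_nonneg_nonpos)
  qed
  then show ?thesis using s by blast
qed

lemma epi_segment:
  assumes "(z + s *\<^sub>R u, val + s * (l \<bullet> u)) \<in> epi g" "0 \<le> t" "t \<le> s"
  shows "(z + t *\<^sub>R u, val + t * (l \<bullet> u)) \<in> epi g"
proof (cases "s = 0")
  case False
  then have "0 < s" using assms by simp
  have "(1 - t / s) *\<^sub>R (z, val) + (t / s) *\<^sub>R (z + s *\<^sub>R u, val + s * (l \<bullet> u)) \<in> epi g"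
    using assms \<open>0 < s\<close> by (intro convexD_alt[OF convex_epi base_in_epi]) auto
  moreover have "(1 - t / s) *\<^sub>R (z, val) + (t / s) *\<^sub>R (z + s *\<^sub>R u, val + s * (l \<bullet> u))
     = (z + t *\<^sub>R u, val + t * (l \<bullet> u))"
    using \<open>0 < s\<close> by (simp add: algebra_simps)
  ultimately show ?thesis by simp
qed (use assms base_in_epi in auto)

text \<open>The subgradient \<open>l\<close> bounds every quotient in direction \<open>u'\<close>
  below by \<open>l \<bullet> u'\<close>; along the fixed direction \<open>u\<close>, convexity
  bounds the quotients above by \<open>l \<bullet> u\<close> for all \<open>t < s\<close>. With
  \<open>critical_coneD\<close> this identifies \<open>K\<close> as the directions in which
  \<open>g\<close> follows its supporting plane for a positive distance.\<close>

lemma critical_coneI: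
  assumes s: "0 < s" "(z + s *\<^sub>R u, val + s * (l \<bullet> u)) \<in> epi g"
  shows "u \<in> critical_cone g z l"
proof -
  have low: "ereal (l \<bullet> u') \<le> (g (z + t *\<^sub>R u') - g z) / ereal t" if "0 < t" for t u'
  proof (cases "g (z + t *\<^sub>R u')")
    case (real r)
    then show ?thesis using g_lower[of "z + t *\<^sub>R u'"] that by (simp add: g_z field_simps)
  qed (use g_lower[of "z + t *\<^sub>R u'"] that in \<open>auto simp: g_z\<close>)
  have "subderivative g z u \<le> ereal (l \<bullet> u)"
  proof (rule ccontr)
    assume "\<not> subderivative g z u \<le> ereal (l \<bullet> u)"
    then have "\<forall>\<^sub>F x in at_right 0 \<times>\<^sub>F nhds u.
        ereal (l \<bullet> u) < (\<lambda>(t, u'). (g (z + t *\<^sub>R u') - g z) / ereal t) x"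
      unfolding subderivative_def not_le by (rule less_LiminfD)
    moreover have "filterlim (\<lambda>t. (t, u)) (at_right 0 \<times>\<^sub>F nhds u) (at_right 0)"
      by (intro filterlim_Pair filterlim_ident tendsto_const)
    ultimately have "\<forall>\<^sub>F t in at_right 0. ereal (l \<bullet> u) < (g (z + t *\<^sub>R u) - g z) / ereal t"
      by (auto dest: eventually_compose_filterlim)
    moreover have "\<forall>\<^sub>F t in at_right 0. t \<in> {0<..<s}" using s(1) eventually_at_right_real by blast
    ultimately have "\<forall>\<^sub>F t::real in at_right 0. False"
    proof eventually_elim
      case (elim t)
      then have "(z + t *\<^sub>R u, val + t * (l \<bullet> u)) \<in> epi g" by (intro epi_segment[OF s(2)]) auto
      then have "(g (z + t *\<^sub>R u) - g z) / ereal t \<le> ereal (l \<bullet> u)"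
        using elim by (simp add: g_z ereal_quotient_le_iff epi_iff)
      then show False using elim by simp
    qed
    then show False by (simp add: trivial_limit_at_right_real)
  qed
  moreover have "ereal (l \<bullet> u) \<le> subderivative g z u"
    unfolding subderivative_def le_Liminf_iff
  proof (intro allI impI)
    fix y assume "y < ereal (l \<bullet> u)"
    moreover have "((\<lambda>u'. ereal (l \<bullet> u')) \<longlongrightarrow> ereal (l \<bullet> u)) (nhds u)"
      by (intro tendsto_intros filterlim_ident)
    ultimately have ev: "\<forall>\<^sub>F u' in nhds u. y < ereal (l \<bullet> u')" by (rule order_tendstoD(1)[rotated])
    show "\<forall>\<^sub>F x in at_right 0 \<times>\<^sub>F nhds u. y < (\<lambda>(t, u'). (g (z + t *\<^sub>R u') - g z) / ereal t) x"
      using eventually_prodI[OF eventually_at_right_less[of "0::real"] ev]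
      by eventually_elim (use low in \<open>force intro: less_le_trans\<close>)
  qed
  ultimately show ?thesis by (simp add: critical_cone_def)
qed

lemma critical_cone_zero: "0 \<in> critical_cone g z l"
  by (rule critical_coneI[of 1]) (use base_in_epi in auto)

lemma critical_cone_scale:
  assumes "u \<in> critical_cone g z l" "0 \<le> c"
  shows "c *\<^sub>R u \<in> critical_cone g z l"
proof (cases "c = 0")
  case False
  obtain s where "0 < s" "(z + s *\<^sub>R u, val + s * (l \<bullet> u)) \<in> epi g"
    using critical_coneD[OF assms(1)] by blast
  then show ?thesis using False assms(2) by (intro critical_coneI[of "s / c"]) auto
qed (simp add: critical_cone_zero)

lemma critical_cone_add:
  assumes "u \<in> critical_cone g z l" "v \<in> critical_cone g z l"
  shows "u + v \<in> critical_cone g z l"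
proof -
  obtain r s where r: "0 < r" "(z + r *\<^sub>R u, val + r * (l \<bullet> u)) \<in> epi g"
    and s: "0 < s" "(z + s *\<^sub>R v, val + s * (l \<bullet> v)) \<in> epi g"
    using critical_coneD assms by meson
  define t where "t = min r s"
  have "(z + t *\<^sub>R u, val + t * (l \<bullet> u)) \<in> epi g" "(z + t *\<^sub>R v, val + t * (l \<bullet> v)) \<in> epi g"
    using r s by (auto intro!: epi_segment[OF r(2)] epi_segment[OF s(2)] simp: t_def)
  then have "(1/2) *\<^sub>R (z + t *\<^sub>R u, val + t * (l \<bullet> u)) + (1/2) *\<^sub>R (z + t *\<^sub>R v, val + t * (l \<bullet> v)) \<in> epi g"
    using convex_epi by (intro convexD) auto
  moreover have "(1/2) *\<^sub>R (z + t *\<^sub>R u, val + t * (l \<bullet> u)) + (1/2) *\<^sub>R (z + t *\<^sub>R v, val + t * (l \<bullet> v))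
      = (z + (t / 2) *\<^sub>R (u + v), val + (t / 2) * (l \<bullet> (u + v)))"
    by (simp add: algebra_simps inner_add_right flip: scaleR_add_left)
  ultimately show ?thesis using r s by (intro critical_coneI[of "t / 2"]) (auto simp: t_def)
qed

text \<open>\<open>K\<close> is closed under sums and nonnegative multiples, so \<open>K - K\<close>
  is already a subspace. In \<open>strict_second_subderivative_le\<close> the vectors
  \<open>b\<close> and \<open>a\<close> become the directions of the start and end points.\<close>

lemma span_critical_cone:
  assumes "u \<in> span (critical_cone g z l)"
  obtains a b where "a \<in> critical_cone g z l" "b \<in> critical_cone g z l" "u = a - b"
proof -
  let ?K = "critical_cone g z l"
  have "subspace {a - b | a b. a \<in> ?K \<and> b \<in> ?K}"
    unfolding subspace_def
  proof (intro conjI ballI allI)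
    show "0 \<in> {a - b | a b. a \<in> ?K \<and> b \<in> ?K}" using critical_cone_zero by force
    fix x assume "x \<in> {a - b | a b. a \<in> ?K \<and> b \<in> ?K}"
    then obtain a b where x: "x = a - b" "a \<in> ?K" "b \<in> ?K" by blast
    show "c *\<^sub>R x \<in> {a - b | a b. a \<in> ?K \<and> b \<in> ?K}" for c
    proof (cases "0 \<le> c")
      case True
      then show ?thesis using x critical_cone_scale by (auto simp: scaleR_diff_right)
    next
      case False
      then have "c *\<^sub>R x = (- c) *\<^sub>R b - (- c) *\<^sub>R a" "0 \<le> - c" using x by (auto simp: algebra_simps)
      then show ?thesis using x critical_cone_scale by blast
    qed
    fix y assume "y \<in> {a - b | a b. a \<in> ?K \<and> b \<in> ?K}"
    then obtain a' b' where y: "y = a' - b'" "a' \<in> ?K" "b' \<in> ?K" by blast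
    have "x + y = (a + a') - (b + b')" using x y by simp
    then show "x + y \<in> {a - b | a b. a \<in> ?K \<and> b \<in> ?K}" using x y critical_cone_add by blast
  qed
  moreover have "?K \<subseteq> {a - b | a b. a \<in> ?K \<and> b \<in> ?K}" using critical_cone_zero by force
  ultimately have "span ?K \<subseteq> {a - b | a b. a \<in> ?K \<and> b \<in> ?K}" by (rule span_minimal[rotated])
  then show thesis using assms that by blast
qed

text \<open>Let \<open>e\<close> be the part of \<open>u\<close> orthogonal to the span of
  \<open>K\<close>. A generator of the epigraph that lies on the supporting plane of
  \<open>l\<close> points into \<open>K\<close> and contributes nothing along \<open>e\<close>.
  Progress along \<open>e\<close> must therefore use generators with a positive gap, and these are
  finitely many, so the cost is proportional to the progress, uniformly in the base point and in the
  subgradient.\<close>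

lemma growth_off_span:
  assumes u: "u \<notin> span (critical_cone g z l)"
  shows "\<exists>\<rho>>0. \<exists>\<delta>>0. \<forall>t u' y \<mu>. 0 < t \<longrightarrow> t < \<delta> \<longrightarrow> norm (u' - u) < \<delta> \<longrightarrow> norm (y - z) < \<delta> \<longrightarrow>
    \<bar>real_of_ereal (g y) - val\<bar> < \<delta> \<longrightarrow> norm (\<mu> - l) < \<delta> \<longrightarrow> \<mu> \<in> subdifferential g y \<longrightarrow>
    ereal (real_of_ereal (g y) + t * (\<mu> \<bullet> u') + \<rho> * t) \<le> g (y + t *\<^sub>R u')"
proof -
  obtain V \<epsilon> where V: "finite V" "V \<subseteq> epi g" and \<epsilon>: "0 < \<epsilon>"
    and gen: "\<And>q. q \<in> epi g \<Longrightarrow> norm (q - (z, val)) < \<epsilon> \<Longrightarrow>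
       \<exists>s. (\<forall>v\<in>V. 0 \<le> s v) \<and> q - (z, val) = (\<Sum>v\<in>V. s v *\<^sub>R (v - (z, val)))"
    by (rule polyhedron_local_generators[OF polyhedron_epi base_in_epi]) (rule that)
  obtain \<delta>1 where \<delta>1: "0 < \<delta>1"
    and near_sub: "\<And>y \<mu>. norm (y - z) < \<delta>1 \<Longrightarrow> \<bar>real_of_ereal (g y) - val\<bar> < \<delta>1 \<Longrightarrow>
     \<mu> \<in> subdifferential g y \<Longrightarrow> \<mu> \<in> subdifferential g z"
    using subdifferential_nearby by blast
  obtain a e where ae: "a \<in> span (critical_cone g z l)" "u = a + e"
    and orth: "\<And>w. w \<in> span (critical_cone g z l) \<Longrightarrow> orthogonal e w"
    using orthogonal_subspace_decomp_exists[of "critical_cone g z l" u] by metis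
  have "e \<noteq> 0" using ae u by auto
  then have eu: "0 < e \<bullet> u" using orth[OF ae(1)] ae(2) by (simp add: inner_add_right orthogonal_def)
  have eK: "e \<bullet> w = 0" if "w \<in> critical_cone g z l" for w
    using orth[OF span_base[OF that]] by (simp add: orthogonal_def)
  \<comment> \<open>The height of a generator above the plane through \<open>(z, val)\<close> with
    slope \<open>\<mu>\<close>.\<close>
  define gap where "gap \<mu> v = (snd v - val) - \<mu> \<bullet> (fst v - z)" for \<mu> v
  define J where "J = {v \<in> V. gap l v \<noteq> 0}"
  have J: "finite J" "J \<subseteq> V" using V by (auto simp: J_def)
  have gapJ: "0 < gap l v" if "v \<in> J" for v
    using that V(2) epi_lower[of "fst v" "snd v"] by (fastforce simp: J_def gap_def)
  have eV: "e \<bullet> (fst v - z) = 0" if "v \<in> V - J" for v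
  proof (rule eK, rule critical_coneI[of 1])
    show "(z + 1 *\<^sub>R (fst v - z), val + 1 * (l \<bullet> (fst v - z))) \<in> epi g"
    proof -
      have "val + l \<bullet> (fst v - z) = snd v" using that by (auto simp: J_def gap_def)
      then show ?thesis using that V(2) by auto
    qed
  qed simp
  \<comment> \<open>Twice \<open>c\<close>, since replacing \<open>l\<close> by a nearby
    \<open>\<mu>\<close> may cost up to \<open>\<delta> * B \<le> c\<close> of the gap.\<close>
  obtain c where c: "0 < c" "\<And>v. v \<in> J \<Longrightarrow> 2 * c \<le> gap l v"
  proof (cases "J = {}")
    case False
    show thesis
    proof (rule that[of "Min (gap l ` J) / 2"])
      show "0 < Min (gap l ` J) / 2" using False J gapJ by simp
    qed (use J in simp)
  qed (use that[of 1] in auto)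
  obtain M where M: "0 < M" "\<And>v. v \<in> V \<Longrightarrow> norm (e \<bullet> (fst v - z)) \<le> M"
    using finite_imp_bounded[OF finite_imageI[OF V(1)], of "\<lambda>v. e \<bullet> (fst v - z)"]
    unfolding bounded_pos by auto
  obtain B where B: "0 < B" "\<And>v. v \<in> V \<Longrightarrow> norm (fst v - z) \<le> B"
    using finite_imp_bounded[OF finite_imageI[OF V(1)], of "\<lambda>v. fst v - z"]
    unfolding bounded_pos by auto
  \<comment> \<open>Chosen so that growth below \<open>\<rho> * t\<close> forces
    \<open>e \<bullet> u' \<le> (e \<bullet> u) / 4\<close>, whereas closeness of \<open>u'\<close>
    to \<open>u\<close> gives at least half of \<open>e \<bullet> u\<close>.\<close>
  define \<rho> where "\<rho> = c * (e \<bullet> u) / (4 * M)"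
  have \<rho>: "0 < \<rho>" using c(1) M(1) eu by (simp add: \<rho>_def)
  \<comment> \<open>\<open>R * \<delta>\<close> dominates the distance of
    \<open>(y + t *\<^sub>R u', \<alpha>)\<close> from \<open>(z, val)\<close>: 2 for
    \<open>y\<close> and its value, the other terms for \<open>t *\<^sub>R u'\<close>,
    \<open>t * (\<mu> \<bullet> u')\<close> and \<open>\<rho> * t\<close>.\<close>
  define R where "R = 2 + (norm u + 1) + (norm l + 1) * (norm u + 1) + \<rho>"
  have "0 \<le> (norm l + 1) * (norm u + 1)" by simp
  then have R: "0 < R" using \<rho> norm_ge_zero[of u] unfolding R_def by linarith
  \<comment> \<open>In this order the entries bound \<open>u'\<close> and \<open>\<mu>\<close>, make
    \<open>\<mu>\<close> a subgradient at \<open>z\<close>, keep the gaps at least \<open>c\<close>,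
    control \<open>e \<bullet> u'\<close>, and stay where the generators represent the
    epigraph.\<close>
  define \<delta> where "\<delta> = Min {1, \<delta>1, c / B, (e \<bullet> u) / (2 * norm e), \<epsilon> / R}"
  have \<delta>: "0 < \<delta>" using \<delta>1 c B eu \<open>e \<noteq> 0\<close> \<epsilon> R by (simp add: \<delta>_def)
  have "\<delta> \<le> 1" "\<delta> \<le> \<delta>1" "\<delta> \<le> c / B" "\<delta> \<le> (e \<bullet> u) / (2 * norm e)" "\<delta> \<le> \<epsilon> / R"
    by (simp_all add: \<delta>_def)
  then have \<delta>_le: "\<delta> \<le> 1" "\<delta> \<le> \<delta>1" "\<delta> * B \<le> c" "norm e * \<delta> \<le> (e \<bullet> u) / 2" "R * \<delta> \<le> \<epsilon>"
    using B R \<open>e \<noteq> 0\<close> by (auto simp: field_simps)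
  show ?thesis
  proof (rule exI[of _ \<rho>], intro conjI \<rho>, rule exI[of _ \<delta>], intro conjI allI impI \<delta>, rule ccontr)
    fix t u' y \<mu>
    assume t: "0 < t" "t < \<delta>" and near: "norm (u' - u) < \<delta>" "norm (y - z) < \<delta>"
        "\<bar>real_of_ereal (g y) - val\<bar> < \<delta>" "norm (\<mu> - l) < \<delta>"
      and \<mu>: "\<mu> \<in> subdifferential g y"
      and below: "\<not> ereal (real_of_ereal (g y) + t * (\<mu> \<bullet> u') + \<rho> * t) \<le> g (y + t *\<^sub>R u')"
    define r where "r = real_of_ereal (g y)"
    define \<alpha> where "\<alpha> = r + t * (\<mu> \<bullet> u') + \<rho> * t"
    have q: "(y + t *\<^sub>R u', \<alpha>) \<in> epi g"
      using below by (simp add: epi_iff r_def \<alpha>_def)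
    have p: "(y, r) \<in> epi g" using subgradient_in_epi[OF \<mu>] by (simp add: r_def)
    have \<mu>z: "\<mu> \<in> subdifferential g z" using near_sub[of y \<mu>] near \<mu> \<delta>_le(2) by simp
    have gap_nonneg: "0 \<le> gap \<mu> v" if "v \<in> V" for v
      using subgradient_at_baseD[OF \<mu>z, of "fst v" "snd v"] that V(2) by (auto simp: gap_def)
    have gap_J: "c \<le> gap \<mu> v" if "v \<in> J" for v
    proof -
      have "v \<in> V" using that J by blast
      have "(\<mu> - l) \<bullet> (fst v - z) \<le> norm (\<mu> - l) * norm (fst v - z)" by (rule norm_cauchy_schwarz)
      also have "\<dots> \<le> \<delta> * B" using near(4) B(2)[OF \<open>v \<in> V\<close>] \<delta> by (intro mult_mono) auto
      finally have "(\<mu> - l) \<bullet> (fst v - z) \<le> c" using \<delta>_le by simp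
      then show ?thesis using c(2)[OF that] by (simp add: gap_def inner_diff_left)
    qed
    have bounds: "norm u' \<le> norm u + 1" "norm \<mu> \<le> norm l + 1"
      using near \<delta>_le(1) norm_triangle_sub[of u' u] norm_triangle_sub[of \<mu> l] by linarith+
    have "R * \<delta> = 2 * \<delta> + (norm u + 1) * \<delta> + (norm l + 1) * (norm u + 1) * \<delta> + \<rho> * \<delta>"
      by (simp add: R_def algebra_simps)
    moreover have "\<rho> * t \<le> \<rho> * \<delta>" using t \<rho> by simp
    moreover have "t * norm u' \<le> (norm u + 1) * \<delta>"
    proof -
      have "t * norm u' \<le> \<delta> * (norm u + 1)" using t bounds \<delta> by (intro mult_mono) auto
      then show ?thesis by (simp add: mult.commute)
    qed
    moreover have "\<bar>t * (\<mu> \<bullet> u')\<bar> \<le> (norm l + 1) * (norm u + 1) * \<delta>"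
    proof -
      have "\<bar>\<mu> \<bullet> u'\<bar> \<le> norm \<mu> * norm u'" by (rule Cauchy_Schwarz_ineq2)
      also have "\<dots> \<le> (norm l + 1) * (norm u + 1)" using bounds by (intro mult_mono) auto
      finally have "t * \<bar>\<mu> \<bullet> u'\<bar> \<le> \<delta> * ((norm l + 1) * (norm u + 1))"
        using t \<delta> by (intro mult_mono) auto
      then show ?thesis using t by (simp add: abs_mult mult.commute)
    qed
    moreover have "norm ((y + t *\<^sub>R u', \<alpha>) - (z, val)) \<le> norm (y - z) + t * norm u' + \<bar>\<alpha> - val\<bar>"
    proof -
      have "norm ((y + t *\<^sub>R u', \<alpha>) - (z, val)) \<le> norm (y + t *\<^sub>R u' - z) + \<bar>\<alpha> - val\<bar>"
        using norm_Pair_le[of "y + t *\<^sub>R u' - z" "\<alpha> - val"] by simp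
      moreover have "norm (y + t *\<^sub>R u' - z) \<le> norm (y - z) + t * norm u'"
        using norm_triangle_ineq[of "y - z" "t *\<^sub>R u'"] t(1) by (simp add: algebra_simps)
      ultimately show ?thesis by simp
    qed
    moreover have "\<bar>\<alpha> - val\<bar> \<le> \<bar>r - val\<bar> + \<bar>t * (\<mu> \<bullet> u')\<bar> + \<rho> * t"
      using mult_pos_pos[OF \<rho> t(1)] unfolding \<alpha>_def by arith
    ultimately have close_q: "norm ((y + t *\<^sub>R u', \<alpha>) - (z, val)) < \<epsilon>"
      using near \<delta>_le(5) r_def by linarith
    have "\<delta> * 2 \<le> R * \<delta>"
    proof -
      have "2 \<le> R" using \<rho> \<open>0 \<le> (norm l + 1) * (norm u + 1)\<close> norm_ge_zero[of u] unfolding R_def by linarith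
      then show ?thesis using \<delta> by (simp add: mult.commute)
    qed
    then have close_p: "norm ((y, r) - (z, val)) < \<epsilon>"
      using norm_Pair_le[of "y - z" "r - val"] near \<delta>_le(5) r_def by simp
    have gap_sum: "(snd q - val) - \<mu> \<bullet> (fst q - z) = (\<Sum>v\<in>V. s v * gap \<mu> v)"
        "e \<bullet> (fst q - z) = (\<Sum>v\<in>J. s v * (e \<bullet> (fst v - z)))"
      if s: "q - (z, val) = (\<Sum>v\<in>V. s v *\<^sub>R (v - (z, val)))" for q s
    proof -
      have 1: "fst q - z = (\<Sum>v\<in>V. s v *\<^sub>R (fst v - z))"
        using arg_cong[OF s, of fst] by (simp add: fst_sum)
      have 2: "snd q - val = (\<Sum>v\<in>V. s v * (snd v - val))"
        using arg_cong[OF s, of snd] by (simp add: snd_sum)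
      show "(snd q - val) - \<mu> \<bullet> (fst q - z) = (\<Sum>v\<in>V. s v * gap \<mu> v)"
        unfolding 1 2 gap_def by (simp add: inner_sum_right right_diff_distrib sum_subtractf)
      have "e \<bullet> (fst q - z) = (\<Sum>v\<in>V. s v * (e \<bullet> (fst v - z)))"
        unfolding 1 by (simp add: inner_sum_right)
      also have "\<dots> = (\<Sum>v\<in>J. s v * (e \<bullet> (fst v - z)))"
        using V J eV by (intro sum.mono_neutral_right) auto
      finally show "e \<bullet> (fst q - z) = (\<Sum>v\<in>J. s v * (e \<bullet> (fst v - z)))" .
    qed
    \<comment> \<open>\<open>\<mu>\<close> is a subgradient both at \<open>y\<close> and at
      \<open>z\<close>, so its supporting plane touches the epigraph at both points.\<close>
    have tight: "r - val - \<mu> \<bullet> (y - z) = 0"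
    proof (rule antisym)
      show "r - val - \<mu> \<bullet> (y - z) \<le> 0"
        using subgradient_ineq[OF \<mu> base_in_epi] by (simp add: r_def inner_diff_right)
      show "0 \<le> r - val - \<mu> \<bullet> (y - z)" using subgradient_at_baseD[OF \<mu>z p] by simp
    qed
    \<comment> \<open>Zero total gap leaves no weight on \<open>J\<close>, so the base point has no
      component along \<open>e\<close> and all progress along \<open>e\<close> is due to the step
      \<open>t *\<^sub>R u'\<close>.\<close>
    have ey: "e \<bullet> (y - z) = 0"
    proof -
      obtain s where s: "\<forall>v\<in>V. 0 \<le> s v" "(y, r) - (z, val) = (\<Sum>v\<in>V. s v *\<^sub>R (v - (z, val)))"
        using gen[OF p close_p] by blast
      have "(\<Sum>v\<in>V. s v * gap \<mu> v) = 0" using gap_sum(1)[OF s(2)] tight by simp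
      then have "\<forall>v\<in>V. s v * gap \<mu> v = 0"
        using V(1) s(1) gap_nonneg by (subst (asm) sum_nonneg_eq_0_iff) auto
      then have "\<forall>v\<in>J. s v = 0" using gap_J c(1) J by fastforce
      then show ?thesis using gap_sum(2)[OF s(2)] by simp
    qed
    obtain s where s: "\<forall>v\<in>V. 0 \<le> s v" "(y + t *\<^sub>R u', \<alpha>) - (z, val) = (\<Sum>v\<in>V. s v *\<^sub>R (v - (z, val)))"
      using gen[OF q close_q] by blast
    \<comment> \<open>The total gap of the moved point is exactly \<open>\<rho> * t\<close>, since
      the linear part cancels by \<open>tight\<close>; this limits the weight available on
      \<open>J\<close>.\<close>
    have "c * sum s J \<le> (\<Sum>v\<in>J. s v * gap \<mu> v)"
      unfolding sum_distrib_left
    proof (rule sum_mono)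
      fix v assume v: "v \<in> J"
      have "s v * c \<le> s v * gap \<mu> v" using gap_J[OF v] s(1) v J by (intro mult_left_mono) auto
      then show "c * s v \<le> s v * gap \<mu> v" by (simp add: mult.commute)
    qed
    also have "\<dots> \<le> (\<Sum>v\<in>V. s v * gap \<mu> v)"
      using V(1) J(2) s(1) gap_nonneg by (intro sum_mono2) auto
    also have "\<dots> = \<rho> * t"
      using gap_sum(1)[OF s(2)] tight by (simp add: \<alpha>_def algebra_simps inner_add_right inner_diff_right)
    finally have sJ: "c * sum s J \<le> \<rho> * t" .
    have "t * (e \<bullet> u') = e \<bullet> (y + t *\<^sub>R u' - z)" using ey by (simp add: inner_add_right inner_diff_right)
    also have "\<dots> = (\<Sum>v\<in>J. s v * (e \<bullet> (fst v - z)))" using gap_sum(2)[OF s(2)] by simp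
    also have "\<dots> \<le> (\<Sum>v\<in>J. s v * M)"
    proof (rule sum_mono)
      fix v assume "v \<in> J"
      then show "s v * (e \<bullet> (fst v - z)) \<le> s v * M"
        using s(1) M(2)[of v] J by (intro mult_left_mono) auto
    qed
    also have "\<dots> = sum s J * M" by (simp add: sum_distrib_right)
    finally have "c * (t * (e \<bullet> u')) \<le> c * (sum s J * M)" using c(1) by (intro mult_left_mono) auto
    also have "\<dots> \<le> \<rho> * t * M" using mult_right_mono[OF sJ, of M] M(1) by (simp add: mult.assoc)
    also have "\<dots> = c * (t * ((e \<bullet> u) / 4))" using M(1) by (simp add: \<rho>_def)
    finally have "e \<bullet> u' \<le> (e \<bullet> u) / 4" using c(1) t(1) by simp
    moreover have "e \<bullet> u - e \<bullet> u' \<le> (e \<bullet> u) / 2"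
    proof -
      have "e \<bullet> (u - u') \<le> norm e * norm (u - u')" by (rule norm_cauchy_schwarz)
      also have "\<dots> \<le> norm e * \<delta>" using near(1) by (intro mult_left_mono) (auto simp: norm_minus_commute)
      finally show ?thesis using \<delta>_le(4) by (simp add: inner_diff_right)
    qed
    ultimately show False using eu by simp
  qed
qed

text \<open>At relative interior points \<open>\<mu>\<close> of \<open>subdifferential g z\<close>, tangents \<open>(a, b)\<close> to the graph
  satisfy \<open>a\<close> orthogonal to the parallel space, so \<open>(\<eta>, 0)\<close> is a regular normal there.\<close>

lemma parallel_space_subset_coderivative:
  "parallel_space \<subseteq> coderivative (subdifferential g) z l 0"
proof
  fix \<eta> assume \<eta>: "\<eta> \<in> parallel_space"
  let ?C = "subdifferential g z"
  have "convex ?C"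
    unfolding convex_alt
  proof (intro ballI allI impI)
    fix \<mu> \<nu> s assume "\<mu> \<in> ?C" "\<nu> \<in> ?C" and s: "0 \<le> s \<and> s \<le> (1::real)"
    then have *: "val + \<mu> \<bullet> (y - z) \<le> \<alpha>" "val + \<nu> \<bullet> (y - z) \<le> \<alpha>" if "(y, \<alpha>) \<in> epi g" for y \<alpha>
      using that subgradient_at_base_iff by blast+
    have "val + ((1 - s) *\<^sub>R \<mu> + s *\<^sub>R \<nu>) \<bullet> (y - z) \<le> \<alpha>" if "(y, \<alpha>) \<in> epi g" for y \<alpha>
      using convex_bound_le[OF *[OF that], of "1 - s" s] s
      by (simp add: algebra_simps inner_add_left inner_diff_left)
    then show "(1 - s) *\<^sub>R \<mu> + s *\<^sub>R \<nu> \<in> ?C" by (simp add: subgradient_at_base_iff)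
  qed
  moreover have "?C \<noteq> {}" using subgradient by blast
  ultimately obtain m where m: "m \<in> rel_interior ?C" using rel_interior_eq_empty by blast
  obtain \<delta> where \<delta>: "0 < \<delta>"
    and near_sub: "\<And>y \<mu>. norm (y - z) < \<delta> \<Longrightarrow> \<bar>real_of_ereal (g y) - val\<bar> < \<delta> \<Longrightarrow>
     \<mu> \<in> subdifferential g y \<Longrightarrow> \<mu> \<in> ?C"
    using subdifferential_nearby by blast
  have regular: "(\<eta>, 0) \<in> regular_normal_cone (gph (subdifferential g)) (z, \<mu>)"
    if \<mu>: "\<mu> \<in> rel_interior ?C" for \<mu>
    unfolding regular_normal_cone_def polar_cone_def
  proof (intro CollectI ballI)
    fix w assume "w \<in> tangent_cone (gph (subdifferential g)) (z, \<mu>)"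
    then obtain t u where tu: "\<And>k::nat. 0 < t k" "\<And>k. (z, \<mu>) + t k *\<^sub>R u k \<in> gph (subdifferential g)"
      and lim: "t \<longlonglongrightarrow> 0" "u \<longlonglongrightarrow> w"
      unfolding tangent_cone_iff by blast
    define a b where "a k = fst (u k)" and "b k = snd (u k)" for k
    have ab: "a \<longlonglongrightarrow> fst w" "b \<longlonglongrightarrow> snd w"
      unfolding a_def b_def using lim by (auto intro: tendsto_intros)
    have sub: "\<mu> + t k *\<^sub>R b k \<in> subdifferential g (z + t k *\<^sub>R a k)" for k
      using tu(2)[of k] by (simp add: gph_def a_def b_def case_prod_unfold)
    have "(\<lambda>k. real_of_ereal (g (z + t k *\<^sub>R a k))) \<longlonglongrightarrow> val"
    proof (rule tendsto_sandwich)
      show "\<forall>\<^sub>F k in sequentially. val + l \<bullet> (t k *\<^sub>R a k) \<le> real_of_ereal (g (z + t k *\<^sub>R a k))"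
        using epi_lower[OF subgradient_in_epi[OF sub]] by simp
      show "\<forall>\<^sub>F k in sequentially. real_of_ereal (g (z + t k *\<^sub>R a k)) \<le>
          val + (\<mu> + t k *\<^sub>R b k) \<bullet> (t k *\<^sub>R a k)"
      proof (rule always_eventually, rule allI)
        show "real_of_ereal (g (z + t k *\<^sub>R a k)) \<le> val + (\<mu> + t k *\<^sub>R b k) \<bullet> (t k *\<^sub>R a k)" for k
          using subgradient_ineq[OF sub[of k] base_in_epi] by simp
      qed
      show "(\<lambda>k. val + l \<bullet> (t k *\<^sub>R a k)) \<longlonglongrightarrow> val"
        using tendsto_add[OF tendsto_const tendsto_inner[OF tendsto_const tendsto_scaleR[OF lim(1) ab(1)]], of val l]
        by simp
      have "(\<lambda>k. val + (\<mu> + t k *\<^sub>R b k) \<bullet> (t k *\<^sub>R a k)) \<longlonglongrightarrow> val + (\<mu> + 0 *\<^sub>R snd w) \<bullet> (0 *\<^sub>R fst w)"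
        using lim(1) ab by (intro tendsto_intros)
      then show "(\<lambda>k. val + (\<mu> + t k *\<^sub>R b k) \<bullet> (t k *\<^sub>R a k)) \<longlonglongrightarrow> val" by simp
    qed
    from tendstoD[OF this \<delta>]
    have ev1: "\<forall>\<^sub>F k in sequentially. \<bar>real_of_ereal (g (z + t k *\<^sub>R a k)) - val\<bar> < \<delta>"
      by (simp add: dist_real_def)
    have "(\<lambda>k. t k *\<^sub>R a k) \<longlonglongrightarrow> 0 *\<^sub>R fst w" using lim(1) ab(1) by (intro tendsto_intros)
    from tendstoD[OF this \<delta>] have ev2: "\<forall>\<^sub>F k in sequentially. norm (z + t k *\<^sub>R a k - z) < \<delta>"
      by simp
    \<comment> \<open>Monotonicity of the subdifferential between \<open>z\<close> and
      \<open>z + t k *\<^sub>R a k\<close>, divided by \<open>t k\<close> and passed to the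
      limit.\<close>
    have "(\<nu> - \<mu>) \<bullet> fst w \<le> 0" if \<nu>: "\<nu> \<in> ?C" for \<nu>
    proof -
      have "\<forall>\<^sub>F k in sequentially. (\<nu> - (\<mu> + t k *\<^sub>R b k)) \<bullet> a k \<le> 0"
        using ev1 ev2
      proof eventually_elim
        case (elim k)
        define y where "y = z + t k *\<^sub>R a k"
        have "val + \<nu> \<bullet> (y - z) \<le> real_of_ereal (g y)"
          using subgradient_at_baseD[OF \<nu> subgradient_in_epi[OF sub]] by (simp add: y_def)
        moreover have "real_of_ereal (g y) + (\<mu> + t k *\<^sub>R b k) \<bullet> (z - y) \<le> val"
          using subgradient_ineq[OF sub base_in_epi] by (simp add: y_def)
        ultimately have "t k * ((\<nu> - (\<mu> + t k *\<^sub>R b k)) \<bullet> a k) \<le> 0"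
          by (simp add: y_def inner_diff_left inner_add_left algebra_simps)
        then show ?case using tu(1)[of k] by (simp add: mult_le_0_iff)
      qed
      moreover have "(\<lambda>k. (\<nu> - (\<mu> + t k *\<^sub>R b k)) \<bullet> a k) \<longlonglongrightarrow> (\<nu> - (\<mu> + 0 *\<^sub>R snd w)) \<bullet> fst w"
        using lim(1) ab by (intro tendsto_intros)
      ultimately show ?thesis by (simp add: tendsto_upperbound)
    qed
    then have le: "(\<nu> - \<mu>) \<bullet> fst w \<le> 0" if "\<nu> \<in> ?C" for \<nu> using that by blast
    \<comment> \<open>From \<open>\<nu>\<close> one can go slightly past a relatively interior
      \<open>\<mu>\<close> without leaving \<open>?C\<close>, which gives the inequality with
      reversed sign.\<close>
    have zero: "(\<nu> - \<mu>) \<bullet> fst w = 0" if \<nu>: "\<nu> \<in> ?C" for \<nu>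
    proof -
      obtain s where s: "1 < s" "(1 - s) *\<^sub>R \<nu> + s *\<^sub>R \<mu> \<in> ?C"
        using \<mu> \<nu> convex_rel_interior_iff[OF \<open>convex ?C\<close> \<open>?C \<noteq> {}\<close>] by blast
      have "(1 - s) *\<^sub>R \<nu> + s *\<^sub>R \<mu> - \<mu> = (1 - s) *\<^sub>R (\<nu> - \<mu>)" by (simp add: algebra_simps)
      then have "(1 - s) * ((\<nu> - \<mu>) \<bullet> fst w) \<le> 0" using le[OF s(2)] by simp
      then have "0 \<le> (\<nu> - \<mu>) \<bullet> fst w" using s(1) by (simp add: mult_le_0_iff)
      then show ?thesis using le[OF \<nu>] by simp
    qed
    have "\<nu> \<bullet> fst w = 0" if "\<nu> \<in> parallel_space" for \<nu>
      using that unfolding parallel_space_def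
    proof (induction rule: span_induct)
      case (step x)
      then show ?case using zero subgradient by (auto simp: inner_diff_left)
    next
      show "subspace {\<nu>. \<nu> \<bullet> fst w = 0}" by (simp add: subspace_hyperplane2)
    qed
    then show "(\<eta>, 0) \<bullet> w \<le> 0" using \<eta> by (simp add: inner_prod_def)
  qed
  \<comment> \<open>\<open>l\<close> may lie on the relative boundary; these points on the way from
    \<open>l\<close> to \<open>m\<close> are relatively interior and carry the regular normal
    \<open>(\<eta>, 0)\<close> to a limiting normal at \<open>l\<close>.\<close>
  define \<mu> where "\<mu> k = l - inverse (real (Suc k)) *\<^sub>R (l - m)" for k
  have \<mu>: "\<mu> k \<in> rel_interior ?C" for k
    unfolding \<mu>_def
    by (rule rel_interior_convex_shrink[OF \<open>convex ?C\<close> m subgradient]) (auto simp: inverse_le_1_iff)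
  have "\<mu> \<longlonglongrightarrow> l - 0 *\<^sub>R (l - m)"
    unfolding \<mu>_def by (intro tendsto_intros LIMSEQ_inverse_real_of_nat)
  then have "(\<lambda>k. (z, \<mu> k)) \<longlonglongrightarrow> (z, l)" by (intro tendsto_Pair) auto
  moreover have "(z, \<mu> k) \<in> gph (subdifferential g)" for k
    using \<mu>[of k] rel_interior_subset[of ?C] by (auto simp: gph_def)
  ultimately have "(\<eta>, 0) \<in> normal_cone (gph (subdifferential g)) (z, l)"
    unfolding normal_cone_def
    by (intro CollectI exI[of _ "\<lambda>k. (z, \<mu> k)"] exI[of _ "\<lambda>_. (\<eta>, 0)"]) (use regular \<mu> in auto)
  then show "\<eta> \<in> coderivative (subdifferential g) z l 0"
    by (simp add: coderivative_def)
qed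

end

section \<open>Solving modulo a subspace\<close>

lemma inner_transpose:
  fixes A :: "real^'n^'m"
  shows "(transpose A *v l) \<bullet> w = l \<bullet> (A *v w)"
  by (simp add: dot_lmul_matrix transpose_matrix_vector)

lemma tendsto_matrix_vector_mult [tendsto_intros]:
  fixes A :: "'a \<Rightarrow> real^'n^'m"
  assumes "(A \<longlongrightarrow> a) F" "(v \<longlongrightarrow> b) F"
  shows "((\<lambda>x. A x *v v x) \<longlongrightarrow> a *v b) F"
  unfolding matrix_vector_mult_def
  by (intro vec_tendstoI) (use assms in \<open>auto intro!: tendsto_intros\<close>)

lemma orthogonal_projection_exists:
  fixes L :: "'a::euclidean_space set"
  assumes "subspace L"
  obtains P where "linear P" "\<And>u. P u \<in> L" "\<And>u \<eta>. \<eta> \<in> L \<Longrightarrow> \<eta> \<bullet> P u = \<eta> \<bullet> u"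
proof -
  obtain B where B: "B \<subseteq> L" "pairwise orthogonal B" "\<And>x. x \<in> B \<Longrightarrow> norm x = 1"
    "independent B" "span B = L"
    using orthonormal_basis_subspace[OF assms] by metis
  have "finite B" using B(4) by (rule independent_imp_finite)
  define P where "P u = (\<Sum>b\<in>B. (b \<bullet> u) *\<^sub>R b)" for u
  show thesis
  proof
    show "linear P"
      by (rule linearI) (simp_all add: P_def inner_add_right scaleR_add_left sum.distrib scaleR_sum_right)
    show "P u \<in> L" for u
      unfolding P_def using B(1) assms by (intro subspace_sum subspace_scale) auto
    show "\<eta> \<bullet> P u = \<eta> \<bullet> u" if "\<eta> \<in> L" for u \<eta>
      using that unfolding B(5)[symmetric]
    proof (induction rule: span_induct)
      case (step x)
      have "x \<bullet> P u = (\<Sum>b\<in>B. if b = x then (x \<bullet> u) else 0)"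
        unfolding P_def inner_sum_right
      proof (rule sum.cong)
        fix b assume "b \<in> B"
        then have "b \<noteq> x \<Longrightarrow> x \<bullet> b = 0" "b = x \<Longrightarrow> x \<bullet> b = 1"
          using B(2) step B(3)[of x]
          by (auto simp: pairwise_def orthogonal_def inner_commute norm_eq_1)
        then show "x \<bullet> (b \<bullet> u) *\<^sub>R b = (if b = x then x \<bullet> u else 0)" by auto
      qed simp
      then show ?case using step \<open>finite B\<close> by simp
    next
      have "{\<eta>. \<eta> \<bullet> P u = \<eta> \<bullet> u} = {\<eta>. \<eta> \<bullet> (P u - u) = 0}" by (simp add: inner_diff_right)
      then show "subspace {\<eta>. \<eta> \<bullet> P u = \<eta> \<bullet> u}" by (simp add: subspace_hyperplane2)
    qed
  qed
qed

text \<open>\<open>P \<circ> D\<close> is onto \<open>L\<close>: otherwise a nonzero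
  \<open>\<eta>\<close> in \<open>L\<close> would be orthogonal to its range and hence to all
  \<open>D h\<close>. \<open>B\<close> is a right inverse on \<open>L\<close>, preceded by the
  projection.\<close>

lemma projected_right_inverse:
  fixes D :: "'a::euclidean_space \<Rightarrow> 'b::euclidean_space"
  assumes D: "linear D" and L: "subspace L"
    and inj: "\<And>\<eta>. \<eta> \<in> L \<Longrightarrow> (\<And>h. \<eta> \<bullet> D h = 0) \<Longrightarrow> \<eta> = 0"
  obtains B where "linear B" "\<And>v \<eta>. \<eta> \<in> L \<Longrightarrow> \<eta> \<bullet> D (B v) = \<eta> \<bullet> v"
proof -
  obtain P where P: "linear P" "\<And>u. P u \<in> L" "\<And>u \<eta>. \<eta> \<in> L \<Longrightarrow> \<eta> \<bullet> P u = \<eta> \<bullet> u"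
    using orthogonal_projection_exists[OF L] by metis
  have PD: "linear (P \<circ> D)" using D P(1) by (rule linear_compose)
  have range: "range (P \<circ> D) = L"
  proof (rule ccontr)
    assume ne: "range (P \<circ> D) \<noteq> L"
    have "subspace (range (P \<circ> D))" using PD by (rule linear_subspace_image) simp
    moreover have "range (P \<circ> D) \<subset> L" using ne P(2) by auto
    ultimately have "span (range (P \<circ> D)) \<subset> span L" using L by (metis span_eq_iff)
    then obtain \<eta> where \<eta>: "\<eta> \<noteq> 0" "\<eta> \<in> span L" "\<And>v. v \<in> span (range (P \<circ> D)) \<Longrightarrow> orthogonal \<eta> v"
      using orthogonal_to_subspace_exists_gen[of "range (P \<circ> D)" L] by metis
    have "\<eta> \<in> L" using \<eta>(2) L by (metis span_eq_iff)
    moreover have "\<eta> \<bullet> D h = 0" for h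
      using \<eta>(3)[OF span_base, of "P (D h)"] P(3)[OF \<open>\<eta> \<in> L\<close>, of "D h"] by (auto simp: orthogonal_def)
    ultimately show False using inj \<eta>(1) by blast
  qed
  obtain B' where B': "linear B'" "\<And>v. v \<in> L \<Longrightarrow> P (D (B' v)) = v"
    using linear_exists_right_inverse_on[OF PD, of UNIV] range by auto
  show thesis
  proof
    show "linear (B' \<circ> P)" using P(1) B'(1) by (rule linear_compose)
    show "\<eta> \<bullet> D ((B' \<circ> P) v) = \<eta> \<bullet> v" if "\<eta> \<in> L" for v \<eta>
      using B'(2)[OF P(2)] P(3)[OF that] by (metis comp_apply)
  qed
qed

text \<open>Brouwer's theorem replaces the implicit function theorem: differentiability at the single
  point \<open>x\<close> suffices to solve the projected equation along a curve with prescribed tangent \<open>p\<close>.\<close>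

lemma curve_with_prescribed_projection:
  fixes f :: "'a::euclidean_space \<Rightarrow> 'b::euclidean_space"
  assumes f: "(f has_derivative D) (at x)" and U: "open U" "x \<in> U" "continuous_on U f"
    and L: "subspace L" and inj: "\<And>\<eta>. \<eta> \<in> L \<Longrightarrow> (\<And>h. \<eta> \<bullet> D h = 0) \<Longrightarrow> \<eta> = 0"
    and p: "\<And>\<eta>. \<eta> \<in> L \<Longrightarrow> \<eta> \<bullet> (D p - y) = 0" and e: "0 < e"
  shows "\<forall>\<^sub>F t in at_right 0. \<exists>r. norm (r - p) \<le> e \<and> (\<forall>\<eta>\<in>L. \<eta> \<bullet> (f (x + t *\<^sub>R r) - f x - t *\<^sub>R y) = 0)"
proof -
  obtain P where P: "linear P" "\<And>u. P u \<in> L" "\<And>u \<eta>. \<eta> \<in> L \<Longrightarrow> \<eta> \<bullet> P u = \<eta> \<bullet> u"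
    using orthogonal_projection_exists[OF L] by metis
  have P_zero_iff: "P u = 0 \<longleftrightarrow> (\<forall>\<eta>\<in>L. \<eta> \<bullet> u = 0)" for u
  proof
    assume *: "\<forall>\<eta>\<in>L. \<eta> \<bullet> u = 0"
    have "P u \<bullet> P u = 0" using P(2,3) * by simp
    then show "P u = 0" by simp
  qed (metis P(3) inner_zero_right)
  have PL: "P v = v" if "v \<in> L" for v
  proof -
    have "v - P v \<in> L" using that P(2) L by (simp add: subspace_diff)
    then have "(v - P v) \<bullet> (v - P v) = 0" using P(3) by (simp add: inner_diff_right)
    then show ?thesis by simp
  qed
  interpret D: linear D using f by (simp add: has_derivative_linear)
  interpret P: linear P by (rule P(1))
  obtain B where B: "linear B" "\<And>v \<eta>. \<eta> \<in> L \<Longrightarrow> \<eta> \<bullet> D (B v) = \<eta> \<bullet> v"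
    using projected_right_inverse[OF D.linear_axioms L inj] by metis
  have PDB: "P (D (B v)) = P v" for v
  proof -
    have "P (D (B v) - v) = 0" using B(2) by (simp add: P_zero_iff inner_diff_right)
    then show ?thesis by (simp add: P.diff)
  qed
  interpret B: linear B by (rule B(1))
  obtain KB where KB: "0 < KB" "\<And>v. norm (B v) \<le> KB * norm v"
    using linear_bounded_pos[OF B(1)] by blast
  obtain KP where KP: "0 < KP" "\<And>v. norm (P v) \<le> KP * norm v"
    using linear_bounded_pos[OF P(1)] by blast
  \<comment> \<open>\<open>B\<close> maps \<open>cball 0 d\<close> into the ball of radius
    \<open>e\<close>, so every candidate direction \<open>p + B s\<close> has norm at most
    \<open>M\<close>; \<open>\<epsilon>\<close> then makes the projected remainder, divided by
    \<open>t\<close>, at most \<open>d\<close>.\<close>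
  define d where "d = e / KB"
  have d: "0 < d" "KB * d \<le> e" using e KB by (simp_all add: d_def)
  define M where "M = norm p + e"
  have M: "0 < M" using e by (simp add: M_def add_nonneg_pos)
  define \<epsilon> where "\<epsilon> = d / (KP * M)"
  have \<epsilon>: "0 < \<epsilon>" "KP * (\<epsilon> * M) = d" using d KP M by (simp_all add: \<epsilon>_def)
  obtain \<delta> where \<delta>: "0 < \<delta>" "\<And>h. norm h < \<delta> \<Longrightarrow> norm (f (x + h) - f x - D h) \<le> \<epsilon> * norm h"
    using f \<epsilon>(1) unfolding has_derivative_at_alt by (metis add_diff_cancel_left')
  obtain \<delta>' where \<delta>': "0 < \<delta>'" "ball x \<delta>' \<subseteq> U" using U(1,2) open_contains_ball by blast
  have "\<forall>\<^sub>F t in at_right 0. t \<in> {0<..<min \<delta> \<delta>' / (2 * M)}"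
    using \<delta>(1) \<delta>'(1) M by (intro eventually_at_right_real) simp
  then show ?thesis
  proof eventually_elim
    case (elim t)
    then have t: "0 < t" "t * M < \<delta>" "t * M < \<delta>'"
    proof -
      show "0 < t" using elim by simp
      have "t * (2 * M) < min \<delta> \<delta>'" using elim M by (simp add: pos_less_divide_eq)
      moreover have "t * M > 0" using \<open>0 < t\<close> M by simp
      ultimately show "t * M < \<delta>" "t * M < \<delta>'" by (simp_all add: algebra_simps)
    qed
    define r where "r s = p + B s" for s
    have Bs: "norm (B s) \<le> e" if "s \<in> cball 0 d" for s
    proof -
      have "norm (B s) \<le> KB * norm s" by (rule KB)
      also have "\<dots> \<le> KB * d" using that KB(1) by simp
      finally show ?thesis using d by simp
    qed
    have r: "norm (t *\<^sub>R r s) \<le> t * M" if "s \<in> cball 0 d" for s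
    proof -
      have "norm (r s) \<le> M" using Bs[OF that] norm_triangle_ineq[of p "B s"] by (simp add: r_def M_def)
      then show ?thesis using t(1) by simp
    qed
    \<comment> \<open>The first summand is the equation to be solved, with values in
      \<open>L\<close>. Adding \<open>s - P s\<close> brings \<open>G\<close> close to the identity
      on a full-dimensional ball, as Brouwer's theorem requires; applying \<open>P\<close> at a zero
      of \<open>G\<close> recovers the equation.\<close>
    define G where "G s = (1 / t) *\<^sub>R P (f (x + t *\<^sub>R r s) - f x - t *\<^sub>R y) + (s - P s)" for s
    have "\<exists>s\<in>cball 0 d. G s = 0"
    proof (rule brouwer_surjective_cball[where S = "{0}"])
      have "continuous_on (cball 0 d) (\<lambda>s. f (x + t *\<^sub>R r s))"
      proof (rule continuous_on_compose2[OF U(3)])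
        show "continuous_on (cball 0 d) (\<lambda>s. x + t *\<^sub>R r s)"
          unfolding r_def using B(1) by (intro continuous_intros linear_continuous_on linear_conv_bounded_linear[THEN iffD1])
        show "(\<lambda>s. x + t *\<^sub>R r s) ` cball 0 d \<subseteq> U"
        proof (rule image_subsetI)
          fix s assume "s \<in> cball (0::'b) d"
          from r[OF this] t(3) have "x + t *\<^sub>R r s \<in> ball x \<delta>'" by (simp add: dist_norm)
          then show "x + t *\<^sub>R r s \<in> U" using \<delta>' by blast
        qed
      qed
      then have "continuous_on (cball 0 d) (\<lambda>s. P (f (x + t *\<^sub>R r s) - f x - t *\<^sub>R y))"
        by (intro bounded_linear.continuous_on[OF linear_conv_bounded_linear[THEN iffD1, OF P(1)]]
            continuous_on_diff continuous_on_const)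
      moreover have "continuous_on (cball 0 d) P"
        using P(1) by (simp add: linear_continuous_on linear_conv_bounded_linear)
      ultimately show "continuous_on (cball 0 d) G"
        unfolding G_def
        by (intro continuous_on_add continuous_on_scaleR continuous_on_const continuous_on_diff continuous_on_id)
      fix v s assume v: "v \<in> {0::'b}" and s: "s \<in> cball (0::'b) d"
      \<comment> \<open>Because \<open>P (D (B s)) = P s\<close>, the linear part cancels and
        \<open>G s - s\<close> is the projected remainder over \<open>t\<close>.\<close>
      define R where "R = f (x + t *\<^sub>R r s) - f x - D (t *\<^sub>R r s)"
      have "norm R \<le> \<epsilon> * norm (t *\<^sub>R r s)" unfolding R_def using r[OF s] t(2) by (intro \<delta>(2)) simp
      also have "\<dots> \<le> \<epsilon> * (t * M)" using r[OF s] \<epsilon>(1) by (intro mult_left_mono) auto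
      finally have R: "norm R \<le> t * (\<epsilon> * M)" by (simp add: algebra_simps)
      have "P (D p - y) = 0" using p P_zero_iff by blast
      then have "P (D (r s) - y) = P s"
        using PDB[of s] by (simp add: r_def D.add P.add P.diff)
      moreover have "f (x + t *\<^sub>R r s) - f x - t *\<^sub>R y = R + t *\<^sub>R (D (r s) - y)"
        by (simp add: R_def D.scale algebra_simps)
      ultimately have "G s = (1 / t) *\<^sub>R P R + s"
        using t(1) by (simp add: G_def P.add P.scale scaleR_add_right)
      then have "norm (v + (s - G s)) = norm (P R) / t" using v t(1) by simp
      also have "\<dots> \<le> KP * norm R / t" using KP(2)[of R] t(1) by (simp add: divide_right_mono)
      also have "\<dots> \<le> KP * (t * (\<epsilon> * M)) / t"
        using R KP(1) t(1) by (intro divide_right_mono mult_left_mono) auto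
      also have "\<dots> = d" using t(1) \<epsilon>(2) by simp
      finally show "v + (s - G s) \<in> cball 0 d" by simp
    qed (use d in auto)
    then obtain s where s: "s \<in> cball 0 d" "G s = 0" by blast
    define u where "u = f (x + t *\<^sub>R r s) - f x - t *\<^sub>R y"
    have "P (G s) = (1 / t) *\<^sub>R P u"
      using PL[OF P(2)] by (simp add: G_def u_def P.add P.diff P.scale)
    then have "P u = 0" using s(2) t(1) by (simp add: P.zero)
    moreover have "norm (r s - p) \<le> e" using Bs[OF s(1)] by (simp add: r_def)
    ultimately show ?case unfolding P_zero_iff u_def by blast
  qed
qed

section \<open>Second-order expansion\<close>

lemma jacobian_row:
  fixes \<Phi> :: "real^'n \<Rightarrow> real^'m"
  assumes "\<Phi> differentiable (at y)"
  shows "jacobian \<Phi> (at y) $ i = gradient (\<lambda>z. \<Phi> z $ i) y"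
proof -
  have "(\<Phi> has_derivative frechet_derivative \<Phi> (at y)) (at y)"
    using assms by (simp add: frechet_derivative_works)
  then have "((\<lambda>z. \<Phi> z $ i) has_derivative (\<lambda>h. frechet_derivative \<Phi> (at y) h $ i)) (at y)"
    by (rule bounded_linear.has_derivative[OF bounded_linear_vec_nth])
  then have "frechet_derivative (\<lambda>z. \<Phi> z $ i) (at y) = (\<lambda>h. frechet_derivative \<Phi> (at y) h $ i)"
    by (rule frechet_derivative_at[symmetric])
  then show ?thesis by (simp add: jacobian_def gradient_def matrix_def vec_eq_iff)
qed

lemma component_has_derivative:
  fixes \<Phi> :: "real^'n \<Rightarrow> real^'m"
  assumes "\<Phi> differentiable (at y)"
  shows "((\<lambda>z. \<Phi> z $ i) has_derivative (\<lambda>h. gradient (\<lambda>z. \<Phi> z $ i) y \<bullet> h)) (at y)"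
proof -
  have "(\<Phi> has_derivative (\<lambda>h. jacobian \<Phi> (at y) *v h)) (at y)"
    using assms by (simp add: jacobian_works)
  then have "((\<lambda>z. \<Phi> z $ i) has_derivative (\<lambda>h. (jacobian \<Phi> (at y) *v h) $ i)) (at y)"
    by (rule bounded_linear.has_derivative[OF bounded_linear_vec_nth])
  then show ?thesis
    by (simp add: matrix_vector_mul_component jacobian_row[OF assms])
qed

text \<open>Maclaurin's formula on the segment. The Lagrange remainder keeps an exact equality with
  the Hessian at an intermediate point, so continuity of the Hessian enters only when limits are
  taken.\<close>

lemma second_order_taylor:
  fixes f :: "real^'n \<Rightarrow> real"
  assumes t: "0 < t" and seg: "\<And>s. 0 \<le> s \<Longrightarrow> s \<le> t \<Longrightarrow> x + s *\<^sub>R w \<in> U"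
    and f': "\<And>y. y \<in> U \<Longrightarrow> (f has_derivative (\<lambda>h. gradient f y \<bullet> h)) (at y)"
    and f'': "\<And>y. y \<in> U \<Longrightarrow> gradient f differentiable (at y)"
  shows "\<exists>s. 0 < s \<and> s < t \<and>
    f (x + t *\<^sub>R w) - f x - t * (gradient f x \<bullet> w) = (hessian f (x + s *\<^sub>R w) *v w) \<bullet> w * (1/2 * t\<^sup>2)"
proof -
  define diff where "diff = (\<lambda>m::nat. if m = 0 then (\<lambda>s. f (x + s *\<^sub>R w))
     else if m = 1 then (\<lambda>s. gradient f (x + s *\<^sub>R w) \<bullet> w)
     else (\<lambda>s. (hessian f (x + s *\<^sub>R w) *v w) \<bullet> w))"
  have line: "((\<lambda>s. x + s *\<^sub>R w) has_derivative (\<lambda>h. h *\<^sub>R w)) (at s)" for s :: real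
    by (auto intro!: derivative_eq_intros)
  have d0: "DERIV (diff 0) s :> diff 1 s" if "0 \<le> s" "s \<le> t" for s
  proof -
    have "((\<lambda>s. f (x + s *\<^sub>R w)) has_derivative (\<lambda>h. gradient f (x + s *\<^sub>R w) \<bullet> (h *\<^sub>R w))) (at s)"
      using has_derivative_compose[OF line f'[OF seg[OF that]]] .
    then show ?thesis
      unfolding has_field_derivative_def diff_def by (simp add: mult_commute_abs)
  qed
  have d1: "DERIV (diff 1) s :> diff 2 s" if "0 \<le> s" "s \<le> t" for s
  proof -
    have "(gradient f has_derivative (\<lambda>h. hessian f (x + s *\<^sub>R w) *v h)) (at (x + s *\<^sub>R w))"
      using f''[OF seg[OF that]] unfolding hessian_def by (simp add: jacobian_works)
    from has_derivative_inner_left[OF has_derivative_compose[OF line this], of w]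
    show ?thesis
      unfolding has_field_derivative_def diff_def by (simp add: matrix_vector_mult_scaleR mult_commute_abs)
  qed
  have "\<exists>s>0. s < t \<and> diff 0 t = (\<Sum>m<2. diff m 0 / fact m * t ^ m) + diff 2 s / fact 2 * t ^ 2"
  proof (rule Maclaurin[OF t])
    show "\<forall>m s. m < 2 \<and> 0 \<le> s \<and> s \<le> t \<longrightarrow> DERIV (diff m) s :> diff (Suc m) s"
    proof (intro allI impI)
      fix m :: nat and s :: real assume "m < 2 \<and> 0 \<le> s \<and> s \<le> t"
      then have "m = 0 \<or> m = 1" "0 \<le> s" "s \<le> t" by auto
      then show "DERIV (diff m) s :> diff (Suc m) s"
        using d0[of s] d1[of s] by (auto simp: numeral_2_eq_2)
    qed
  qed auto
  then show ?thesis by (auto simp: diff_def numeral_2_eq_2 algebra_simps)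
qed

lemma C2_aroundE:
  fixes \<Phi> :: "real^'n \<Rightarrow> real^'m"
  assumes "C2_around \<Phi> x"
  obtains U where "open U" "x \<in> U" "continuous_on U \<Phi>"
    "\<And>y. y \<in> U \<Longrightarrow> \<Phi> differentiable (at y)"
    "continuous_on U (\<lambda>y. jacobian \<Phi> (at y))"
    "\<And>i y. y \<in> U \<Longrightarrow> gradient (\<lambda>z. \<Phi> z $ i) differentiable (at y)"
    "\<And>i. continuous_on U (hessian (\<lambda>z. \<Phi> z $ i))"
proof -
  obtain U where U: "open U" "x \<in> U"
    and 1: "\<And>y. y \<in> U \<Longrightarrow> \<Phi> differentiable (at y)"
    and 2: "\<And>i y. y \<in> U \<Longrightarrow> gradient (\<lambda>z. \<Phi> z $ i) differentiable (at y)"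
    and 3: "\<And>i. continuous_on U (hessian (\<lambda>z. \<Phi> z $ i))"
    using assms unfolding C2_around_def by blast
  have "continuous_on U \<Phi>"
    using 1 U(1) by (simp add: continuous_on_eq_continuous_at differentiable_imp_continuous_within)
  moreover have "continuous_on U (\<lambda>y. \<chi> i. gradient (\<lambda>z. \<Phi> z $ i) y)"
    using 2 U(1)
    by (intro continuous_on_vec_lambda)
      (simp add: continuous_on_eq_continuous_at differentiable_imp_continuous_within)
  then have "continuous_on U (\<lambda>y. jacobian \<Phi> (at y))"
    by (rule continuous_on_eq) (simp add: vec_eq_iff jacobian_row[OF 1])
  ultimately show thesis using that U 1 2 3 by blast
qed

text \<open>The base point \<open>X p\<close> moves, so an expansion at the fixed point
  \<open>x\<close> would not do. The intermediate points of the Lagrange form also tend to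
  \<open>x\<close>, and joint continuity of \<open>h\<close> at \<open>(x, w)\<close> gives the
  limit.\<close>

lemma second_order_expansion:
  fixes \<Phi> :: "real^'n \<Rightarrow> real^'m"
  assumes C2: "C2_around \<Phi> x"
    and T: "filterlim T (at_right (0::real)) F" and W: "(W \<longlongrightarrow> w) F" and X: "(X \<longlongrightarrow> x) F"
  shows "((\<lambda>p. (\<Phi> (X p + T p *\<^sub>R W p) - \<Phi> (X p) - T p *\<^sub>R (jacobian \<Phi> (at (X p)) *v W p)) /\<^sub>R (1/2 * (T p)\<^sup>2))
    \<longlongrightarrow> second_derivative \<Phi> x w) F"
proof (rule vec_tendstoI)
  fix i
  obtain U where U: "open U" "x \<in> U" and d1: "\<And>y. y \<in> U \<Longrightarrow> \<Phi> differentiable (at y)"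
    and d2: "\<And>y. y \<in> U \<Longrightarrow> gradient (\<lambda>z. \<Phi> z $ i) differentiable (at y)"
    and cont: "continuous_on U (hessian (\<lambda>z. \<Phi> z $ i))"
    using C2_aroundE[OF C2] by metis
  define f where "f = (\<lambda>z. \<Phi> z $ i)"
  define h where "h z = (hessian f (fst z) *v snd z) \<bullet> snd z" for z
  have hess: "(hessian f \<longlongrightarrow> hessian f x) (nhds x)"
    using cont U unfolding f_def
    by (simp add: continuous_on_eq_continuous_at isCont_def tendsto_at_iff_tendsto_nhds)
  have fs: "(fst \<longlongrightarrow> x) (nhds (x, w))" "(snd \<longlongrightarrow> w) (nhds (x, w))"
    using tendsto_fst[OF filterlim_ident, of "(x, w)"] tendsto_snd[OF filterlim_ident, of "(x, w)"] by auto
  from tendsto_inner[OF tendsto_matrix_vector_mult[OF filterlim_compose[OF hess fs(1)] fs(2)] fs(2)]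
  have h_lim: "(h \<longlongrightarrow> h (x, w)) (nhds (x, w))"
    by (simp add: h_def[abs_def])
  show "((\<lambda>p. ((\<Phi> (X p + T p *\<^sub>R W p) - \<Phi> (X p) - T p *\<^sub>R (jacobian \<Phi> (at (X p)) *v W p)) /\<^sub>R (1/2 * (T p)\<^sup>2)) $ i)
    \<longlongrightarrow> second_derivative \<Phi> x w $ i) F"
  proof (rule tendstoI)
    fix e :: real assume "0 < e"
    have "\<forall>\<^sub>F z in nhds (x, w). fst z \<in> U"
      unfolding nhds_prod using eventually_prodI[OF eventually_nhds_in_open[OF U], of "\<lambda>_. True"] by simp
    then have "\<forall>\<^sub>F z in nhds (x, w). fst z \<in> U \<and> dist (h z) (h (x, w)) < e"
      using tendstoD[OF h_lim \<open>0 < e\<close>] by (rule eventually_conj)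
    then obtain \<delta> where \<delta>: "0 < \<delta>"
      "\<And>z. dist z (x, w) < \<delta> \<Longrightarrow> fst z \<in> U \<and> dist (h z) (h (x, w)) < e"
      unfolding eventually_nhds_metric by blast
    have T0: "(T \<longlongrightarrow> 0) F" and Tpos: "\<forall>\<^sub>F p in F. 0 < T p"
      using T by (auto simp: filterlim_at elim: eventually_mono)
    \<comment> \<open>The radius \<open>\<delta>\<close> is shared out: a quarter for
      \<open>X p\<close>, a quarter for the step, a half for \<open>W p\<close>.\<close>
    have "((\<lambda>p. T p *\<^sub>R W p) \<longlongrightarrow> 0 *\<^sub>R w) F" by (intro tendsto_intros T0 W)
    then have "\<forall>\<^sub>F p in F. norm (T p *\<^sub>R W p) < \<delta> / 4"
      using tendstoD[of _ "0 *\<^sub>R w" F "\<delta> / 4"] \<delta>(1) by fastforce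
    moreover have "\<forall>\<^sub>F p in F. dist (X p) x < \<delta> / 4" "\<forall>\<^sub>F p in F. dist (W p) w < \<delta> / 2"
      using \<delta>(1) by (simp_all only: tendstoD[OF X] tendstoD[OF W] half_gt_zero zero_less_divide_iff zero_less_numeral simp_thms)
    ultimately show "\<forall>\<^sub>F p in F. dist (((\<Phi> (X p + T p *\<^sub>R W p) - \<Phi> (X p) -
        T p *\<^sub>R (jacobian \<Phi> (at (X p)) *v W p)) /\<^sub>R (1/2 * (T p)\<^sup>2)) $ i) (second_derivative \<Phi> x w $ i) < e"
      using Tpos
    proof eventually_elim
      case (elim p)
      have near: "dist (X p + s *\<^sub>R W p, W p) (x, w) < \<delta>" if "0 \<le> s" "s \<le> T p" for s
      proof -
        have "norm (s *\<^sub>R W p) \<le> norm (T p *\<^sub>R W p)" using that by (simp add: mult_right_mono)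
        moreover have "dist (X p + s *\<^sub>R W p, W p) (x, w) \<le> norm (X p + s *\<^sub>R W p - x) + norm (W p - w)"
          using norm_Pair_le[of "X p + s *\<^sub>R W p - x" "W p - w"] by (simp add: dist_norm)
        moreover have "norm (X p + s *\<^sub>R W p - x) \<le> norm (X p - x) + norm (s *\<^sub>R W p)"
          using norm_triangle_ineq[of "X p - x" "s *\<^sub>R W p"] by (simp add: algebra_simps)
        ultimately show ?thesis using elim by (simp add: dist_norm)
      qed
      have seg: "X p + s *\<^sub>R W p \<in> U" if "0 \<le> s" "s \<le> T p" for s using \<delta>(2)[OF near[OF that]] by simp
      have XU: "X p \<in> U" using seg[of 0] elim by simp
      obtain s where s: "0 < s" "s < T p"
        "f (X p + T p *\<^sub>R W p) - f (X p) - T p * (gradient f (X p) \<bullet> W p)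
          = (hessian f (X p + s *\<^sub>R W p) *v W p) \<bullet> W p * (1/2 * (T p)\<^sup>2)"
        using second_order_taylor[of "T p" "X p" "W p" U f] elim(4) seg d2
          component_has_derivative[OF d1] unfolding f_def by blast
      have "((\<Phi> (X p + T p *\<^sub>R W p) - \<Phi> (X p) - T p *\<^sub>R (jacobian \<Phi> (at (X p)) *v W p)) /\<^sub>R (1/2 * (T p)\<^sup>2)) $ i
          = (f (X p + T p *\<^sub>R W p) - f (X p) - T p * (gradient f (X p) \<bullet> W p)) /\<^sub>R (1/2 * (T p)\<^sup>2)"
        by (simp add: f_def matrix_vector_mul_component jacobian_row[OF d1[OF XU]])
      also have "\<dots> = h (X p + s *\<^sub>R W p, W p)"
        unfolding s(3) using elim(4) by (simp add: h_def)
      finally show ?case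
        using \<delta>(2)[OF near[of s]] s(1,2) by (simp add: second_derivative_def h_def f_def)
    qed
  qed
qed

lemma tendsto_jacobian:
  fixes \<Phi> :: "real^'n \<Rightarrow> real^'m"
  assumes "C2_around \<Phi> x" "(X \<longlongrightarrow> x) F"
  shows "((\<lambda>p. jacobian \<Phi> (at (X p))) \<longlongrightarrow> jacobian \<Phi> (at x)) F"
proof -
  obtain U where "open U" "x \<in> U" "continuous_on U (\<lambda>y. jacobian \<Phi> (at y))"
    using C2_aroundE[OF assms(1)] by metis
  then have "isCont (\<lambda>y. jacobian \<Phi> (at y)) x" by (simp add: continuous_on_eq_continuous_at)
  then show ?thesis using assms(2) by (rule isCont_tendsto_compose)
qed

text \<open>Strict differentiability, read off from the second-order expansion: the quotient is the
  Jacobian term plus \<open>T p / 2\<close> times a convergent quantity.\<close>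

lemma tendsto_difference_quotient:
  fixes \<Phi> :: "real^'n \<Rightarrow> real^'m"
  assumes C2: "C2_around \<Phi> x"
    and T: "filterlim T (at_right (0::real)) F" and W: "(W \<longlongrightarrow> w) F" and X: "(X \<longlongrightarrow> x) F"
  shows "((\<lambda>p. (\<Phi> (X p + T p *\<^sub>R W p) - \<Phi> (X p)) /\<^sub>R T p) \<longlongrightarrow> jacobian \<Phi> (at x) *v w) F"
proof -
  have T0: "(T \<longlongrightarrow> 0) F" and Tpos: "\<forall>\<^sub>F p in F. 0 < T p"
    using T by (auto simp: filterlim_at elim: eventually_mono)
  define Q where "Q p = (\<Phi> (X p + T p *\<^sub>R W p) - \<Phi> (X p) - T p *\<^sub>R (jacobian \<Phi> (at (X p)) *v W p)) /\<^sub>R (1/2 * (T p)\<^sup>2)" for p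
  have "(Q \<longlongrightarrow> second_derivative \<Phi> x w) F"
    unfolding Q_def by (rule second_order_expansion[OF assms])
  then have "((\<lambda>p. jacobian \<Phi> (at (X p)) *v W p + (T p / 2) *\<^sub>R Q p)
      \<longlongrightarrow> jacobian \<Phi> (at x) *v w + (0 / 2) *\<^sub>R second_derivative \<Phi> x w) F"
    by (intro tendsto_intros tendsto_jacobian[OF C2 X] W T0) auto
  then have "((\<lambda>p. jacobian \<Phi> (at (X p)) *v W p + (T p / 2) *\<^sub>R Q p) \<longlongrightarrow> jacobian \<Phi> (at x) *v w) F" by simp
  moreover have "\<forall>\<^sub>F p in F. jacobian \<Phi> (at (X p)) *v W p + (T p / 2) *\<^sub>R Q p
      = (\<Phi> (X p + T p *\<^sub>R W p) - \<Phi> (X p)) /\<^sub>R T p"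
    using Tpos by eventually_elim (simp add: Q_def power2_eq_square scaleR_diff_right inverse_eq_divide)
  ultimately show ?thesis by (simp cong: filterlim_cong)
qed

section \<open>Uniform injectivity near a point, and auxiliary limits\<close>

text \<open>On a finite-dimensional space injectivity amounts to a lower bound
  \<open>e * norm \<eta>\<close>, and a perturbation of operator norm at most \<open>e / 2\<close>
  leaves half of it.\<close>

lemma transpose_injective_nearby:
  fixes A :: "'a::topological_space \<Rightarrow> real^'n^'m"
  assumes "subspace L" "\<And>\<eta>. \<eta> \<in> L \<Longrightarrow> transpose a *v \<eta> = 0 \<Longrightarrow> \<eta> = 0" "(A \<longlongrightarrow> a) F"
  obtains c where "0 < c" "\<forall>\<^sub>F x in F. \<forall>\<eta>\<in>L. c * norm \<eta> \<le> norm (transpose (A x) *v \<eta>)"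
proof -
  obtain e where e: "0 < e" "\<forall>\<eta>\<in>L. e * norm \<eta> \<le> norm (transpose a *v \<eta>)"
    using injective_imp_isometric[of L "(*v) (transpose a)"] assms(1,2) closed_subspace
    by (auto simp: mult.commute)
  \<comment> \<open>The number of entries: entries of size at most \<open>e / (2 * N)\<close> give
    an operator norm of at most \<open>e / 2\<close>.\<close>
  define N where "N = real CARD('n) * real CARD('m)"
  have N: "0 < N" by (simp add: N_def)
  have "\<forall>\<^sub>F x in F. \<forall>i j. \<bar>A x $ i $ j - a $ i $ j\<bar> < e / (2 * N)"
    using N e(1) tendstoD[OF tendsto_vec_nth[OF tendsto_vec_nth[OF assms(3)]], of "e / (2 * N)"]
    by (auto intro!: eventually_all_finite simp: dist_real_def)
  then have "\<forall>\<^sub>F x in F. \<forall>\<eta>\<in>L. e / 2 * norm \<eta> \<le> norm (transpose (A x) *v \<eta>)"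
  proof eventually_elim
    case (elim x)
    let ?D = "transpose (A x) - transpose a"
    have "onorm ((*v) ?D) \<le> N * (e / (2 * N))"
      unfolding N_def
      by (rule onorm_le_matrix_component) (use elim in \<open>auto simp: transpose_def less_imp_le N_def\<close>)
    then have D: "onorm ((*v) ?D) \<le> e / 2" using N by simp
    show ?case
    proof
      fix \<eta> assume "\<eta> \<in> L"
      have "norm (?D *v \<eta>) \<le> onorm ((*v) ?D) * norm \<eta>"
        by (rule onorm) simp
      also have "\<dots> \<le> e / 2 * norm \<eta>" using D by (intro mult_right_mono) auto
      finally have "norm (?D *v \<eta>) \<le> e / 2 * norm \<eta>" .
      moreover have "norm (transpose a *v \<eta>) \<le> norm (transpose (A x) *v \<eta>) + norm (?D *v \<eta>)"
        using norm_triangle_ineq4[of "transpose (A x) *v \<eta>" "?D *v \<eta>"]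
        by (simp add: matrix_vector_mult_diff_rdistrib)
      ultimately show "e / 2 * norm \<eta> \<le> norm (transpose (A x) *v \<eta>)"
        using e(2) \<open>\<eta> \<in> L\<close> by fastforce
    qed
  qed
  then show thesis using that[of "e / 2"] e(1) by simp
qed

text \<open>Keeps \<open>transpose A *v l\<close> in the form used by \<open>multipliers\<close> and
  \<open>SOQC\<close>.\<close>

declare transpose_matrix_vector [simp del]

lemma tendsto_transpose:
  fixes A :: "'a \<Rightarrow> real^'n^'m"
  assumes "(A \<longlongrightarrow> a) F"
  shows "((\<lambda>x. transpose (A x)) \<longlongrightarrow> transpose a) F"
  unfolding transpose_def by (intro tendsto_vec_lambda tendsto_vec_nth assms)

lemma eventually_at_right_pos: "filterlim T (at_right (0::real)) F \<Longrightarrow> \<forall>\<^sub>F p in F. 0 < T p"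
  by (auto simp: filterlim_at elim: eventually_mono)

lemma filterlim_at_right_0_sequentially:
  fixes t :: "nat \<Rightarrow> real"
  assumes "t \<longlonglongrightarrow> 0" "\<And>k. 0 < t k"
  shows "filterlim t (at_right 0) sequentially"
  using assms(1) assms(2)[THEN less_imp_neq, THEN not_sym] assms(2) by (simp add: filterlim_at)

lemma second_order_quotient_ge:
  assumes "0 < t" "f x = ereal a" "ereal (a + t * (v \<bullet> w) + b) \<le> f (x + t *\<^sub>R w)"
  shows "ereal (b / (1/2 * t\<^sup>2)) \<le> second_order_quotient f t x v w"
proof (cases "f (x + t *\<^sub>R w)")
  case (real r)
  then show ?thesis
    using assms by (simp add: second_order_quotient_def divide_right_mono)
next
  case PInf
  then show ?thesis using assms by (simp add: second_order_quotient_def)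
qed (use assms in simp)

lemma Liminf_le_of_tendsto:
  fixes f :: "'a \<Rightarrow> ereal"
  assumes "filterlim s F G" "((\<lambda>k. f (s k)) \<longlongrightarrow> C) G" "G \<noteq> bot"
  shows "Liminf F f \<le> C"
proof (rule dense_le)
  fix y assume "y < Liminf F f"
  then have "\<forall>\<^sub>F p in F. y < f p" by (rule less_LiminfD)
  then have "\<forall>\<^sub>F k in G. y < f (s k)" using assms(1) by (rule eventually_compose_filterlim)
  then have "\<forall>\<^sub>F k in G. y \<le> f (s k)" by (rule eventually_mono) simp
  then show "y \<le> C" by (rule tendsto_lowerbound[OF assms(2) _ assms(3)])
qed

section \<open>The chain rule\<close>

text \<open>Packages what the qualification condition yields: a neighbourhood \<open>N\<close> and
  one constant \<open>c\<close> valid throughout it. Uniformity matters since multipliers at moving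
  points must stay bounded and converge. The identity mapping fits the same pattern.\<close>

locale composite_polyhedral = polyhedral_subgradient g "\<Phi> x0" l
  for g :: "real^'m \<Rightarrow> ereal" and \<Phi> :: "real^'n \<Rightarrow> real^'m" and x0 l +
  fixes \<phi> :: "real^'n \<Rightarrow> ereal" and N :: "(real^'n) set" and c :: real
  assumes open_N: "open N" and x0_N: "x0 \<in> N" and c_pos: "0 < c"
    and C2_N: "x \<in> N \<Longrightarrow> C2_around \<Phi> x"
    and rep_N: "x \<in> N \<Longrightarrow> \<phi> x = g (\<Phi> x)"
    and transversal: "x \<in> N \<Longrightarrow> \<eta> \<in> parallel_space \<Longrightarrow>
      c * norm \<eta> \<le> norm (transpose (jacobian \<Phi> (at x)) *v \<eta>)"
begin

abbreviation "J x \<equiv> jacobian \<Phi> (at x)"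

lemma has_derivative_N: "x \<in> N \<Longrightarrow> (\<Phi> has_derivative (\<lambda>h. J x *v h)) (at x)"
  using C2_N[of x] jacobian_works[of \<Phi> "at x"] by (auto simp: C2_around_def)

lemma continuous_on_N: "continuous_on N \<Phi>"
  using has_derivative_N has_derivative_continuous by (fastforce intro: continuous_at_imp_continuous_on)

lemma injective_N:
  assumes "x \<in> N" "\<eta> \<in> parallel_space" "\<And>h. \<eta> \<bullet> (J x *v h) = 0"
  shows "\<eta> = 0"
proof -
  have "(transpose (J x) *v \<eta>) \<bullet> (transpose (J x) *v \<eta>) = 0"
    using assms(3) by (subst inner_transpose)
  then have "transpose (J x) *v \<eta> = 0" by simp
  then have "c * norm \<eta> \<le> 0" using transversal[OF assms(1,2)] by simp
  then show ?thesis using c_pos by (simp add: mult_le_0_iff)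
qed

lemma parallel_projection_solvable:
  assumes "x \<in> N"
  obtains p where "\<And>\<eta>. \<eta> \<in> parallel_space \<Longrightarrow> \<eta> \<bullet> (J x *v p - y) = 0"
proof -
  obtain B where "\<And>v \<eta>. \<eta> \<in> parallel_space \<Longrightarrow> \<eta> \<bullet> (J x *v B v) = \<eta> \<bullet> v"
    using projected_right_inverse[OF matrix_vector_mul_linear subspace_parallel_space, of "J x"]
      injective_N[OF assms] by metis
  then show thesis using that[of "B y"] by (simp add: inner_diff_right)
qed

text \<open>The prescribed projection gives
  \<open>\<Phi> (x + t *\<^sub>R r) = \<Phi> x + t *\<^sub>R y + h\<close> with \<open>h\<close>
  orthogonal to \<open>L\<close>. Convexity keeps the point without \<open>h\<close> in the
  epigraph, and \<open>epi_translate\<close> absorbs \<open>h\<close> at the price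
  \<open>l \<bullet> h\<close>; no approximation error is left.\<close>

lemma epi_curve:
  "\<exists>\<delta>>0. \<forall>x \<alpha> y b w s e. x \<in> N \<longrightarrow> norm (\<Phi> x - \<Phi> x0) < \<delta> \<longrightarrow> \<bar>\<alpha> - val\<bar> < \<delta> \<longrightarrow> (\<Phi> x, \<alpha>) \<in> epi g \<longrightarrow>
     0 < s \<longrightarrow> (\<Phi> x + s *\<^sub>R y, \<alpha> + s * b) \<in> epi g \<longrightarrow>
     (\<forall>\<eta>\<in>parallel_space. \<eta> \<bullet> (J x *v w - y) = 0) \<longrightarrow> 0 < e \<longrightarrow>
     (\<forall>\<^sub>F t in at_right 0. \<exists>r. norm (r - w) \<le> e \<and> x + t *\<^sub>R r \<in> N \<and>
        (\<Phi> (x + t *\<^sub>R r), \<alpha> + t * b + l \<bullet> (\<Phi> (x + t *\<^sub>R r) - \<Phi> x - t *\<^sub>R y)) \<in> epi g)"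
proof -
  obtain \<delta> where \<delta>: "0 < \<delta>"
    and translate: "\<And>y \<alpha> h. (y, \<alpha>) \<in> epi g \<Longrightarrow> norm (y - \<Phi> x0) < \<delta> \<Longrightarrow> \<bar>\<alpha> - val\<bar> < \<delta> \<Longrightarrow> norm h < \<delta> \<Longrightarrow>
      (\<And>\<eta>. \<eta> \<in> parallel_space \<Longrightarrow> \<eta> \<bullet> h = 0) \<Longrightarrow> (y + h, \<alpha> + l \<bullet> h) \<in> epi g"
    using epi_translate by blast
  show ?thesis
  proof (rule exI[of _ \<delta>], intro conjI \<delta> allI impI)
    fix x \<alpha> y b w and s e :: real
    assume x: "x \<in> N" and near: "norm (\<Phi> x - \<Phi> x0) < \<delta>" "\<bar>\<alpha> - val\<bar> < \<delta>" and base: "(\<Phi> x, \<alpha>) \<in> epi g"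
      and s: "0 < s" "(\<Phi> x + s *\<^sub>R y, \<alpha> + s * b) \<in> epi g"
      and orth: "\<forall>\<eta>\<in>parallel_space. \<eta> \<bullet> (J x *v w - y) = 0" and e: "0 < e"
    have curve: "\<forall>\<^sub>F t in at_right 0. \<exists>r. norm (r - w) \<le> e \<and>
        (\<forall>\<eta>\<in>parallel_space. \<eta> \<bullet> (\<Phi> (x + t *\<^sub>R r) - \<Phi> x - t *\<^sub>R y) = 0)"
      by (rule curve_with_prescribed_projection[OF has_derivative_N[OF x] open_N x continuous_on_N
            subspace_parallel_space injective_N[OF x]]) (use orth e in auto)
    have "((\<lambda>t. norm (\<Phi> x + t *\<^sub>R y - \<Phi> x0)) \<longlongrightarrow> norm (\<Phi> x + 0 *\<^sub>R y - \<Phi> x0)) (at_right 0)"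
      by (intro tendsto_intros)
    then have ev1: "\<forall>\<^sub>F t in at_right 0. norm (\<Phi> x + t *\<^sub>R y - \<Phi> x0) < \<delta>"
      using near(1) by (intro order_tendstoD(2)) auto
    have "((\<lambda>t. \<bar>\<alpha> + t * b - val\<bar>) \<longlongrightarrow> \<bar>\<alpha> + 0 * b - val\<bar>) (at_right 0)"
      by (intro tendsto_intros)
    then have ev2: "\<forall>\<^sub>F t in at_right 0. \<bar>\<alpha> + t * b - val\<bar> < \<delta>"
      using near(2) by (intro order_tendstoD(2)) auto
    have "\<forall>\<^sub>F x' in nhds x. x' \<in> N \<and> dist (\<Phi> x') (\<Phi> x) < \<delta> / 2"
    proof (rule eventually_conj)
      show "\<forall>\<^sub>F x' in nhds x. x' \<in> N" using open_N x by (rule eventually_nhds_in_open)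
      have "isCont \<Phi> x" using continuous_on_N open_N x by (simp add: continuous_on_eq_continuous_at)
      then show "\<forall>\<^sub>F x' in nhds x. dist (\<Phi> x') (\<Phi> x) < \<delta> / 2"
        using \<delta> by (intro tendstoD) (auto simp: isCont_def tendsto_at_iff_tendsto_nhds)
    qed
    then obtain d where d: "0 < d" "\<And>x'. dist x' x < d \<Longrightarrow> x' \<in> N \<and> dist (\<Phi> x') (\<Phi> x) < \<delta> / 2"
      unfolding eventually_nhds_metric by blast
    have lims: "((\<lambda>t. t * (norm w + e)) \<longlongrightarrow> 0 * (norm w + e)) (at_right 0)" "((\<lambda>t. t * norm y) \<longlongrightarrow> 0 * norm y) (at_right 0)"
      by (intro tendsto_intros)+
    have ev3: "\<forall>\<^sub>F t in at_right 0. t * (norm w + e) < d" "\<forall>\<^sub>F t in at_right 0. t * norm y < \<delta> / 2"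
      using order_tendstoD(2)[OF lims(1), of d] order_tendstoD(2)[OF lims(2), of "\<delta> / 2"] d(1) \<delta> by simp_all
    have ev4: "\<forall>\<^sub>F t in at_right 0. t \<in> {0<..<s}" using s(1) by (rule eventually_at_right_real)
    show "\<forall>\<^sub>F t in at_right 0. \<exists>r. norm (r - w) \<le> e \<and> x + t *\<^sub>R r \<in> N \<and>
        (\<Phi> (x + t *\<^sub>R r), \<alpha> + t * b + l \<bullet> (\<Phi> (x + t *\<^sub>R r) - \<Phi> x - t *\<^sub>R y)) \<in> epi g"
      using curve ev1 ev2 ev3 ev4
    proof eventually_elim
      case (elim t)
      then obtain r where r: "norm (r - w) \<le> e"
        and orth_r: "\<And>\<eta>. \<eta> \<in> parallel_space \<Longrightarrow> \<eta> \<bullet> (\<Phi> (x + t *\<^sub>R r) - \<Phi> x - t *\<^sub>R y) = 0"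
        by blast
      have t: "0 < t" "t < s" using elim by auto
      have "norm r \<le> norm w + e" using r norm_triangle_sub[of r w] by linarith
      then have "norm (t *\<^sub>R r) \<le> t * (norm w + e)" using t by simp
      then have x': "x + t *\<^sub>R r \<in> N" "norm (\<Phi> (x + t *\<^sub>R r) - \<Phi> x) < \<delta> / 2"
        using d(2)[of "x + t *\<^sub>R r"] elim(4) by (auto simp: dist_norm)
      define h where "h = \<Phi> (x + t *\<^sub>R r) - \<Phi> x - t *\<^sub>R y"
      have h: "norm h < \<delta>"
        using norm_triangle_ineq4[of "\<Phi> (x + t *\<^sub>R r) - \<Phi> x" "t *\<^sub>R y"] x'(2) elim(5) t(1)
        by (simp add: h_def)
      have "(1 - t / s) *\<^sub>R (\<Phi> x, \<alpha>) + (t / s) *\<^sub>R (\<Phi> x + s *\<^sub>R y, \<alpha> + s * b) \<in> epi g"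
        using t by (intro convexD_alt[OF convex_epi base s(2)]) auto
      moreover have "(1 - t / s) *\<^sub>R (\<Phi> x, \<alpha>) + (t / s) *\<^sub>R (\<Phi> x + s *\<^sub>R y, \<alpha> + s * b)
          = (\<Phi> x + t *\<^sub>R y, \<alpha> + t * b)"
        using s(1) by (simp add: algebra_simps)
      ultimately have "(\<Phi> x + t *\<^sub>R y, \<alpha> + t * b) \<in> epi g" by simp
      from translate[OF this elim(2,3) h] orth_r
      have "(\<Phi> x + t *\<^sub>R y + h, \<alpha> + t * b + l \<bullet> h) \<in> epi g" by (simp add: h_def)
      then show ?case using r x'(1) by (intro exI[of _ r]) (simp add: h_def)
    qed
  qed
qed

text \<open>The vector is already a regular normal: along a sequence defining a tangent of
  \<open>epi \<phi>\<close>, the subgradient inequality of \<open>g\<close> passes to the limit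
  through the difference quotients of \<open>\<Phi>\<close>.\<close>

lemma subdifferential_composeI:
  assumes x: "x \<in> N" and \<mu>: "\<mu> \<in> subdifferential g (\<Phi> x)"
  shows "transpose (J x) *v \<mu> \<in> subdifferential \<phi> x"
proof -
  define r where "r = real_of_ereal (g (\<Phi> x))"
  have r: "\<phi> x = ereal r" using subgradient_value[OF \<mu>] rep_N[OF x] by (simp add: r_def)
  have "(transpose (J x) *v \<mu>, -1) \<in> regular_normal_cone (epi \<phi>) (x, r)"
    unfolding regular_normal_cone_def polar_cone_def
  proof (intro CollectI ballI)
    fix w assume "w \<in> tangent_cone (epi \<phi>) (x, r)"
    then obtain t u where tu: "\<And>k::nat. 0 < t k" "\<And>k. (x, r) + t k *\<^sub>R u k \<in> epi \<phi>"
      and lim: "t \<longlonglongrightarrow> 0" "u \<longlonglongrightarrow> w"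
      unfolding tangent_cone_iff by blast
    define a b where "a k = fst (u k)" and "b k = snd (u k)" for k
    have ab: "a \<longlonglongrightarrow> fst w" "b \<longlonglongrightarrow> snd w"
      unfolding a_def b_def using lim by (auto intro: tendsto_intros)
    have T: "filterlim t (at_right 0) sequentially" by (rule filterlim_at_right_0_sequentially[OF lim(1) tu(1)])
    have "(\<lambda>k. x + t k *\<^sub>R a k) \<longlonglongrightarrow> x + 0 *\<^sub>R fst w" using lim(1) ab(1) by (intro tendsto_intros)
    then have "\<forall>\<^sub>F k in sequentially. x + t k *\<^sub>R a k \<in> N" using open_N x by (intro topological_tendstoD) auto
    then have "\<forall>\<^sub>F k in sequentially. \<mu> \<bullet> ((\<Phi> (x + t k *\<^sub>R a k) - \<Phi> x) /\<^sub>R t k) \<le> b k"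
    proof eventually_elim
      case (elim k)
      have "(\<Phi> (x + t k *\<^sub>R a k), r + t k * b k) \<in> epi g"
        using tu(2)[of k] rep_N[OF elim] by (simp add: epi_def a_def b_def case_prod_unfold)
      then have "\<mu> \<bullet> (\<Phi> (x + t k *\<^sub>R a k) - \<Phi> x) \<le> b k * t k"
        using subgradient_ineq[OF \<mu>] by (fastforce simp: r_def mult.commute)
      then show ?case using tu(1)[of k] by (simp add: divide_simps)
    qed
    then have "\<mu> \<bullet> (J x *v fst w) \<le> snd w"
      using tendsto_difference_quotient[OF C2_N[OF x] T ab(1) tendsto_const] ab(2)
      by (intro tendsto_le[OF _ ab(2) tendsto_inner[OF tendsto_const]]) auto
    then show "(transpose (J x) *v \<mu>, -1) \<bullet> w \<le> 0" by (simp add: inner_prod_def inner_transpose)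
  qed
  moreover have "(x, r) \<in> epi \<phi>" by (simp add: epi_iff r)
  ultimately show ?thesis
    using regular_normal_cone_subset_normal_cone[of "(x, r)" "epi \<phi>"] by (auto simp: subdifferential_def r)
qed

text \<open>Strictly above the graph \<open>(0, -1)\<close> is a tangent direction, which would
  force \<open>\<beta> \<le> 0\<close>. Limiting normals are approached from arbitrary points of the
  epigraph, so this case has to be excluded.\<close>

lemma regular_normal_finite:
  assumes n: "(\<xi>, - \<beta>) \<in> regular_normal_cone (epi \<phi>) (x, \<alpha>)" and \<beta>: "0 < \<beta>" and q: "(x, \<alpha>) \<in> epi \<phi>"
  shows "\<phi> x = ereal \<alpha>"
proof (rule ccontr)
  assume "\<phi> x \<noteq> ereal \<alpha>"
  then have "\<phi> x < ereal \<alpha>" using q by (simp add: epi_iff)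
  then obtain a where a: "\<phi> x < ereal a" "a < \<alpha>"
    by (metis ereal_dense2 ereal_less(2) less_ereal.simps(1))
  have "((0, -1) :: (real^'n) \<times> real) \<in> tangent_cone (epi \<phi>) (x, \<alpha>)"
    unfolding tangent_cone_iff
  proof (intro exI conjI allI)
    show "0 < (\<alpha> - a) * inverse (real (Suc k))" for k using a(2) by simp
    show "(x, \<alpha>) + ((\<alpha> - a) * inverse (real (Suc k))) *\<^sub>R (0, -1) \<in> epi \<phi>" for k
    proof -
      have "(\<alpha> - a) * inverse (real (Suc k)) \<le> \<alpha> - a"
        using a(2) by (intro mult_left_le) (auto simp: inverse_le_1_iff)
      then have "ereal a \<le> ereal (\<alpha> - (\<alpha> - a) * inverse (real (Suc k)))" by simp
      with a(1) have "\<phi> x \<le> ereal (\<alpha> - (\<alpha> - a) * inverse (real (Suc k)))" by (meson less_imp_le order_trans)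
      then show ?thesis by (simp add: epi_iff)
    qed
    have "(\<lambda>k. (\<alpha> - a) * inverse (real (Suc k))) \<longlonglongrightarrow> (\<alpha> - a) * 0"
      by (intro tendsto_intros LIMSEQ_inverse_real_of_nat)
    then show "(\<lambda>k. (\<alpha> - a) * inverse (real (Suc k))) \<longlonglongrightarrow> 0" by simp
  qed simp
  then have "(\<xi>, - \<beta>) \<bullet> ((0, -1) :: (real^'n) \<times> real) \<le> 0"
    using n unfolding regular_normal_cone_def polar_cone_def by blast
  then show False using \<beta> by (simp add: inner_prod_def)
qed

text \<open>\<open>epi_curve\<close> produces enough tangents of \<open>epi \<phi>\<close>. Those
  over the base point itself show that \<open>\<xi>\<close> equals \<open>\<beta>\<close> times the
  transposed Jacobian of \<open>l\<close> up to the image of \<open>L\<close>; those towards the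
  other points of \<open>epi g\<close> then give the subgradient inequality for
  \<open>l + \<eta>\<close>.\<close>

lemma regular_normal_multiplier:
  "\<exists>\<delta>>0. \<forall>x \<alpha> \<xi> \<beta>. x \<in> N \<longrightarrow> norm (\<Phi> x - \<Phi> x0) < \<delta> \<longrightarrow> \<bar>\<alpha> - val\<bar> < \<delta> \<longrightarrow> (x, \<alpha>) \<in> epi \<phi> \<longrightarrow> 0 < \<beta> \<longrightarrow>
     (\<xi>, - \<beta>) \<in> regular_normal_cone (epi \<phi>) (x, \<alpha>) \<longrightarrow>
     \<phi> x = ereal \<alpha> \<and> (\<exists>\<eta>\<in>parallel_space. l + \<eta> \<in> subdifferential g (\<Phi> x) \<and> \<xi> = \<beta> *\<^sub>R (transpose (J x) *v (l + \<eta>)))"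
proof -
  obtain \<delta> where \<delta>: "0 < \<delta>"
    and curve: "\<And>x \<alpha> y b w s e. x \<in> N \<Longrightarrow> norm (\<Phi> x - \<Phi> x0) < \<delta> \<Longrightarrow> \<bar>\<alpha> - val\<bar> < \<delta> \<Longrightarrow> (\<Phi> x, \<alpha>) \<in> epi g \<Longrightarrow>
     0 < s \<Longrightarrow> (\<Phi> x + s *\<^sub>R y, \<alpha> + s * b) \<in> epi g \<Longrightarrow>
     (\<And>\<eta>. \<eta> \<in> parallel_space \<Longrightarrow> \<eta> \<bullet> (J x *v w - y) = 0) \<Longrightarrow> 0 < e \<Longrightarrow>
     (\<forall>\<^sub>F t in at_right 0. \<exists>r. norm (r - w) \<le> e \<and> x + t *\<^sub>R r \<in> N \<and>
        (\<Phi> (x + t *\<^sub>R r), \<alpha> + t * b + l \<bullet> (\<Phi> (x + t *\<^sub>R r) - \<Phi> x - t *\<^sub>R y)) \<in> epi g)"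
    using epi_curve by blast
  show ?thesis
  proof (rule exI[of _ \<delta>], intro conjI \<delta> allI impI)
    fix x \<alpha> \<xi> and \<beta> :: real
    assume x: "x \<in> N" and near: "norm (\<Phi> x - \<Phi> x0) < \<delta>" "\<bar>\<alpha> - val\<bar> < \<delta>" and q: "(x, \<alpha>) \<in> epi \<phi>"
      and \<beta>: "0 < \<beta>" and n: "(\<xi>, - \<beta>) \<in> regular_normal_cone (epi \<phi>) (x, \<alpha>)"
    show val_x: "\<phi> x = ereal \<alpha>" by (rule regular_normal_finite[OF n \<beta> q])
    have base: "(\<Phi> x, \<alpha>) \<in> epi g" using q rep_N[OF x] by (simp add: epi_iff)
    \<comment> \<open>A target \<open>(y', \<alpha>')\<close> and a direction \<open>w\<close>
      matching it along \<open>L\<close> yield a tangent vector. Its last component is the linear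
      increase towards the target plus the price \<open>l \<bullet> h\<close> per unit of
      \<open>t\<close>.\<close>
    have key: "\<xi> \<bullet> w \<le> \<beta> * (\<alpha>' - \<alpha> + l \<bullet> (J x *v w - (y' - \<Phi> x)))"
      if q': "(y', \<alpha>') \<in> epi g" and orth: "\<And>\<eta>. \<eta> \<in> parallel_space \<Longrightarrow> \<eta> \<bullet> (J x *v w - (y' - \<Phi> x)) = 0"
      for w y' \<alpha>'
    proof -
      define y where "y = y' - \<Phi> x"
      have "\<exists>t r. 0 < t \<and> t < inverse (real (Suc k)) \<and> norm (r - w) \<le> inverse (real (Suc k)) \<and> x + t *\<^sub>R r \<in> N \<and>
        (\<Phi> (x + t *\<^sub>R r), \<alpha> + t * (\<alpha>' - \<alpha>) + l \<bullet> (\<Phi> (x + t *\<^sub>R r) - \<Phi> x - t *\<^sub>R y)) \<in> epi g" for k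
      proof -
        have k: "0 < inverse (real (Suc k))" by simp
        have evA: "\<forall>\<^sub>F t in at_right 0. \<exists>r. norm (r - w) \<le> inverse (real (Suc k)) \<and> x + t *\<^sub>R r \<in> N \<and>
            (\<Phi> (x + t *\<^sub>R r), \<alpha> + t * (\<alpha>' - \<alpha>) + l \<bullet> (\<Phi> (x + t *\<^sub>R r) - \<Phi> x - t *\<^sub>R y)) \<in> epi g"
          by (rule curve[OF x near base, of 1]) (use q' orth k in \<open>auto simp: y_def\<close>)
        have evB: "\<forall>\<^sub>F t in at_right 0. t \<in> {0<..<inverse (real (Suc k))}" using k by (rule eventually_at_right_real)
        from eventually_happens'[OF trivial_limit_at_right_real eventually_conj[OF evA evB]]
        show ?thesis unfolding greaterThanLessThan_iff by blast
      qed
      then obtain T R where T: "\<And>k. 0 < T k" "\<And>k. T k < inverse (real (Suc k))"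
        and R: "\<And>k. norm (R k - w) \<le> inverse (real (Suc k))" "\<And>k. x + T k *\<^sub>R R k \<in> N"
        and epi: "\<And>k. (\<Phi> (x + T k *\<^sub>R R k), \<alpha> + T k * (\<alpha>' - \<alpha>) + l \<bullet> (\<Phi> (x + T k *\<^sub>R R k) - \<Phi> x - T k *\<^sub>R y)) \<in> epi g"
        by metis
      have T0: "T \<longlonglongrightarrow> 0"
        by (rule tendsto_sandwich[OF _ _ tendsto_const LIMSEQ_inverse_real_of_nat])
          (use T in \<open>auto simp: less_imp_le\<close>)
      have R0: "R \<longlonglongrightarrow> w"
        by (rule LIM_zero_cancel, rule Lim_null_comparison[OF _ LIMSEQ_inverse_real_of_nat]) (use R in auto)
      have Tf: "filterlim T (at_right 0) sequentially" by (rule filterlim_at_right_0_sequentially[OF T0 T(1)])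
      define b where "b k = \<alpha>' - \<alpha> + l \<bullet> ((\<Phi> (x + T k *\<^sub>R R k) - \<Phi> x) /\<^sub>R T k - y)" for k
      have "(w, \<alpha>' - \<alpha> + l \<bullet> (J x *v w - y)) \<in> tangent_cone (epi \<phi>) (x, \<alpha>)"
        unfolding tangent_cone_iff
      proof (intro exI[of _ T] exI[of _ "\<lambda>k. (R k, b k)"] conjI allI T T0 tendsto_Pair R0)
        show "b \<longlonglongrightarrow> \<alpha>' - \<alpha> + l \<bullet> (J x *v w - y)"
          unfolding b_def
          by (intro tendsto_intros tendsto_difference_quotient[OF C2_N[OF x] Tf R0 tendsto_const])
        show "(x, \<alpha>) + T k *\<^sub>R (R k, b k) \<in> epi \<phi>" for k
        proof -
          define A where "A = \<Phi> (x + T k *\<^sub>R R k) - \<Phi> x"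
          have "T k *\<^sub>R (A /\<^sub>R T k - y) = A - T k *\<^sub>R y"
            using T(1)[of k] by (simp add: scaleR_diff_right)
          then have "T k * (l \<bullet> (A /\<^sub>R T k - y)) = l \<bullet> (A - T k *\<^sub>R y)" by (metis inner_scaleR_right)
          then have "T k * b k = T k * (\<alpha>' - \<alpha>) + l \<bullet> (\<Phi> (x + T k *\<^sub>R R k) - \<Phi> x - T k *\<^sub>R y)"
            unfolding b_def distrib_left A_def by simp
          then show ?thesis using epi[of k] rep_N[OF R(2)] by (simp add: epi_iff add.assoc)
        qed
      qed
      then have "(\<xi>, - \<beta>) \<bullet> (w, \<alpha>' - \<alpha> + l \<bullet> (J x *v w - y)) \<le> 0"
        using n unfolding regular_normal_cone_def polar_cone_def by blast
      then show ?thesis by (simp add: inner_prod_def y_def)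
    qed
    define \<zeta> where "\<zeta> = \<xi> - \<beta> *\<^sub>R (transpose (J x) *v l)"
    have \<zeta>_le: "\<zeta> \<bullet> w \<le> 0" if "\<And>\<eta>. \<eta> \<in> parallel_space \<Longrightarrow> \<eta> \<bullet> (J x *v w) = 0" for w
      using key[OF base, of w] that by (simp add: \<zeta>_def inner_diff_left inner_transpose)
    let ?M = "(*v) (transpose (J x)) ` parallel_space"
    have M: "subspace ?M" by (rule linear_subspace_image[OF matrix_vector_mul_linear subspace_parallel_space])
    \<comment> \<open>The part \<open>b\<close> orthogonal to the image of \<open>L\<close> is
      itself an admissible direction, and testing with it gives
      \<open>b \<bullet> b \<le> 0\<close>.\<close>
    obtain a b where ab: "a \<in> span ?M" "\<And>v. v \<in> span ?M \<Longrightarrow> orthogonal b v" "\<zeta> = a + b"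
      using orthogonal_subspace_decomp_exists[of ?M \<zeta>] by metis
    have "\<eta> \<bullet> (J x *v b) = 0" if "\<eta> \<in> parallel_space" for \<eta>
      using ab(2)[OF span_base, of "transpose (J x) *v \<eta>"] that
      by (auto simp: orthogonal_def inner_commute[of b] inner_transpose)
    then have "\<zeta> \<bullet> b \<le> 0" by (rule \<zeta>_le)
    moreover have "\<zeta> \<bullet> b = b \<bullet> b"
      using ab(2)[OF ab(1)] by (simp add: ab(3) inner_add_left orthogonal_def inner_commute[of a])
    ultimately have "b = 0" by (metis inner_ge_zero inner_eq_zero_iff order_antisym)
    then have "\<zeta> \<in> ?M" using ab M by (metis add.right_neutral span_eq_iff)
    then obtain \<eta>' where \<eta>': "\<eta>' \<in> parallel_space" "\<zeta> = transpose (J x) *v \<eta>'" by blast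
    define \<eta> where "\<eta> = \<eta>' /\<^sub>R \<beta>"
    have \<eta>: "\<eta> \<in> parallel_space" using \<eta>'(1) subspace_parallel_space by (simp add: \<eta>_def subspace_scale)
    have \<xi>: "\<xi> = \<beta> *\<^sub>R (transpose (J x) *v (l + \<eta>))"
    proof -
      have "\<beta> *\<^sub>R (transpose (J x) *v \<eta>) = transpose (J x) *v \<eta>'"
        using \<beta> by (simp add: \<eta>_def matrix_vector_mult_scaleR)
      then show ?thesis using \<eta>'(2)
        by (simp add: \<zeta>_def matrix_vector_right_distrib scaleR_add_right algebra_simps)
    qed
    have "l + \<eta> \<in> subdifferential g (\<Phi> x)"
      unfolding subdifferential_polyhedral[OF polyhedral]
    proof (intro conjI allI impI)
      show "\<bar>g (\<Phi> x)\<bar> \<noteq> \<infinity>" using val_x rep_N[OF x] by simp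
      fix y' \<alpha>' assume q': "(y', \<alpha>') \<in> epi g"
      obtain w where w: "\<And>\<eta>. \<eta> \<in> parallel_space \<Longrightarrow> \<eta> \<bullet> (J x *v w - (y' - \<Phi> x)) = 0"
        using parallel_projection_solvable[OF x, of "y' - \<Phi> x"] by blast
      have "\<beta> * ((l + \<eta>) \<bullet> (J x *v w)) \<le> \<beta> * (\<alpha>' - \<alpha> + l \<bullet> (J x *v w - (y' - \<Phi> x)))"
        using key[OF q' w] by (simp add: \<xi> inner_transpose)
      then have "(l + \<eta>) \<bullet> (J x *v w) \<le> \<alpha>' - \<alpha> + l \<bullet> (J x *v w - (y' - \<Phi> x))" using \<beta> by simp
      moreover have "\<eta> \<bullet> (J x *v w) = \<eta> \<bullet> (y' - \<Phi> x)" using w[OF \<eta>] by (simp add: inner_diff_right)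
      moreover have "real_of_ereal (g (\<Phi> x)) = \<alpha>" using val_x rep_N[OF x] by simp
      ultimately show "real_of_ereal (g (\<Phi> x)) + (l + \<eta>) \<bullet> (y' - \<Phi> x) \<le> \<alpha>'"
        by (simp add: inner_add_left inner_diff_right)
    qed
    then show "\<exists>\<eta>\<in>parallel_space. l + \<eta> \<in> subdifferential g (\<Phi> x) \<and> \<xi> = \<beta> *\<^sub>R (transpose (J x) *v (l + \<eta>))"
      using \<eta> \<xi> by blast
  qed
qed

text \<open>Limits of the regular case. The bound \<open>c\<close> keeps the components
  \<open>\<eta> k\<close> bounded, a subsequence converges within the closed space \<open>L\<close>,
  and the subgradient inequality is preserved because the heights \<open>A\<close> converge as
  well.\<close>

lemma subdifferential_composeD:
  "\<exists>\<delta>>0. \<forall>x v. x \<in> N \<longrightarrow> norm (\<Phi> x - \<Phi> x0) < \<delta> \<longrightarrow> \<bar>real_of_ereal (\<phi> x) - val\<bar> < \<delta> \<longrightarrow>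
     v \<in> subdifferential \<phi> x \<longrightarrow>
     (\<exists>\<mu>\<in>subdifferential g (\<Phi> x). \<mu> - l \<in> parallel_space \<and> v = transpose (J x) *v \<mu>)"
proof -
  obtain \<delta> where \<delta>: "0 < \<delta>"
    and mult: "\<And>x \<alpha> \<xi> \<beta>. x \<in> N \<Longrightarrow> norm (\<Phi> x - \<Phi> x0) < \<delta> \<Longrightarrow> \<bar>\<alpha> - val\<bar> < \<delta> \<Longrightarrow> (x, \<alpha>) \<in> epi \<phi> \<Longrightarrow> 0 < \<beta> \<Longrightarrow>
     (\<xi>, - \<beta>) \<in> regular_normal_cone (epi \<phi>) (x, \<alpha>) \<Longrightarrow>
     \<phi> x = ereal \<alpha> \<and> (\<exists>\<eta>\<in>parallel_space. l + \<eta> \<in> subdifferential g (\<Phi> x) \<and> \<xi> = \<beta> *\<^sub>R (transpose (J x) *v (l + \<eta>)))"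
    using regular_normal_multiplier by blast
  show ?thesis
  proof (rule exI[of _ \<delta>], intro conjI \<delta> allI impI)
    fix x v
    assume x: "x \<in> N" and near: "norm (\<Phi> x - \<Phi> x0) < \<delta>" "\<bar>real_of_ereal (\<phi> x) - val\<bar> < \<delta>"
      and v: "v \<in> subdifferential \<phi> x"
    define r where "r = real_of_ereal (\<phi> x)"
    have r: "\<phi> x = ereal r" using v by (simp add: subdifferential_def r_def ereal_real)
    have "(v, -1) \<in> normal_cone (epi \<phi>) (x, r)" using v by (simp add: subdifferential_def r_def)
    then obtain xs vs where k: "\<And>k::nat. xs k \<in> epi \<phi>" "\<And>k. vs k \<in> regular_normal_cone (epi \<phi>) (xs k)"
      and lim: "xs \<longlonglongrightarrow> (x, r)" "vs \<longlonglongrightarrow> (v, -1)"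
      unfolding normal_cone_def by blast
    \<comment> \<open>The approximating normals need not have last component -1; with the sign
      changed, \<open>B\<close> tends to 1 and is eventually positive, as \<open>mult\<close>
      requires.\<close>
    define X A \<Xi> B where "X k = fst (xs k)" and "A k = snd (xs k)" and "\<Xi> k = fst (vs k)" and "B k = - snd (vs k)" for k
    have X: "X \<longlonglongrightarrow> x" and A: "A \<longlonglongrightarrow> r" and \<Xi>: "\<Xi> \<longlonglongrightarrow> v" and B: "B \<longlonglongrightarrow> 1"
      using tendsto_fst[OF lim(1)] tendsto_snd[OF lim(1)] tendsto_fst[OF lim(2)]
        tendsto_minus[OF tendsto_snd[OF lim(2)]]
      unfolding X_def A_def \<Xi>_def B_def by simp_all
    have "isCont \<Phi> x" using continuous_on_N open_N x by (simp add: continuous_on_eq_continuous_at)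
    then have \<Phi>X: "(\<lambda>k. \<Phi> (X k)) \<longlonglongrightarrow> \<Phi> x" using X by (rule isCont_tendsto_compose)
    have ev: "\<forall>\<^sub>F k in sequentially. X k \<in> N"
      using topological_tendstoD[OF X open_N x] .
    have "\<forall>\<^sub>F k in sequentially. norm (\<Phi> (X k) - \<Phi> x0) < \<delta>"
      by (rule order_tendstoD(2)[OF _ near(1)]) (intro tendsto_intros \<Phi>X)
    moreover have "\<forall>\<^sub>F k in sequentially. \<bar>A k - val\<bar> < \<delta>"
      by (rule order_tendstoD(2)[OF _ near(2)[folded r_def]]) (intro tendsto_intros A)
    moreover have "\<forall>\<^sub>F k in sequentially. 0 < B k"
      using order_tendstoD(1)[OF B] by simp
    ultimately have "\<forall>\<^sub>F k in sequentially. X k \<in> N \<and> 0 < B k \<and> \<phi> (X k) = ereal (A k) \<and>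
        (\<exists>\<eta>\<in>parallel_space. l + \<eta> \<in> subdifferential g (\<Phi> (X k)) \<and> \<Xi> k = B k *\<^sub>R (transpose (J (X k)) *v (l + \<eta>)))"
      using ev
    proof eventually_elim
      case (elim k)
      have "(X k, A k) \<in> epi \<phi>" "(\<Xi> k, - B k) \<in> regular_normal_cone (epi \<phi>) (X k, A k)"
        using k[of k] by (simp_all add: X_def A_def \<Xi>_def B_def)
      then show ?case using mult[of "X k" "A k" "B k" "\<Xi> k"] elim by blast
    qed
    then obtain K where K: "\<And>k. K \<le> k \<Longrightarrow> X k \<in> N \<and> 0 < B k \<and> \<phi> (X k) = ereal (A k) \<and>
        (\<exists>\<eta>\<in>parallel_space. l + \<eta> \<in> subdifferential g (\<Phi> (X k)) \<and> \<Xi> k = B k *\<^sub>R (transpose (J (X k)) *v (l + \<eta>)))"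
      unfolding eventually_sequentially by blast
    then have "\<exists>\<eta>. \<forall>k. \<eta> k \<in> parallel_space \<and> l + \<eta> k \<in> subdifferential g (\<Phi> (X (k + K))) \<and>
        \<Xi> (k + K) = B (k + K) *\<^sub>R (transpose (J (X (k + K))) *v (l + \<eta> k))"
      by (intro choice allI) (meson le_add2)
    then obtain \<eta> where \<eta>: "\<And>k. \<eta> k \<in> parallel_space"
      and sub: "\<And>k. l + \<eta> k \<in> subdifferential g (\<Phi> (X (k + K)))"
      and \<Xi>_eq: "\<And>k. \<Xi> (k + K) = B (k + K) *\<^sub>R (transpose (J (X (k + K))) *v (l + \<eta> k))"
      by blast
    have XN: "X (k + K) \<in> N" and Bpos: "0 < B (k + K)" and A_eq: "\<phi> (X (k + K)) = ereal (A (k + K))" for k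
      using K[of "k + K"] by auto
    have JX: "(\<lambda>k. transpose (J (X (k + K)))) \<longlonglongrightarrow> transpose (J x)"
      by (intro tendsto_transpose LIMSEQ_ignore_initial_segment[OF tendsto_jacobian[OF C2_N[OF x] X]])
    \<comment> \<open>Dividing out the scale and removing the contribution of \<open>l\<close>
      isolates the image of \<open>\<eta> k\<close>.\<close>
    define \<zeta> where "\<zeta> k = \<Xi> (k + K) /\<^sub>R B (k + K) - transpose (J (X (k + K))) *v l" for k
    have \<zeta>_eq: "\<zeta> k = transpose (J (X (k + K))) *v \<eta> k" for k
      using Bpos[of k] by (simp add: \<zeta>_def \<Xi>_eq matrix_vector_right_distrib)
    have \<zeta>_lim: "\<zeta> \<longlonglongrightarrow> v - transpose (J x) *v l"
    proof -
      have "\<zeta> \<longlonglongrightarrow> v /\<^sub>R 1 - transpose (J x) *v l"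
        unfolding \<zeta>_def
        by (intro tendsto_intros JX LIMSEQ_ignore_initial_segment[OF \<Xi>] LIMSEQ_ignore_initial_segment[OF B]) simp
      then show ?thesis by simp
    qed
    then have "bounded (range \<zeta>)" by (intro convergent_imp_bounded convergentI)
    then obtain C where "\<forall>u\<in>range \<zeta>. norm u \<le> C" unfolding bounded_iff by (elim exE)
    then have C: "norm (\<zeta> k) \<le> C" for k by blast
    have "norm (\<eta> k) \<le> C / c" for k
      using transversal[OF XN \<eta>, of k k] C[of k] c_pos by (simp add: \<zeta>_eq field_simps)
    then have "bounded (range \<eta>)" by (auto simp: bounded_iff)
    then obtain \<eta>0 s where s: "strict_mono s" "(\<eta> \<circ> s) \<longlonglongrightarrow> \<eta>0"
      using bounded_imp_convergent_subsequence by blast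
    have \<eta>0: "\<eta>0 \<in> parallel_space"
      by (rule closed_sequentially[OF closed_subspace[OF subspace_parallel_space] _ s(2)]) (simp add: \<eta>)
    have "(\<lambda>k. transpose (J (X (s k + K))) *v (\<eta> \<circ> s) k) \<longlonglongrightarrow> transpose (J x) *v \<eta>0"
      using LIMSEQ_subseq_LIMSEQ[OF JX s(1)] s(2) by (intro tendsto_matrix_vector_mult) (simp_all add: o_def)
    moreover have "(\<lambda>k. transpose (J (X (s k + K))) *v (\<eta> \<circ> s) k) \<longlonglongrightarrow> v - transpose (J x) *v l"
      using LIMSEQ_subseq_LIMSEQ[OF \<zeta>_lim s(1)] by (simp add: o_def \<zeta>_eq)
    ultimately have "v - transpose (J x) *v l = transpose (J x) *v \<eta>0"
      using LIMSEQ_unique by blast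
    then have v_eq: "v = transpose (J x) *v (l + \<eta>0)" by (simp add: matrix_vector_right_distrib algebra_simps)
    have "l + \<eta>0 \<in> subdifferential g (\<Phi> x)"
      unfolding subdifferential_polyhedral[OF polyhedral]
    proof (intro conjI allI impI)
      show "\<bar>g (\<Phi> x)\<bar> \<noteq> \<infinity>" using r rep_N[OF x] by simp
      fix y \<alpha> assume y: "(y, \<alpha>) \<in> epi g"
      have "A (s k + K) + (l + (\<eta> \<circ> s) k) \<bullet> (y - \<Phi> (X (s k + K))) \<le> \<alpha>" for k
        using subgradient_ineq[OF sub[of "s k"] y] A_eq[of "s k"] rep_N[OF XN] by simp
      moreover have "(\<lambda>k. A (s k + K) + (l + (\<eta> \<circ> s) k) \<bullet> (y - \<Phi> (X (s k + K)))) \<longlonglongrightarrow>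
          r + (l + \<eta>0) \<bullet> (y - \<Phi> x)"
        using LIMSEQ_subseq_LIMSEQ[OF LIMSEQ_ignore_initial_segment[OF A, of K] s(1)]
          LIMSEQ_subseq_LIMSEQ[OF LIMSEQ_ignore_initial_segment[OF \<Phi>X, of K] s(1)] s(2)
        unfolding o_def by (intro tendsto_intros)
      ultimately have "r + (l + \<eta>0) \<bullet> (y - \<Phi> x) \<le> \<alpha>" by (intro LIMSEQ_le_const2) auto
      then show "real_of_ereal (g (\<Phi> x)) + (l + \<eta>0) \<bullet> (y - \<Phi> x) \<le> \<alpha>" using r rep_N[OF x] by simp
    qed
    then show "\<exists>\<mu>\<in>subdifferential g (\<Phi> x). \<mu> - l \<in> parallel_space \<and> v = transpose (J x) *v \<mu>"
      using \<eta>0 v_eq by (intro bexI[of _ "l + \<eta>0"]) auto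
  qed
qed

text \<open>With slope \<open>l \<bullet> a\<close> along \<open>a\<close> and price
  \<open>l \<bullet> h\<close> for the correction, \<open>epi_curve\<close> bounds the value by the
  supporting plane at the new point; \<open>g_lower\<close> is the opposite bound.\<close>

lemma flat_curve:
  assumes a: "a \<in> critical_cone g (\<Phi> x0) l"
    and w: "\<And>\<eta>. \<eta> \<in> parallel_space \<Longrightarrow> \<eta> \<bullet> (J x0 *v w - a) = 0" and e: "0 < e"
  shows "\<forall>\<^sub>F t in at_right 0. \<exists>r. norm (r - w) \<le> e \<and> x0 + t *\<^sub>R r \<in> N \<and>
    g (\<Phi> (x0 + t *\<^sub>R r)) = ereal (val + l \<bullet> (\<Phi> (x0 + t *\<^sub>R r) - \<Phi> x0))"
proof -
  obtain s where s: "0 < s" "(\<Phi> x0 + s *\<^sub>R a, val + s * (l \<bullet> a)) \<in> epi g"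
    using critical_coneD[OF a] by blast
  have "\<forall>\<^sub>F t in at_right 0. \<exists>r. norm (r - w) \<le> e \<and> x0 + t *\<^sub>R r \<in> N \<and>
      (\<Phi> (x0 + t *\<^sub>R r), val + t * (l \<bullet> a) + l \<bullet> (\<Phi> (x0 + t *\<^sub>R r) - \<Phi> x0 - t *\<^sub>R a)) \<in> epi g"
  proof -
    obtain \<delta> where \<delta>: "0 < \<delta>"
      and curve: "\<And>x \<alpha> y b w s e. x \<in> N \<Longrightarrow> norm (\<Phi> x - \<Phi> x0) < \<delta> \<Longrightarrow> \<bar>\<alpha> - val\<bar> < \<delta> \<Longrightarrow> (\<Phi> x, \<alpha>) \<in> epi g \<Longrightarrow>
       0 < s \<Longrightarrow> (\<Phi> x + s *\<^sub>R y, \<alpha> + s * b) \<in> epi g \<Longrightarrow>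
       (\<And>\<eta>. \<eta> \<in> parallel_space \<Longrightarrow> \<eta> \<bullet> (J x *v w - y) = 0) \<Longrightarrow> 0 < e \<Longrightarrow>
       (\<forall>\<^sub>F t in at_right 0. \<exists>r. norm (r - w) \<le> e \<and> x + t *\<^sub>R r \<in> N \<and>
          (\<Phi> (x + t *\<^sub>R r), \<alpha> + t * b + l \<bullet> (\<Phi> (x + t *\<^sub>R r) - \<Phi> x - t *\<^sub>R y)) \<in> epi g)"
      using epi_curve by blast
    show ?thesis by (rule curve[OF x0_N _ _ base_in_epi s w e]) (use \<delta> in simp_all)
  qed
  then show ?thesis
  proof (rule eventually_mono)
    fix t assume "\<exists>r. norm (r - w) \<le> e \<and> x0 + t *\<^sub>R r \<in> N \<and>
      (\<Phi> (x0 + t *\<^sub>R r), val + t * (l \<bullet> a) + l \<bullet> (\<Phi> (x0 + t *\<^sub>R r) - \<Phi> x0 - t *\<^sub>R a)) \<in> epi g"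
    then obtain r where r: "norm (r - w) \<le> e" "x0 + t *\<^sub>R r \<in> N"
      and "(\<Phi> (x0 + t *\<^sub>R r), val + t * (l \<bullet> a) + l \<bullet> (\<Phi> (x0 + t *\<^sub>R r) - \<Phi> x0 - t *\<^sub>R a)) \<in> epi g"
      by blast
    then have le: "g (\<Phi> (x0 + t *\<^sub>R r)) \<le> ereal (val + l \<bullet> (\<Phi> (x0 + t *\<^sub>R r) - \<Phi> x0))"
      by (simp add: epi_iff inner_diff_right)
    then show "\<exists>r. norm (r - w) \<le> e \<and> x0 + t *\<^sub>R r \<in> N \<and>
        g (\<Phi> (x0 + t *\<^sub>R r)) = ereal (val + l \<bullet> (\<Phi> (x0 + t *\<^sub>R r) - \<Phi> x0))"
      using r antisym[OF le g_lower] by blast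
  qed
qed

text \<open>Where the supporting plane of \<open>l\<close> touches the graph, \<open>l\<close>
  remains a subgradient, so base points on the flat part have the constant multiplier
  \<open>l\<close>.\<close>

lemma subgradient_on_flat:
  assumes "g y = ereal (val + l \<bullet> (y - \<Phi> x0))"
  shows "l \<in> subdifferential g y"
  unfolding subdifferential_polyhedral[OF polyhedral]
  using assms epi_lower by (auto simp: inner_diff_right)

end

section \<open>The strict second subderivative\<close>

context
  fixes f :: "'a::euclidean_space \<Rightarrow> ereal" and x0 v0 w :: 'a and F :: "(real \<times> 'a \<times> 'a \<times> 'a) filter"
  defines "F \<equiv> at_right 0 \<times>\<^sub>F nhds w \<times>\<^sub>F gph_subdifferential_at f x0 v0"
begin

lemma strict_filter_t: "filterlim fst (at_right 0) F"
  unfolding F_def by (rule filterlim_fst)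

lemma strict_filter_w: "((\<lambda>p. fst (snd p)) \<longlongrightarrow> w) F"
  unfolding F_def by (rule filterlim_compose[OF filterlim_fst filterlim_snd])

lemma strict_filter_gph: "filterlim (\<lambda>p. snd (snd p)) (gph_subdifferential_at f x0 v0) F"
  unfolding F_def by (rule filterlim_compose[OF filterlim_snd filterlim_snd])

lemma strict_filter_xv: "((\<lambda>p. snd (snd p)) \<longlongrightarrow> (x0, v0)) F"
  using strict_filter_gph unfolding gph_subdifferential_at_def filterlim_inf by blast

lemma strict_filter_x: "((\<lambda>p. fst (snd (snd p))) \<longlongrightarrow> x0) F"
  using tendsto_fst[OF strict_filter_xv] by simp

lemma strict_filter_v: "((\<lambda>p. snd (snd (snd p))) \<longlongrightarrow> v0) F"
  using tendsto_snd[OF strict_filter_xv] by simp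

lemma strict_filter_subgradient: "\<forall>\<^sub>F p in F. snd (snd (snd p)) \<in> subdifferential f (fst (snd (snd p)))"
  using strict_filter_gph unfolding gph_subdifferential_at_def filterlim_inf filterlim_principal
  by (simp add: gph_def case_prod_unfold)

lemma strict_filter_value: "((\<lambda>p. f (fst (snd (snd p)))) \<longlongrightarrow> f x0) F"
  using strict_filter_gph unfolding gph_subdifferential_at_def filterlim_inf filterlim_filtercomap_iff
  by (simp add: o_def case_prod_unfold)

lemma strict_second_subderivative_geI:
  assumes "\<And>b. ereal b < C \<Longrightarrow>
    \<forall>\<^sub>F p in F. ereal b < second_order_quotient f (fst p) (fst (snd (snd p))) (snd (snd (snd p))) (fst (snd p))"
    and "C \<noteq> -\<infinity>"
  shows "C \<le> strict_second_subderivative f x0 v0 w"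
  unfolding strict_second_subderivative_def le_Liminf_iff F_def[symmetric] case_prod_unfold
proof (intro allI impI)
  fix y assume "y < C"
  then obtain b where "y \<le> ereal b" "ereal b < C"
    by (metis ereal_dense2 less_imp_le)
  then show "\<forall>\<^sub>F p in F. y < second_order_quotient f (fst p) (fst (snd (snd p))) (snd (snd (snd p))) (fst (snd p))"
    using assms(1) by (blast intro: eventually_mono le_less_trans)
qed

end

lemma strict_second_subderivative_leI:
  fixes T :: "nat \<Rightarrow> real"
  assumes T: "T \<longlonglongrightarrow> 0" "\<And>k. 0 < T k" and lim: "W \<longlonglongrightarrow> w" "X \<longlonglongrightarrow> x0" "V \<longlonglongrightarrow> v0"
    and V: "\<And>k. V k \<in> subdifferential f (X k)" and val: "(\<lambda>k. f (X k)) \<longlonglongrightarrow> f x0"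
    and quot: "(\<lambda>k. second_order_quotient f (T k) (X k) (V k) (W k)) \<longlonglongrightarrow> C"
  shows "strict_second_subderivative f x0 v0 w \<le> C"
  unfolding strict_second_subderivative_def
proof (rule Liminf_le_of_tendsto)
  show "filterlim (\<lambda>k. (T k, W k, X k, V k)) (at_right 0 \<times>\<^sub>F nhds w \<times>\<^sub>F gph_subdifferential_at f x0 v0) sequentially"
    unfolding gph_subdifferential_at_def
    by (intro filterlim_Pair filterlim_at_right_0_sequentially T lim filterlim_inf[THEN iffD2] conjI tendsto_Pair)
      (use V val in \<open>auto simp: filterlim_principal filterlim_filtercomap_iff gph_def o_def\<close>)
  show "(\<lambda>k. (\<lambda>(t, w', x, v). second_order_quotient f t x v w') (T k, W k, X k, V k)) \<longlonglongrightarrow> C"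
    using quot by simp
qed simp

context composite_polyhedral
begin

text \<open>Since \<open>m p - l\<close> lies in \<open>L\<close>, transversality bounds its norm by
  that of \<open>V p\<close> minus the transposed Jacobian of \<open>l\<close>, divided by
  \<open>c\<close>, and this tends to 0. Convergence of the values is what brings the chain rule
  within reach.\<close>

lemma strict_filter_multipliers:
  fixes w :: "real^'n" and F :: "(real \<times> (real^'n) \<times> (real^'n) \<times> (real^'n)) filter"
  defines "F \<equiv> at_right 0 \<times>\<^sub>F nhds w \<times>\<^sub>F gph_subdifferential_at \<phi> x0 (transpose (J x0) *v l)"
  shows "\<exists>m. (m \<longlongrightarrow> l) F \<and> (\<forall>\<^sub>F p in F. m p \<in> subdifferential g (\<Phi> (fst (snd (snd p))))
       \<and> snd (snd (snd p)) = transpose (J (fst (snd (snd p)))) *v m p)"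
proof -
  define X V where "X p = fst (snd (snd p))" and "V p = snd (snd (snd p))" for p :: "real \<times> (real^'n) \<times> (real^'n) \<times> (real^'n)"
  have X: "(X \<longlongrightarrow> x0) F" and V: "(V \<longlongrightarrow> transpose (J x0) *v l) F"
    and sub: "\<forall>\<^sub>F p in F. V p \<in> subdifferential \<phi> (X p)" and val_lim: "((\<lambda>p. \<phi> (X p)) \<longlongrightarrow> \<phi> x0) F"
    unfolding F_def X_def V_def
    by (rule strict_filter_x strict_filter_v strict_filter_subgradient strict_filter_value)+
  obtain \<delta> where \<delta>: "0 < \<delta>"
    and chain: "\<And>x v. x \<in> N \<Longrightarrow> norm (\<Phi> x - \<Phi> x0) < \<delta> \<Longrightarrow> \<bar>real_of_ereal (\<phi> x) - val\<bar> < \<delta> \<Longrightarrow>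
     v \<in> subdifferential \<phi> x \<Longrightarrow>
     \<exists>\<mu>\<in>subdifferential g (\<Phi> x). \<mu> - l \<in> parallel_space \<and> v = transpose (J x) *v \<mu>"
    using subdifferential_composeD by blast
  define m where "m p = (SOME \<mu>. \<mu> \<in> subdifferential g (\<Phi> (X p)) \<and> \<mu> - l \<in> parallel_space \<and> V p = transpose (J (X p)) *v \<mu>)" for p
  have XN: "\<forall>\<^sub>F p in F. X p \<in> N" using topological_tendstoD[OF X open_N x0_N] .
  have "isCont \<Phi> x0" using continuous_on_N open_N x0_N by (simp add: continuous_on_eq_continuous_at)
  then have "((\<lambda>p. \<Phi> (X p)) \<longlongrightarrow> \<Phi> x0) F" using X by (rule isCont_tendsto_compose)
  from tendstoD[OF this \<delta>] have ev1: "\<forall>\<^sub>F p in F. norm (\<Phi> (X p) - \<Phi> x0) < \<delta>" by (simp add: dist_norm)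
  have "\<phi> x0 = ereal val" using rep_N[OF x0_N] g_z by simp
  then have "((\<lambda>p. real_of_ereal (\<phi> (X p))) \<longlongrightarrow> val) F" using val_lim by (intro lim_real_of_ereal) simp
  from tendstoD[OF this \<delta>] have ev2: "\<forall>\<^sub>F p in F. \<bar>real_of_ereal (\<phi> (X p)) - val\<bar> < \<delta>" by (simp add: dist_real_def)
  have m: "\<forall>\<^sub>F p in F. m p \<in> subdifferential g (\<Phi> (X p)) \<and> m p - l \<in> parallel_space \<and> V p = transpose (J (X p)) *v m p"
    using XN ev1 ev2 sub
  proof eventually_elim
    case (elim p)
    have "\<exists>\<mu>. \<mu> \<in> subdifferential g (\<Phi> (X p)) \<and> \<mu> - l \<in> parallel_space \<and> V p = transpose (J (X p)) *v \<mu>"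
      using chain[OF elim] by blast
    then show ?case unfolding m_def by (rule someI_ex)
  qed
  have "((\<lambda>p. norm (V p - transpose (J (X p)) *v l) / c) \<longlongrightarrow>
      norm (transpose (J x0) *v l - transpose (J x0) *v l) / c) F"
    using c_pos by (intro tendsto_intros V tendsto_transpose tendsto_jacobian[OF C2_N[OF x0_N] X]) simp
  then have null: "((\<lambda>p. norm (V p - transpose (J (X p)) *v l) / c) \<longlongrightarrow> 0) F" by simp
  have "\<forall>\<^sub>F p in F. norm (m p - l) \<le> norm (V p - transpose (J (X p)) *v l) / c"
    using m XN
  proof eventually_elim
    case (elim p)
    then have "c * norm (m p - l) \<le> norm (V p - transpose (J (X p)) *v l)"
      using transversal[of "X p" "m p - l"] by (simp add: matrix_vector_mult_diff_distrib)
    then show ?case using c_pos by (simp add: field_simps)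
  qed
  then have "((\<lambda>p. m p - l) \<longlongrightarrow> 0) F" using null by (rule Lim_null_comparison)
  then have "(m \<longlongrightarrow> l) F" by (rule LIM_zero_cancel)
  moreover have "\<forall>\<^sub>F p in F. m p \<in> subdifferential g (\<Phi> (X p)) \<and> V p = transpose (J (X p)) *v m p"
    using m by (rule eventually_mono) blast
  ultimately show ?thesis unfolding X_def V_def by blast
qed

text \<open>With \<open>v = \<nabla>\<Phi>(x)\<^sup>T \<mu>\<close> the quotient of \<open>\<phi>\<close> splits into the quotient of \<open>g\<close> at
  \<open>(\<Phi> x, \<mu>)\<close>, bounded below by \<open>b\<close> over \<open>1/2 t\<^sup>2\<close>, and the curvature term of \<open>\<langle>\<mu>, \<Phi>\<rangle>\<close>.\<close>

lemma second_order_quotient_split: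
  assumes x: "x \<in> N" "x + t *\<^sub>R w' \<in> N" and t: "0 < t" and \<mu>: "\<mu> \<in> subdifferential g (\<Phi> x)"
    and b: "ereal (real_of_ereal (g (\<Phi> x)) + \<mu> \<bullet> (\<Phi> (x + t *\<^sub>R w') - \<Phi> x) + b) \<le> g (\<Phi> (x + t *\<^sub>R w'))"
  shows "ereal (\<mu> \<bullet> ((\<Phi> (x + t *\<^sub>R w') - \<Phi> x - t *\<^sub>R (J x *v w')) /\<^sub>R (1/2 * t\<^sup>2)) + b / (1/2 * t\<^sup>2))
    \<le> second_order_quotient \<phi> t x (transpose (J x) *v \<mu>) w'"
proof -
  define \<tau> where "\<tau> = 1/2 * t\<^sup>2"
  define d where "d = \<Phi> (x + t *\<^sub>R w') - \<Phi> x - t *\<^sub>R (J x *v w')"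
  have "ereal ((\<mu> \<bullet> d + b) / (1/2 * t\<^sup>2)) \<le> second_order_quotient \<phi> t x (transpose (J x) *v \<mu>) w'"
  proof (rule second_order_quotient_ge[OF t])
    show "\<phi> x = ereal (real_of_ereal (g (\<Phi> x)))" using subgradient_value[OF \<mu>] rep_N[OF x(1)] by simp
    have "real_of_ereal (g (\<Phi> x)) + t * ((transpose (J x) *v \<mu>) \<bullet> w') + (\<mu> \<bullet> d + b)
        = real_of_ereal (g (\<Phi> x)) + \<mu> \<bullet> (\<Phi> (x + t *\<^sub>R w') - \<Phi> x) + b"
      by (simp add: d_def inner_transpose inner_diff_right)
    with b show "ereal (real_of_ereal (g (\<Phi> x)) + t * ((transpose (J x) *v \<mu>) \<bullet> w') + (\<mu> \<bullet> d + b)) \<le> \<phi> (x + t *\<^sub>R w')"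
      unfolding rep_N[OF x(2)] by (simp only:)
  qed
  then show ?thesis
    unfolding d_def[symmetric] \<tau>_def[symmetric]
    by (simp add: divide_inverse mult.commute distrib_left)
qed

lemma strict_second_subderivative_ge:
  "ereal (l \<bullet> second_derivative \<Phi> x0 w) + indicator_fun (span (critical_cone g (\<Phi> x0) l)) (J x0 *v w)
    \<le> strict_second_subderivative \<phi> x0 (transpose (J x0) *v l) w"
proof (rule strict_second_subderivative_geI)
  let ?F = "at_right 0 \<times>\<^sub>F nhds w \<times>\<^sub>F gph_subdifferential_at \<phi> x0 (transpose (J x0) *v l)"
  define T W X V where "T p = fst p" and "W p = fst (snd p)" and "X p = fst (snd (snd p))" and "V p = snd (snd (snd p))"
    for p :: "real \<times> (real^'n) \<times> (real^'n) \<times> (real^'n)"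
  have T: "filterlim T (at_right 0) ?F" and W: "(W \<longlongrightarrow> w) ?F" and X: "(X \<longlongrightarrow> x0) ?F"
    and val_lim: "((\<lambda>p. \<phi> (X p)) \<longlongrightarrow> \<phi> x0) ?F"
    unfolding T_def[abs_def] W_def X_def
    by (rule strict_filter_t strict_filter_w strict_filter_x strict_filter_value)+
  obtain m where m_lim: "(m \<longlongrightarrow> l) ?F"
    and m: "\<forall>\<^sub>F p in ?F. m p \<in> subdifferential g (\<Phi> (X p)) \<and> V p = transpose (J (X p)) *v m p"
    using strict_filter_multipliers[of w] unfolding X_def V_def by blast
  have T0: "(T \<longlongrightarrow> 0) ?F" and Tpos: "\<forall>\<^sub>F p in ?F. 0 < T p"
    using T eventually_at_right_pos[OF T] by (auto simp: filterlim_at)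
  have XN: "\<forall>\<^sub>F p in ?F. X p \<in> N" using topological_tendstoD[OF X open_N x0_N] .
  have "((\<lambda>p. X p + T p *\<^sub>R W p) \<longlongrightarrow> x0 + 0 *\<^sub>R w) ?F" by (intro tendsto_intros X T0 W)
  then have XN': "\<forall>\<^sub>F p in ?F. X p + T p *\<^sub>R W p \<in> N" using topological_tendstoD[OF _ open_N] x0_N by fastforce
  define Q where "Q p = m p \<bullet> ((\<Phi> (X p + T p *\<^sub>R W p) - \<Phi> (X p) - T p *\<^sub>R (J (X p) *v W p)) /\<^sub>R (1/2 * (T p)\<^sup>2))" for p
  have Q: "(Q \<longlongrightarrow> l \<bullet> second_derivative \<Phi> x0 w) ?F"
    unfolding Q_def by (intro tendsto_inner m_lim second_order_expansion[OF C2_N[OF x0_N] T W X])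
  fix b assume b: "ereal b < ereal (l \<bullet> second_derivative \<Phi> x0 w) + indicator_fun (span (critical_cone g (\<Phi> x0) l)) (J x0 *v w)"
  have "\<forall>\<^sub>F p in ?F. ereal b < second_order_quotient \<phi> (T p) (X p) (V p) (W p)"
  proof (cases "J x0 *v w \<in> span (critical_cone g (\<Phi> x0) l)")
    case True
    then have "\<forall>\<^sub>F p in ?F. b < Q p" using b order_tendstoD(1)[OF Q] by (simp add: indicator_fun_def)
    then show ?thesis using m Tpos XN XN'
    proof eventually_elim
      case (elim p)
      have sub: "m p \<in> subdifferential g (\<Phi> (X p))" and V: "V p = transpose (J (X p)) *v m p" using elim by auto
      have "ereal (real_of_ereal (g (\<Phi> (X p))) + m p \<bullet> (\<Phi> (X p + T p *\<^sub>R W p) - \<Phi> (X p)) + 0)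
          \<le> g (\<Phi> (X p + T p *\<^sub>R W p))"
        using subgradient_global[OF sub] by simp
      from second_order_quotient_split[OF elim(4,5,3) sub this]
      have "ereal (Q p) \<le> second_order_quotient \<phi> (T p) (X p) (V p) (W p)"
        by (simp add: V Q_def)
      then show ?case using elim(1) by (meson less_ereal.simps(1) less_le_trans)
    qed
  next
    case False
    obtain \<rho> \<delta> where \<rho>: "0 < \<rho>" and \<delta>: "0 < \<delta>"
      and growth: "\<And>t u' y \<mu>. 0 < t \<Longrightarrow> t < \<delta> \<Longrightarrow> norm (u' - J x0 *v w) < \<delta> \<Longrightarrow> norm (y - \<Phi> x0) < \<delta> \<Longrightarrow>
        \<bar>real_of_ereal (g y) - val\<bar> < \<delta> \<Longrightarrow> norm (\<mu> - l) < \<delta> \<Longrightarrow> \<mu> \<in> subdifferential g y \<Longrightarrow>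
        ereal (real_of_ereal (g y) + t * (\<mu> \<bullet> u') + \<rho> * t) \<le> g (y + t *\<^sub>R u')"
      using growth_off_span[OF False] by blast
    \<comment> \<open>With the exact difference quotient as direction,
      \<open>\<Phi> (X p) + T p *\<^sub>R u p\<close> is the new image point itself, so the growth
      estimate applies without an error term.\<close>
    define u where "u p = (\<Phi> (X p + T p *\<^sub>R W p) - \<Phi> (X p)) /\<^sub>R T p" for p
    have "(u \<longlongrightarrow> J x0 *v w) ?F"
      unfolding u_def by (rule tendsto_difference_quotient[OF C2_N[OF x0_N] T W X])
    from tendstoD[OF this \<delta>] have ev_u: "\<forall>\<^sub>F p in ?F. norm (u p - J x0 *v w) < \<delta>" by (simp add: dist_norm)
    have "isCont \<Phi> x0" using continuous_on_N open_N x0_N by (simp add: continuous_on_eq_continuous_at)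
    then have "((\<lambda>p. \<Phi> (X p)) \<longlongrightarrow> \<Phi> x0) ?F" using X by (rule isCont_tendsto_compose)
    from tendstoD[OF this \<delta>] have ev_y: "\<forall>\<^sub>F p in ?F. norm (\<Phi> (X p) - \<Phi> x0) < \<delta>" by (simp add: dist_norm)
    have "\<phi> x0 = ereal val" using rep_N[OF x0_N] g_z by simp
    then have "((\<lambda>p. real_of_ereal (\<phi> (X p))) \<longlongrightarrow> val) ?F" using val_lim by (intro lim_real_of_ereal) simp
    from tendstoD[OF this \<delta>] have ev_val: "\<forall>\<^sub>F p in ?F. \<bar>real_of_ereal (\<phi> (X p)) - val\<bar> < \<delta>" by (simp add: dist_real_def)
    have ev_m: "\<forall>\<^sub>F p in ?F. norm (m p - l) < \<delta>" using tendstoD[OF m_lim \<delta>] by (simp add: dist_norm)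
    define \<kappa> where "\<kappa> = l \<bullet> second_derivative \<Phi> x0 w - 1"
    have ev_Q: "\<forall>\<^sub>F p in ?F. \<kappa> < Q p" using order_tendstoD(1)[OF Q] by (simp add: \<kappa>_def)
    \<comment> \<open>For such \<open>T p\<close> the growth contributes
      \<open>2 * \<rho> / T p > \<bar>b - \<kappa>\<bar> + 1\<close>, enough to lift the bound
      \<open>\<kappa>\<close> on \<open>Q p\<close> above \<open>b\<close>.\<close>
    have ev_T: "\<forall>\<^sub>F p in ?F. T p < min \<delta> (2 * \<rho> / (\<bar>b - \<kappa>\<bar> + 1))"
      using \<rho> \<delta> by (intro order_tendstoD(2)[OF T0]) (simp add: add_nonneg_pos)
    show ?thesis using m Tpos XN XN' ev_u ev_y ev_val ev_m ev_Q ev_T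
    proof eventually_elim
      case (elim p)
      have sub: "m p \<in> subdifferential g (\<Phi> (X p))" and V: "V p = transpose (J (X p)) *v m p" using elim by auto
      have tu: "T p *\<^sub>R u p = \<Phi> (X p + T p *\<^sub>R W p) - \<Phi> (X p)" using elim(2) by (simp add: u_def)
      have "ereal (real_of_ereal (g (\<Phi> (X p))) + T p * (m p \<bullet> u p) + \<rho> * T p) \<le> g (\<Phi> (X p) + T p *\<^sub>R u p)"
        using elim rep_N[OF elim(3)] sub by (intro growth) auto
      moreover have "T p * (m p \<bullet> u p) = m p \<bullet> (\<Phi> (X p + T p *\<^sub>R W p) - \<Phi> (X p))" by (simp flip: tu)
      ultimately have "ereal (real_of_ereal (g (\<Phi> (X p))) + m p \<bullet> (\<Phi> (X p + T p *\<^sub>R W p) - \<Phi> (X p)) + \<rho> * T p)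
          \<le> g (\<Phi> (X p + T p *\<^sub>R W p))"
        by (simp add: tu)
      from second_order_quotient_split[OF elim(3,4,2) sub this]
      have "ereal (Q p + \<rho> * T p / (1/2 * (T p)\<^sup>2)) \<le> second_order_quotient \<phi> (T p) (X p) (V p) (W p)"
        by (simp add: V Q_def)
      moreover have "b < Q p + \<rho> * T p / (1/2 * (T p)\<^sup>2)"
      proof -
        have "T p * (\<bar>b - \<kappa>\<bar> + 1) < 2 * \<rho>" using elim(10) by (simp add: pos_less_divide_eq add_nonneg_pos)
        then have "\<bar>b - \<kappa>\<bar> + 1 < 2 * \<rho> / T p" using elim(2) by (simp add: pos_less_divide_eq mult.commute)
        moreover have "\<rho> * T p / (1/2 * (T p)\<^sup>2) = 2 * \<rho> / T p" using elim(2) by (simp add: power2_eq_square)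
        ultimately show ?thesis using elim(9) by linarith
      qed
      ultimately show ?case by (meson less_ereal.simps(1) less_le_trans)
    qed
  qed
  then show "\<forall>\<^sub>F p in ?F. ereal b < second_order_quotient \<phi> (fst p) (fst (snd (snd p))) (snd (snd (snd p))) (fst (snd p))"
    by (simp add: T_def W_def X_def V_def)
qed (simp add: indicator_fun_def)

lemma strict_second_subderivative_le:
  assumes "J x0 *v w \<in> span (critical_cone g (\<Phi> x0) l)"
  shows "strict_second_subderivative \<phi> x0 (transpose (J x0) *v l) w \<le> ereal (l \<bullet> second_derivative \<Phi> x0 w)"
proof -
  obtain a b where a: "a \<in> critical_cone g (\<Phi> x0) l" and b: "b \<in> critical_cone g (\<Phi> x0) l"
    and ab: "J x0 *v w = a - b"
    using span_critical_cone[OF assms] by blast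
  \<comment> \<open>The start direction matches \<open>b\<close> along \<open>L\<close>; adding
    \<open>w\<close> then matches \<open>a\<close>, because the Jacobian sends \<open>w\<close> to
    \<open>a - b\<close>.\<close>
  obtain p where p: "\<And>\<eta>. \<eta> \<in> parallel_space \<Longrightarrow> \<eta> \<bullet> (J x0 *v p - b) = 0"
    using parallel_projection_solvable[OF x0_N] by blast
  have q: "\<eta> \<bullet> (J x0 *v (p + w) - a) = 0" if "\<eta> \<in> parallel_space" for \<eta>
    using p[OF that] by (simp add: matrix_vector_right_distrib ab algebra_simps inner_add_right inner_diff_right)
  \<comment> \<open>Both curves exist for all small \<open>t\<close>, so one \<open>t\<close> can
    serve the start and the end point.\<close>
  have "\<exists>t r s. 0 < t \<and> t < inverse (real (Suc k))
      \<and> norm (r - p) \<le> inverse (real (Suc k)) \<and> x0 + t *\<^sub>R r \<in> N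
      \<and> g (\<Phi> (x0 + t *\<^sub>R r)) = ereal (val + l \<bullet> (\<Phi> (x0 + t *\<^sub>R r) - \<Phi> x0))
      \<and> norm (s - (p + w)) \<le> inverse (real (Suc k)) \<and> x0 + t *\<^sub>R s \<in> N
      \<and> g (\<Phi> (x0 + t *\<^sub>R s)) = ereal (val + l \<bullet> (\<Phi> (x0 + t *\<^sub>R s) - \<Phi> x0))" for k
  proof -
    have k: "0 < inverse (real (Suc k))" by simp
    from eventually_happens'[OF trivial_limit_at_right_real eventually_conj[OF eventually_conj[OF flat_curve[OF b p k]
            flat_curve[OF a q k]] eventually_at_right_real[OF k]]]
    show ?thesis unfolding greaterThanLessThan_iff by blast
  qed
  then obtain T R S where T: "\<And>k. 0 < T k" "\<And>k. T k < inverse (real (Suc k))"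
    and R: "\<And>k. norm (R k - p) \<le> inverse (real (Suc k))" "\<And>k. x0 + T k *\<^sub>R R k \<in> N"
      "\<And>k. g (\<Phi> (x0 + T k *\<^sub>R R k)) = ereal (val + l \<bullet> (\<Phi> (x0 + T k *\<^sub>R R k) - \<Phi> x0))"
    and S: "\<And>k. norm (S k - (p + w)) \<le> inverse (real (Suc k))" "\<And>k. x0 + T k *\<^sub>R S k \<in> N"
      "\<And>k. g (\<Phi> (x0 + T k *\<^sub>R S k)) = ereal (val + l \<bullet> (\<Phi> (x0 + T k *\<^sub>R S k) - \<Phi> x0))"
    by metis
  have T0: "T \<longlonglongrightarrow> 0"
    by (rule tendsto_sandwich[OF _ _ tendsto_const LIMSEQ_inverse_real_of_nat])
      (use T in \<open>auto simp: less_imp_le\<close>)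
  have R0: "R \<longlonglongrightarrow> p"
    by (rule LIM_zero_cancel, rule Lim_null_comparison[OF _ LIMSEQ_inverse_real_of_nat]) (use R in auto)
  have S0: "S \<longlonglongrightarrow> p + w"
    by (rule LIM_zero_cancel, rule Lim_null_comparison[OF _ LIMSEQ_inverse_real_of_nat]) (use S in auto)
  have Tf: "filterlim T (at_right 0) sequentially" by (rule filterlim_at_right_0_sequentially[OF T0 T(1)])
  define X W where "X k = x0 + T k *\<^sub>R R k" and "W k = S k - R k" for k
  have XW: "X k + T k *\<^sub>R W k = x0 + T k *\<^sub>R S k" for k by (simp add: X_def W_def scaleR_diff_right)
  have XN: "X k \<in> N" and gX: "g (\<Phi> (X k)) = ereal (val + l \<bullet> (\<Phi> (X k) - \<Phi> x0))" for k
    using R by (simp_all add: X_def)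
  have "X \<longlonglongrightarrow> x0 + 0 *\<^sub>R p" unfolding X_def by (intro tendsto_intros T0 R0)
  then have X: "X \<longlonglongrightarrow> x0" by simp
  have "W \<longlonglongrightarrow> p + w - p" unfolding W_def by (intro tendsto_intros S0 R0)
  then have W: "W \<longlonglongrightarrow> w" by simp
  show ?thesis
  proof (rule strict_second_subderivative_leI[OF T0 T(1) W X])
    show "(\<lambda>k. transpose (J (X k)) *v l) \<longlonglongrightarrow> transpose (J x0) *v l"
      by (intro tendsto_intros tendsto_transpose tendsto_jacobian[OF C2_N[OF x0_N] X])
    show "transpose (J (X k)) *v l \<in> subdifferential \<phi> (X k)" for k
      by (rule subdifferential_composeI[OF XN subgradient_on_flat[OF gX]])
    have "isCont \<Phi> x0" using continuous_on_N open_N x0_N by (simp add: continuous_on_eq_continuous_at)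
    then have \<Phi>X: "(\<lambda>k. \<Phi> (X k)) \<longlonglongrightarrow> \<Phi> x0" using X by (rule isCont_tendsto_compose)
    have "(\<lambda>k. val + l \<bullet> (\<Phi> (X k) - \<Phi> x0)) \<longlonglongrightarrow> val + l \<bullet> (\<Phi> x0 - \<Phi> x0)"
      by (intro tendsto_intros \<Phi>X)
    then show "(\<lambda>k. \<phi> (X k)) \<longlonglongrightarrow> \<phi> x0"
      using rep_N[OF x0_N] g_z by (simp add: rep_N[OF XN] gX)
    \<comment> \<open>Both values lie on the supporting plane of \<open>l\<close> and the
      subgradient comes from the same \<open>l\<close>, so \<open>g\<close> drops out and the
      quotient is exactly that of \<open>l \<bullet> \<Phi>\<close>.\<close>
    have quot: "second_order_quotient \<phi> (T k) (X k) (transpose (J (X k)) *v l) (W k)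
        = ereal (l \<bullet> ((\<Phi> (X k + T k *\<^sub>R W k) - \<Phi> (X k) - T k *\<^sub>R (J (X k) *v W k)) /\<^sub>R (1/2 * (T k)\<^sup>2)))" for k
    proof -
      have "\<phi> (X k + T k *\<^sub>R W k) = ereal (val + l \<bullet> (\<Phi> (X k + T k *\<^sub>R W k) - \<Phi> x0))"
        unfolding XW using S rep_N by simp
      moreover have "\<phi> (X k) = ereal (val + l \<bullet> (\<Phi> (X k) - \<Phi> x0))"
        using rep_N[OF XN] gX by simp
      ultimately have "second_order_quotient \<phi> (T k) (X k) (transpose (J (X k)) *v l) (W k)
        = ereal ((val + l \<bullet> (\<Phi> (X k + T k *\<^sub>R W k) - \<Phi> x0) - (val + l \<bullet> (\<Phi> (X k) - \<Phi> x0))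
            - T k * ((transpose (J (X k)) *v l) \<bullet> W k)) / (1/2 * (T k)\<^sup>2))"
        using T(1)[of k] by (simp add: second_order_quotient_def)
      also have "val + l \<bullet> (\<Phi> (X k + T k *\<^sub>R W k) - \<Phi> x0) - (val + l \<bullet> (\<Phi> (X k) - \<Phi> x0))
            - T k * ((transpose (J (X k)) *v l) \<bullet> W k)
          = l \<bullet> (\<Phi> (X k + T k *\<^sub>R W k) - \<Phi> (X k) - T k *\<^sub>R (J (X k) *v W k))"
        by (simp add: inner_transpose inner_diff_right)
      finally show ?thesis
        by (simp only: inner_scaleR_right divide_inverse mult.commute)
    qed
    show "(\<lambda>k. second_order_quotient \<phi> (T k) (X k) (transpose (J (X k)) *v l) (W k))
        \<longlonglongrightarrow> ereal (l \<bullet> second_derivative \<Phi> x0 w)"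
      unfolding quot
      by (intro tendsto_intros tendsto_ereal second_order_expansion[OF C2_N[OF x0_N] Tf W X])
  qed
qed

lemma strict_second_subderivative_eq:
  "strict_second_subderivative \<phi> x0 (transpose (J x0) *v l) w
    = ereal (l \<bullet> second_derivative \<Phi> x0 w) + indicator_fun (span (critical_cone g (\<Phi> x0) l)) (J x0 *v w)"
proof (cases "J x0 *v w \<in> span (critical_cone g (\<Phi> x0) l)")
  case True
  then show ?thesis
    using strict_second_subderivative_le[of w] strict_second_subderivative_ge[of w]
    by (intro antisym) (simp_all add: indicator_fun_def)
next
  case False
  then show ?thesis using strict_second_subderivative_ge[of w] by (simp add: indicator_fun_def)
qed

end

section \<open>From the qualification condition to the setting of the chain rule\<close>

text \<open>\<open>L\<close> lies in the coderivative at 0, so SOQC makes the transposed Jacobian at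
  \<open>x0\<close> injective on it; continuity of the Jacobian extends this to a uniform bound on a
  neighbourhood.\<close>

lemma composite_polyhedralI:
  fixes \<Phi> :: "real^'n \<Rightarrow> real^'m"
  assumes rep: "composite_representation \<phi> g \<Phi> x0" and l: "l \<in> subdifferential g (\<Phi> x0)"
    and SOQC: "SOQC g \<Phi> x0 l"
  obtains N c where "composite_polyhedral g \<Phi> x0 l \<phi> N c"
proof -
  interpret polyhedral_subgradient g "\<Phi> x0" l
    using rep l by unfold_locales (simp_all add: composite_representation_def)
  have C2: "C2_around \<Phi> x0" using rep by (simp add: composite_representation_def)
  obtain O' where O': "open O'" "x0 \<in> O'" "\<And>y. y \<in> O' \<Longrightarrow> \<phi> y = g (\<Phi> y)"
    using rep unfolding composite_representation_def by blast
  \<comment> \<open>An open set witnessing \<open>C2_around\<close> at \<open>x0\<close> is a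
    witness at each of its points.\<close>
  obtain U where U: "open U" "x0 \<in> U" "\<And>y. y \<in> U \<Longrightarrow> C2_around \<Phi> y"
    using C2 unfolding C2_around_def by meson
  have inj: "\<eta> = 0" if "\<eta> \<in> parallel_space" "transpose (jacobian \<Phi> (at x0)) *v \<eta> = 0" for \<eta>
    using that parallel_space_subset_coderivative SOQC unfolding SOQC_def by blast
  have J: "((\<lambda>x. jacobian \<Phi> (at x)) \<longlongrightarrow> jacobian \<Phi> (at x0)) (nhds x0)"
    by (rule tendsto_jacobian[OF C2 filterlim_ident])
  obtain c where c: "0 < c"
    "\<forall>\<^sub>F x in nhds x0. \<forall>\<eta>\<in>parallel_space. c * norm \<eta> \<le> norm (transpose (jacobian \<Phi> (at x)) *v \<eta>)"
    using transpose_injective_nearby[OF subspace_parallel_space inj J] by blast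
  then obtain W where W: "open W" "x0 \<in> W"
    "\<And>x \<eta>. x \<in> W \<Longrightarrow> \<eta> \<in> parallel_space \<Longrightarrow> c * norm \<eta> \<le> norm (transpose (jacobian \<Phi> (at x)) *v \<eta>)"
    unfolding eventually_nhds by blast
  have "composite_polyhedral g \<Phi> x0 l \<phi> (O' \<inter> U \<inter> W) c"
    by unfold_locales (use O' U W c in auto)
  then show thesis by (rule that)
qed

section \<open>The identity mapping\<close>

lemma jacobian_ident: "jacobian (\<lambda>y::real^'m. y) (at x) = mat 1"
proof -
  have "frechet_derivative (\<lambda>y::real^'m. y) (at x) = (\<lambda>h. h)"
    by (rule frechet_derivative_at[symmetric]) (rule has_derivative_ident)
  then show ?thesis by (simp add: jacobian_def matrix_def mat_def axis_def vec_eq_iff)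
qed

lemma gradient_component: "gradient (\<lambda>y::real^'m. y $ i) x = axis i 1"
proof -
  have "frechet_derivative (\<lambda>y::real^'m. y $ i) (at x) = (\<lambda>h. h $ i)"
    by (rule frechet_derivative_at[symmetric]) (rule bounded_linear_imp_has_derivative[OF bounded_linear_vec_nth])
  then show ?thesis by (auto simp: gradient_def vec_eq_iff axis_def)
qed

lemma hessian_component: "hessian (\<lambda>y::real^'m. y $ i) x = 0"
proof -
  have "frechet_derivative (\<lambda>x::real^'m. axis i (1::real)) (at x) = (\<lambda>h. 0)"
    by (rule frechet_derivative_at[symmetric]) (rule has_derivative_const)
  then show ?thesis
    by (simp add: hessian_def gradient_component[abs_def] jacobian_def matrix_def vec_eq_iff)
qed

lemma second_derivative_ident: "second_derivative (\<lambda>y::real^'m. y) x w = 0"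
  by (simp add: second_derivative_def hessian_component vec_eq_iff)

lemma C2_around_ident: "C2_around (\<lambda>y::real^'m. y) x"
  unfolding C2_around_def
  by (intro exI[of _ UNIV]) (simp add: gradient_component[abs_def] hessian_component[abs_def])

text \<open>With the identity Jacobian the transversality bound holds with equality for
  \<open>c = 1\<close>, so \<open>g\<close> is covered as its own composite.\<close>

lemma composite_polyhedral_ident:
  fixes g :: "real^'m \<Rightarrow> ereal"
  assumes "polyhedral_function g" "l \<in> subdifferential g z"
  shows "composite_polyhedral g (\<lambda>y. y) z l g UNIV 1"
  by unfold_locales (use assms in \<open>simp_all add: C2_around_ident jacobian_ident transpose_mat\<close>)

theorem theorem3p5:
  fixes \<phi> :: "real^'n \<Rightarrow> ereal" and g :: "real^'m \<Rightarrow> ereal"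
    and \<Phi> :: "real^'n \<Rightarrow> real^'m"
    and xbar vbar :: "real^'n" and lbar :: "real^'m"
  assumes "\<bar>\<phi> xbar\<bar> \<noteq> \<infinity>"
    and "composite_representation \<phi> g \<Phi> xbar"
    and "vbar \<in> subdifferential \<phi> xbar"
    and "lbar \<in> multipliers g \<Phi> xbar vbar"
    and "SOQC g \<Phi> xbar lbar"
  shows "(\<forall>w. strict_second_subderivative \<phi> xbar vbar w
              = ereal (lbar \<bullet> second_derivative \<Phi> xbar w)
                + strict_second_subderivative g (\<Phi> xbar) lbar (jacobian \<Phi> (at xbar) *v w))
       \<and> (\<forall>u. strict_second_subderivative g (\<Phi> xbar) lbar u
              = indicator_fun (span (critical_cone g (\<Phi> xbar) lbar)) u)"
proof -
  have vbar: "vbar = transpose (jacobian \<Phi> (at xbar)) *v lbar"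
    and lbar: "lbar \<in> subdifferential g (\<Phi> xbar)"
    using assms(4) by (auto simp: multipliers_def)
  have g: "polyhedral_function g" using assms(2) by (simp add: composite_representation_def)
  obtain N c where "composite_polyhedral g \<Phi> xbar lbar \<phi> N c"
    using composite_polyhedralI[OF assms(2) lbar assms(5)] by blast
  note eq_\<phi> = composite_polyhedral.strict_second_subderivative_eq[OF this]
  \<comment> \<open>The identity has no curvature, so only the indicator term survives.\<close>
  have eq_g: "strict_second_subderivative g (\<Phi> xbar) lbar u
      = indicator_fun (span (critical_cone g (\<Phi> xbar) lbar)) u" for u
    using composite_polyhedral.strict_second_subderivative_eq[OF composite_polyhedral_ident[OF g lbar], of u]
    by (simp add: jacobian_ident transpose_mat second_derivative_ident flip: zero_ereal_def)
  show ?thesis by (simp add: eq_\<phi> eq_g vbar)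
qed

end
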